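(* Let $C$ be a compact tropical curve of genus $g$ with a fixed reference point $p_0\in C$. Let $W_{g-1}\subset J(C)$ be the set of all $\mu(D)$ with $D$ an effective divisor of degree $g-1$ on $C$, let $[\Theta]\subset J(C)$ be the theta divisor, and let $\kappa\in J(C)$ be the Jacobi inversion constant. Then $$W_{g-1}+\kappa=[\Theta].$$
   Context: Compact tropical curves. A compact tropical curve $C$ is a connected finite (1-dimensional) graph, loops and multiple edges allowed, with a metric structure: each inner edge (one not adjacent to a 1-valent vertex) has a finite positive length, and each leaf (edge adjacent to a 1-valent vertex) has infinite length, the 1-valent vertices (the endpoints) lying at infinity. 2-valent vertices may be inserted or removed freely. The genus is $g=b_1(C)$. A divisor is a finite formal sum $D=\sum a_ip_i$, $a_i\in\mathbb{Z}$, $p_i\in C$; its degree is $\sum a_i$; it is effective if all $a_i\ge0$. Jacobian. A 1-form $\omega$ on $C$ assigns a real number $\omega(\xi)$ to each unit tangent vector $\xi$ along each edge, constant along the edge, with $\omega(-\xi)=-\omega(\xi)$, such that at each point (endpoints included) the sum of $\omega(\xi)$ over outward unit vectors $\xi$ is $0$ (so $\omega$ vanishes on leaves). $\Omega(C)$ is the $g$-dimensional real vector space of 1-forms. Integration over cycles embeds $\Lambda=H_1(C,\mathbb{Z})$ as a lattice in $\Omega(C)^*$, and $J(C)=\Omega(C)^*/\Lambda$. For $D=\sum a_ip_i$, $\mu(D)\in J(C)$ is the class of $\omega\mapsto\sum_i a_i\int_{p_0}^{p_i}\omega$ (paths arbitrary). In particular there is a map $\mu:C\to J(C)$, $p\mapsto\mu(p)$,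 and it lifts to $\hat\mu:\hat C\to\Omega(C)^*$ on the universal cover $\hat C$ of $C$. Theta function. Let $Q$ be the positive definite symmetric bilinear form on $\Lambda$ given on cycles written as edge chains by $Q(\sum_E a(E)E,\sum_E b(E)E)=\sum_E a(E)b(E)\,\mathrm{length}(E)$, extended bilinearly to $\Omega(C)^*\cong\Lambda\otimes\mathbb{R}$. Put $\Theta(x)=\max_{\nu\in\Lambda}\{Q(\nu,x)-\tfrac12Q(\nu,\nu)\}$ for $x\in\Omega(C)^*$. Its corner locus (the set of points where $\Theta$ is not locally affine) is $\Lambda$-periodic and $[\Theta]\subset J(C)$ denotes its image. For $\lambda\in J(C)$ with a lift $\tilde\lambda\in\Omega(C)^*$ let $\Theta_\lambda(x)=\Theta(x-\tilde\lambda)$ and $[\Theta_\lambda]=[\Theta]+\lambda$. The divisor $D_\lambda=\mu^*[\Theta_\lambda]$ on $C$ has as coefficient at $p\in C$ the sum of slopes, along all edge directions emanating from a lift $\hat p\in\hat C$ of $p$, of the piecewise linear function $\Theta_\lambda\circ\hat\mu$ at $\hat p$ (independent of the lifts). Jacobi inversion constant. There is a unique element $\kappa\in J(C)$ (depending on $C$ and $p_0$) such that $\mu(D_\lambda)+\kappa=\lambda$ for all $\lambda\in J(C)$; this is the constant $\kappa$ in the claim. *)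

theory Defs
  imports
    "HOL-Analysis.Analysis"
    "HOL-Library.Function_Algebras"
    "HOL-Library.Set_Algebras"
    "Graph_Theory.Digraph_Component"
begin

text \<open>Chains, 1-forms and functionals on 1-forms are plain functions; the following pointwise
  structure makes them real vector spaces.\<close>

instantiation "fun" :: (type, scaleR) scaleR
begin

definition scaleR_fun_def: "c *\<^sub>R f = (\<lambda>x. c *\<^sub>R f x)"

instance ..

end

instance "fun" :: (type, real_vector) real_vector
  by standard (simp_all add: scaleR_fun_def plus_fun_def fun_eq_iff algebra_simps)


section \<open>Compact tropical curves\<close>

text \<open>The arcs are the edges, each with an auxiliary orientation.\<close>

record ('v, 'e) metric_graph =
  graph :: "('v, 'e) pre_digraph"
  edge_length :: "'e \<Rightarrow> ereal"

definition valence :: "('v, 'e) metric_graph \<Rightarrow> 'v \<Rightarrow> nat" where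
  "valence C v = out_degree (graph C) v + in_degree (graph C) v"

text \<open>The edge \<open>e\<close> is parametrised by arc length \<open>t \<in> [0, edge_length C e]\<close> from its tail to its
  head.  Leaves are oriented towards infinity, so that \<open>t = \<infinity>\<close> is the 1-valent endpoint; this is
  what the last axiom says.  A curve homeomorphic to \<open>[-\<infinity>, \<infinity>]\<close> is given with a 2-valent vertex
  in its interior, and a circle with a 2-valent vertex carrying a loop.\<close>

definition tropical_curve :: "('v, 'e) metric_graph \<Rightarrow> bool" where
  "tropical_curve C \<longleftrightarrow>
     fin_digraph (graph C) \<and> Digraph_Component.connected (graph C) \<and>
     (\<forall>e\<in>arcs (graph C). 0 < edge_length C e) \<and>
     (\<forall>e\<in>arcs (graph C). edge_length C e = \<infinity> \<longleftrightarrow> valence C (head (graph C) e) = 1) \<and>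
     (\<forall>e\<in>arcs (graph C). valence C (tail (graph C) e) \<noteq> 1)"

datatype ('v, 'e) point = Vertex 'v | Interior 'e real

definition points :: "('v, 'e) metric_graph \<Rightarrow> ('v, 'e) point set" where
  "points C = Vertex ` verts (graph C) \<union>
     {Interior e t | e t. e \<in> arcs (graph C) \<and> 0 < t \<and> ereal t < edge_length C e}"

definition point_at :: "('v, 'e) metric_graph \<Rightarrow> 'e \<Rightarrow> ereal \<Rightarrow> ('v, 'e) point" where
  "point_at C e t =
     (if t = 0 then Vertex (tail (graph C) e)
      else if t = edge_length C e then Vertex (head (graph C) e)
      else Interior e (real_of_ereal t))"

text \<open>\<open>(e, t, \<epsilon>)\<close> is the unit tangent vector at the point with parameter \<open>t\<close> of the edge \<open>e\<close>,
  directed along \<open>e\<close> if \<open>\<epsilon> = 1\<close> and against \<open>e\<close> if \<open>\<epsilon> = -1\<close>.  A loop contributes two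
  vectors at its vertex.\<close>

definition unit_tangents :: "('v, 'e) metric_graph \<Rightarrow> ('v, 'e) point \<Rightarrow> ('e \<times> ereal \<times> real) set" where
  "unit_tangents C p =
     {(e, t, \<epsilon>). e \<in> arcs (graph C) \<and> 0 \<le> t \<and> t \<le> edge_length C e \<and> point_at C e t = p \<and>
        (\<epsilon> = 1 \<and> t < edge_length C e \<or> \<epsilon> = -1 \<and> 0 < t)}"


section \<open>Cycles, 1-forms and the Jacobian\<close>

text \<open>\<open>cycles C\<close> is \<open>H\<^sub>1(C, R)\<close>, where \<open>R\<close> is the coefficient ring \<open>'r\<close>.\<close>

definition cycles :: "('v, 'e) metric_graph \<Rightarrow> ('e \<Rightarrow> 'r::comm_ring_1) set" where
  "cycles C = {a. (\<forall>e. e \<notin> arcs (graph C) \<longrightarrow> a e = 0) \<and>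
     (\<forall>v\<in>verts (graph C). (\<Sum>e\<in>in_arcs (graph C) v. a e) = (\<Sum>e\<in>out_arcs (graph C) v. a e))}"

definition genus :: "('v, 'e) metric_graph \<Rightarrow> nat" where
  "genus C = dim (cycles C :: ('e \<Rightarrow> real) set)"

text \<open>A 1-form is constant along each edge and odd, so it is recorded by its values \<open>\<omega> e\<close> on the
  unit tangent vectors in the direction of \<open>e\<close>; its value on \<open>(e, t, \<epsilon>)\<close> is \<open>\<epsilon> * \<omega> e\<close>.\<close>

definition one_forms :: "('v, 'e) metric_graph \<Rightarrow> ('e \<Rightarrow> real) set" where
  "one_forms C = {\<omega>. (\<forall>e. e \<notin> arcs (graph C) \<longrightarrow> \<omega> e = 0) \<and>
     (\<forall>p\<in>points C. (\<Sum>(e, t, \<epsilon>)\<in>unit_tangents C p. \<epsilon> * \<omega> e) = 0)}"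

text \<open>Functionals on \<^const>\<open>one_forms\<close> are extended by 0 to all functions.\<close>

definition dual_forms :: "('v, 'e) metric_graph \<Rightarrow> (('e \<Rightarrow> real) \<Rightarrow> real) set" where
  "dual_forms C = {x. (\<forall>\<omega>. \<omega> \<notin> one_forms C \<longrightarrow> x \<omega> = 0) \<and>
     (\<forall>\<omega>\<in>one_forms C. \<forall>\<eta>\<in>one_forms C. x (\<omega> + \<eta>) = x \<omega> + x \<eta>) \<and>
     (\<forall>c. \<forall>\<omega>\<in>one_forms C. x (c *\<^sub>R \<omega>) = c * x \<omega>)}"

text \<open>Integration over a chain.  The junk value \<open>real_of_ereal \<infinity> = 0\<close> is harmless here and below:
  1-forms and cycles vanish on the edges of infinite length.\<close>

definition chain_integral ::
  "('v, 'e) metric_graph \<Rightarrow> ('e \<Rightarrow> real) \<Rightarrow> ('e \<Rightarrow> real) \<Rightarrow> real" where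
  "chain_integral C b = (\<lambda>\<omega>. if \<omega> \<in> one_forms C
     then (\<Sum>e\<in>arcs (graph C). b e * \<omega> e * real_of_ereal (edge_length C e)) else 0)"

definition lattice :: "('v, 'e) metric_graph \<Rightarrow> (('e \<Rightarrow> real) \<Rightarrow> real) set" where
  "lattice C = {chain_integral C (\<lambda>e. real_of_int (a e)) | a. a \<in> cycles C}"

text \<open>Elements of the Jacobian are cosets of the lattice, added as sets; the elements of a coset
  are its lifts.\<close>

definition jacobian :: "('v, 'e) metric_graph \<Rightarrow> (('e \<Rightarrow> real) \<Rightarrow> real) set set" where
  "jacobian C = {x +o lattice C | x. x \<in> dual_forms C}"


section \<open>Paths and the Abel-Jacobi map\<close>

text \<open>A path is a list of segments \<open>(e, s, t)\<close>, each running inside the edge \<open>e\<close> from parameter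
  \<open>s\<close> to parameter \<open>t\<close>.\<close>

inductive is_path ::
  "('v, 'e) metric_graph \<Rightarrow> ('v, 'e) point \<Rightarrow> ('e \<times> ereal \<times> ereal) list \<Rightarrow> ('v, 'e) point \<Rightarrow> bool"
  for C where
  Nil: "p \<in> points C \<Longrightarrow> is_path C p [] p"
| Cons: "\<lbrakk>e \<in> arcs (graph C); 0 \<le> s; s \<le> edge_length C e; 0 \<le> t; t \<le> edge_length C e;
     is_path C (point_at C e t) xs q\<rbrakk> \<Longrightarrow> is_path C (point_at C e s) ((e, s, t) # xs) q"

text \<open>A path from \<open>p\<^sub>0\<close> represents a point of the universal cover, and \<open>path_integral C xs\<close> is the
  image of that point in the dual of the space of 1-forms under the lifted Abel-Jacobi map.\<close>

definition path_integral ::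
  "('v, 'e) metric_graph \<Rightarrow> ('e \<times> ereal \<times> ereal) list \<Rightarrow> ('e \<Rightarrow> real) \<Rightarrow> real" where
  "path_integral C xs = (\<lambda>\<omega>. if \<omega> \<in> one_forms C
     then (\<Sum>(e, s, t)\<leftarrow>xs. \<omega> e * real_of_ereal (t - s)) else 0)"

definition divisor :: "('v, 'e) metric_graph \<Rightarrow> (('v, 'e) point \<Rightarrow> int) \<Rightarrow> bool" where
  "divisor C D \<longleftrightarrow> finite {p. D p \<noteq> 0} \<and> {p. D p \<noteq> 0} \<subseteq> points C"

definition divisor_degree :: "(('v, 'e) point \<Rightarrow> int) \<Rightarrow> int" where
  "divisor_degree D = (\<Sum>p | D p \<noteq> 0. D p)"

definition effective :: "(('v, 'e) point \<Rightarrow> int) \<Rightarrow> bool" where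
  "effective D \<longleftrightarrow> (\<forall>p. 0 \<le> D p)"

definition abel_jacobi ::
  "('v, 'e) metric_graph \<Rightarrow> ('v, 'e) point \<Rightarrow> (('v, 'e) point \<Rightarrow> int) \<Rightarrow> (('e \<Rightarrow> real) \<Rightarrow> real) set" where
  "abel_jacobi C p0 D =
     (\<Sum>p | D p \<noteq> 0. real_of_int (D p) *\<^sub>R path_integral C (SOME xs. is_path C p0 xs p)) +o lattice C"

text \<open>The degree is an integer, so that for genus 0 the set \<open>W\<^sub>g\<^sub>-\<^sub>1\<close> is empty.\<close>

definition W :: "('v, 'e) metric_graph \<Rightarrow> ('v, 'e) point \<Rightarrow> int \<Rightarrow> (('e \<Rightarrow> real) \<Rightarrow> real) set set" where
  "W C p0 d = {abel_jacobi C p0 D | D. divisor C D \<and> effective D \<and> divisor_degree D = d}"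


section \<open>The theta function\<close>

text \<open>\<open>Q\<close> is extended from the lattice through the isomorphism of \<open>H\<^sub>1(C, \<real>)\<close>, that is of
  \<open>lattice C \<otimes> \<real>\<close>, with \<^const>\<open>dual_forms\<close> given by integration.\<close>

definition real_cycle :: "('v, 'e) metric_graph \<Rightarrow> (('e \<Rightarrow> real) \<Rightarrow> real) \<Rightarrow> 'e \<Rightarrow> real" where
  "real_cycle C x = (THE b. b \<in> cycles C \<and> chain_integral C b = x)"

definition Q ::
  "('v, 'e) metric_graph \<Rightarrow> (('e \<Rightarrow> real) \<Rightarrow> real) \<Rightarrow> (('e \<Rightarrow> real) \<Rightarrow> real) \<Rightarrow> real" where
  "Q C x y = (\<Sum>e\<in>arcs (graph C).
     real_cycle C x e * real_cycle C y e * real_of_ereal (edge_length C e))"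

text \<open>The supremum is attained, \<open>Q\<close> being positive definite.\<close>

definition theta :: "('v, 'e) metric_graph \<Rightarrow> (('e \<Rightarrow> real) \<Rightarrow> real) \<Rightarrow> real" where
  "theta C x = (SUP \<nu>\<in>lattice C. Q C \<nu> x - Q C \<nu> \<nu> / 2)"

text \<open>The open sets below are those of the topology of pointwise convergence on functionals, which
  induces the usual topology on the finite-dimensional space \<^const>\<open>dual_forms\<close>.\<close>

definition locally_affine_at ::
  "('v, 'e) metric_graph \<Rightarrow> ((('e \<Rightarrow> real) \<Rightarrow> real) \<Rightarrow> real) \<Rightarrow> (('e \<Rightarrow> real) \<Rightarrow> real) \<Rightarrow> bool" where
  "locally_affine_at C F x \<longleftrightarrow> (\<exists>U A. open U \<and> x \<in> U \<and>
     (\<forall>y\<in>dual_forms C. \<forall>z\<in>dual_forms C. \<forall>s::real.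
        A ((1 - s) *\<^sub>R y + s *\<^sub>R z) = (1 - s) * A y + s * A z) \<and>
     (\<forall>y\<in>U \<inter> dual_forms C. F y = A y))"

definition theta_divisor :: "('v, 'e) metric_graph \<Rightarrow> (('e \<Rightarrow> real) \<Rightarrow> real) set set" where
  "theta_divisor C =
     {x +o lattice C | x. x \<in> dual_forms C \<and> \<not> locally_affine_at C (theta C) x}"


section \<open>The pulled-back divisor and the Jacobi inversion constant\<close>

text \<open>Slope of the pullback of \<open>F\<close> to the universal cover, at the point represented by the path
  \<open>xs\<close>, in the direction of a unit tangent vector: the path is prolonged by a segment of length
  \<open>s\<close>.  At an infinite endpoint the prolongation is constant, since \<open>\<infinity> - s = \<infinity>\<close>, and
  the slope is 0; this is the slope along a leaf, as 1-forms vanish on leaves.\<close>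

definition outgoing_slope ::
  "('v, 'e) metric_graph \<Rightarrow> ((('e \<Rightarrow> real) \<Rightarrow> real) \<Rightarrow> real) \<Rightarrow>
     ('e \<times> ereal \<times> ereal) list \<Rightarrow> 'e \<times> ereal \<times> real \<Rightarrow> real" where
  "outgoing_slope C F xs = (\<lambda>(e, t, \<epsilon>).
     vector_derivative (\<lambda>s. F (path_integral C (xs @ [(e, t, t + ereal (\<epsilon> * s))]))) (at_right 0))"

text \<open>The coefficients of \<open>\<mu>\<^sup>*[\<Theta>\<^sub>\<lambda>]\<close> are integers because the functions over which
  \<^const>\<open>theta\<close> is the supremum have integral slopes along the edges; \<open>THE\<close> picks that integer.
  The argument
  \<open>j\<close> is \<open>\<lambda>\<close>; \<open>l\<close> is its lift and \<open>xs\<close> stands for the lift of \<open>p\<close>.\<close>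

definition theta_pullback ::
  "('v, 'e) metric_graph \<Rightarrow> ('v, 'e) point \<Rightarrow> (('e \<Rightarrow> real) \<Rightarrow> real) set \<Rightarrow> ('v, 'e) point \<Rightarrow> int" where
  "theta_pullback C p0 j p = (if p \<in> points C
     then (let l = (SOME l. l \<in> j); xs = (SOME xs. is_path C p0 xs p)
       in THE n. real_of_int n =
         (\<Sum>\<xi>\<in>unit_tangents C p. outgoing_slope C (\<lambda>x. theta C (x - l)) xs \<xi>))
     else 0)"

definition jacobi_inversion_constant ::
  "('v, 'e) metric_graph \<Rightarrow> ('v, 'e) point \<Rightarrow> (('e \<Rightarrow> real) \<Rightarrow> real) set \<Rightarrow> bool" where
  "jacobi_inversion_constant C p0 \<kappa> \<longleftrightarrow> \<kappa> \<in> jacobian C \<and>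
     (\<forall>j\<in>jacobian C. abel_jacobi C p0 (theta_pullback C p0 j) + \<kappa> = j)"

end

theory Submission
  imports Defs
begin

text \<open>
  Let \<open>N x\<close> be the set of lattice points attaining the maximum in \<open>\<Theta>(x)\<close>; then \<open>[\<Theta>]\<close> consists of the
  classes of those \<open>x\<close> for which \<open>N x\<close> has at least two elements, it is symmetric, and every pulled-back
  divisor \<open>D\<^sub>\<lambda>\<close> is effective of degree \<open>g\<close>.

  If \<open>\<lambda> \<in> [\<Theta>]\<close>, two elements of \<open>N (-\<lambda>)\<close> differ on some edge.  For \<open>q\<close> inside that edge the divisor
  \<open>D\<^bsub>\<lambda> + \<mu>(q)\<^esub>\<close> contains \<open>q\<close>, and \<open>D\<^bsub>\<lambda> + \<mu>(q)\<^esub> - q\<close> is effective of degree \<open>g - 1\<close> with image \<open>\<lambda> - \<kappa>\<close>.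

  Conversely let \<open>\<lambda> = \<mu>(D) + \<kappa>\<close> with \<open>D\<close> effective of degree \<open>g - 1\<close>, and suppose \<open>\<lambda> \<notin> [\<Theta>]\<close>.  Lift so
  that \<open>N (-\<lambda>) = {0}\<close>, that is, so that the cost \<open>|c|\<^sup>2/2 + x(c)\<close>, where \<open>x = -\<lambda>\<close>, is positive on nonzero
  cycles.  By Jacobi inversion and Abel's theorem \<open>D + q = D\<^bsub>\<lambda> + \<mu>(q)\<^esub> + div \<phi>\<close>.  Completing the square
  identifies the theta function along the curve with the minimal cost of an integral flow from \<open>q\<close>, and
  minimal flows are simple paths.  Hence \<open>D\<^bsub>\<lambda> + \<mu>(q)\<^esub> - q\<close> has at \<open>y\<close> the coefficient \<open>-1\<close> plus the number of
  directions from which minimal flows arrive at \<open>y\<close>.  Where \<open>\<phi>\<close> is maximal, this orientation being acyclic,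
  some point is not reached from inside the maximum set, and there \<open>D\<close> is negative.
\<close>

section \<open>Integral flows on finite networks\<close>

text \<open>The translate \<open>\<lambda> + \<mu>(q)\<close> is used because the argument of its
  theta function at \<open>q\<close> is a lift of \<open>-\<lambda>\<close>, whatever
  \<open>q\<close> is; hence both inclusions inspect \<open>N (-\<lambda>)\<close>, and the symmetry
  of the theta function is needed. The constant \<kappa> enters only through its independence of
  \<lambda>.

  The converse needs finite combinatorics, and three things obstruct it. Leaves have infinite
  length, so the divisor is pushed off them. Divisors may have points inside edges, so the edges are
  cut there. And the maximum in the theta function runs over cycles, not over paths: a chain
  \<open>c\<close> from \<open>q\<close> to \<open>y\<close> represents a lift of \<open>y\<close>,
  and \<open>cost (c - a)\<close> is \<open>cost c\<close> minus the value at the corresponding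
  argument of the affine piece given by the cycle \<open>a\<close>.

  The orientation is acyclic by an exchange argument: if some minimal flow arrives at
  \<open>y\<close> through a segment from \<open>z\<close>, then every minimal flow to
  \<open>z\<close>, prolonged by that segment, is minimal for \<open>y\<close>. The number of
  segments in a longest minimal flow therefore increases strictly along the orientation.\<close>

locale network =
  fixes V :: "'v set" and S :: "'s set" and tl hd :: "'s \<Rightarrow> 'v"
  assumes finite_V [simp]: "finite V" and finite_S [simp]: "finite S"
    and tl_in: "\<sigma> \<in> S \<Longrightarrow> tl \<sigma> \<in> V" and hd_in: "\<sigma> \<in> S \<Longrightarrow> hd \<sigma> \<in> V"
begin

definition bd :: "('s \<Rightarrow> 'r::comm_ring_1) \<Rightarrow> 'v \<Rightarrow> 'r" where
  "bd c y = (\<Sum>\<sigma>\<in>{\<sigma>\<in>S. hd \<sigma> = y}. c \<sigma>) - (\<Sum>\<sigma>\<in>{\<sigma>\<in>S. tl \<sigma> = y}. c \<sigma>)"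

definition chain :: "('s \<Rightarrow> 'r::comm_ring_1) \<Rightarrow> bool" where
  "chain c \<longleftrightarrow> (\<forall>\<sigma>. \<sigma> \<notin> S \<longrightarrow> c \<sigma> = 0)"

definition chains_from_to :: "'v \<Rightarrow> 'v \<Rightarrow> ('s \<Rightarrow> int) set" where
  "chains_from_to q y = {c. chain c \<and> (\<forall>v\<in>V. bd c v = of_bool (v = y) - of_bool (v = q))}"

definition cycs :: "('s \<Rightarrow> int) set" where
  "cycs = {c. chain c \<and> (\<forall>v\<in>V. bd c v = 0)}"

lemma bd_add: "bd (\<lambda>\<sigma>. c \<sigma> + d \<sigma>) y = bd c y + bd d y"
  by (simp add: bd_def sum.distrib)

lemma bd_diff: "bd (\<lambda>\<sigma>. c \<sigma> - d \<sigma>) y = bd c y - bd d y"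
  by (simp add: bd_def sum_subtractf)

lemma bd_uminus: "bd (\<lambda>\<sigma>. - c \<sigma>) y = - bd c y"
  by (simp add: bd_def sum_negf)

lemma bd_zero [simp]: "bd (\<lambda>\<sigma>. 0) y = 0"
  by (simp add: bd_def)

lemma bd_cmult: "bd (\<lambda>\<sigma>. k * c \<sigma>) y = k * bd c y"
  by (simp add: bd_def sum_distrib_left algebra_simps)

lemma bd_sum: "bd (\<lambda>\<sigma>. \<Sum>i\<in>I. f i \<sigma>) y = (\<Sum>i\<in>I. bd (f i) y)"
  unfolding bd_def by (subst sum.swap, subst (2) sum.swap) (simp add: sum_subtractf)

lemma bd_of_int: "bd (\<lambda>\<sigma>. of_int (c \<sigma>)) y = of_int (bd c y)"
  by (simp add: bd_def)

lemma bd_unit: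
  assumes "\<sigma> \<in> S"
  shows "bd (\<lambda>\<tau>. if \<tau> = \<sigma> then k else 0) y = k * (of_bool (y = hd \<sigma>) - of_bool (y = tl \<sigma>))"
  using assms by (auto simp: bd_def)

text \<open>Summation by parts: the boundary operator is adjoint to taking differences along
  segments. A constant \<open>f\<close> shows that the total boundary is 0, an indicator function
  \<open>f\<close> gives the net flow through a cut.\<close>

lemma sum_bd:
  "(\<Sum>y\<in>V. f y * bd c y) = (\<Sum>\<sigma>\<in>S. c \<sigma> * (f (hd \<sigma>) - f (tl \<sigma>)))"
proof -
  have *: "(\<Sum>y\<in>V. f y * (\<Sum>\<sigma>\<in>{\<sigma>\<in>S. g \<sigma> = y}. c \<sigma>)) = (\<Sum>\<sigma>\<in>S. c \<sigma> * f (g \<sigma>))"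
    if "\<And>\<sigma>. \<sigma> \<in> S \<Longrightarrow> g \<sigma> \<in> V" for g
  proof -
    have "(\<Sum>y\<in>V. f y * (\<Sum>\<sigma>\<in>{\<sigma>\<in>S. g \<sigma> = y}. c \<sigma>)) =
        (\<Sum>y\<in>V. \<Sum>\<sigma>\<in>{\<sigma>\<in>S. g \<sigma> = y}. c \<sigma> * f (g \<sigma>))"
      by (simp add: sum_distrib_left mult.commute)
    also have "\<dots> = (\<Sum>\<sigma>\<in>S. c \<sigma> * f (g \<sigma>))"
      by (rule sum.group) (use that in auto)
    finally show ?thesis .
  qed
  show ?thesis
    using *[of hd] *[of tl] hd_in tl_in
    by (simp add: bd_def right_diff_distrib sum_subtractf)
qed

lemma chain_zero [simp]: "chain (\<lambda>\<sigma>. 0)" by (simp add: chain_def)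

lemma chain_add: "chain c \<Longrightarrow> chain d \<Longrightarrow> chain (\<lambda>\<sigma>. c \<sigma> + d \<sigma>)" by (simp add: chain_def)

lemma chain_diff: "chain c \<Longrightarrow> chain d \<Longrightarrow> chain (\<lambda>\<sigma>. c \<sigma> - d \<sigma>)" by (simp add: chain_def)

lemma chain_unit: "\<sigma> \<in> S \<Longrightarrow> chain (\<lambda>\<tau>. if \<tau> = \<sigma> then k else 0)" by (auto simp: chain_def)

lemma chains_from_to_diff:
  "c \<in> chains_from_to q y \<Longrightarrow> d \<in> chains_from_to q y \<Longrightarrow> (\<lambda>\<sigma>. c \<sigma> - d \<sigma>) \<in> cycs"
  by (auto simp: chains_from_to_def cycs_def chain_diff bd_diff)

lemma chains_from_to_diff_cyc:
  "c \<in> chains_from_to q y \<Longrightarrow> d \<in> cycs \<Longrightarrow> (\<lambda>\<sigma>. c \<sigma> - d \<sigma>) \<in> chains_from_to q y"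
  by (auto simp: chains_from_to_def cycs_def chain_diff bd_diff)

lemma chains_from_to_trans:
  "c \<in> chains_from_to x y \<Longrightarrow> d \<in> chains_from_to y z \<Longrightarrow> (\<lambda>\<sigma>. c \<sigma> + d \<sigma>) \<in> chains_from_to x z"
  by (auto simp: chains_from_to_def chain_add bd_add)

lemma zero_in_cycs: "(\<lambda>\<sigma>. 0) \<in> cycs"
  by (simp add: cycs_def)

lemma cycs_uminus: "c \<in> cycs \<Longrightarrow> (\<lambda>\<sigma>. - c \<sigma>) \<in> cycs"
  by (auto simp: cycs_def chain_def bd_uminus)

lemma unit_in_chains:
  "\<sigma> \<in> S \<Longrightarrow> (\<lambda>\<tau>. if \<tau> = \<sigma> then 1 else 0) \<in> chains_from_to (tl \<sigma>) (hd \<sigma>)"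
  by (simp add: chains_from_to_def chain_unit bd_unit)

lemma uminus_in_chains:
  "c \<in> chains_from_to x y \<Longrightarrow> (\<lambda>\<tau>. - c \<tau>) \<in> chains_from_to y x"
  by (auto simp: chains_from_to_def chain_def bd_uminus)

lemma zero_in_chains: "(\<lambda>\<tau>. 0) \<in> chains_from_to x x"
  by (simp add: chains_from_to_def)

text \<open>A flow from \<open>q\<close> to \<open>t\<close> contains a simple directed path; the path is found by breadth-first
  search in the support of the flow.\<close>

lemma simple_path_in_flow:
  assumes c: "c \<in> chains_from_to q t" and q: "q \<in> V" and t: "t \<in> V"
  obtains d where "d \<in> chains_from_to q t" "\<And>\<sigma>. d \<sigma> = 0 \<or> d \<sigma> = sgn (c \<sigma>)"
    "\<And>\<sigma>. \<sigma> \<in> S \<Longrightarrow> tl \<sigma> = t \<Longrightarrow> d \<sigma> \<le> 0" "\<And>\<sigma>. \<sigma> \<in> S \<Longrightarrow> hd \<sigma> = t \<Longrightarrow> 0 \<le> d \<sigma>"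
proof -
  \<comment> \<open>One search step follows a segment along its orientation where \<open>c\<close>
    is positive and against it where \<open>c\<close> is negative.\<close>
  define stp where "stp X = X \<union> {hd \<sigma> |\<sigma>. \<sigma> \<in> S \<and> 0 < c \<sigma> \<and> tl \<sigma> \<in> X}
      \<union> {tl \<sigma> |\<sigma>. \<sigma> \<in> S \<and> c \<sigma> < 0 \<and> hd \<sigma> \<in> X}" for X
  define R where "R n = (stp ^^ n) {q}" for n
  have R0: "R 0 = {q}" and RS: "\<And>n. R (Suc n) = stp (R n)"
    by (simp_all add: R_def)
  \<comment> \<open>The last clause confines the path to vertices found within \<open>n\<close>
    steps. A vertex first found at step \<open>n + 1\<close> is then met by no segment of the path
    being prolonged, which secures the sign conditions at the new end.\<close>
  define P where "P n v d \<longleftrightarrow> d \<in> chains_from_to q v \<and> (\<forall>\<sigma>. d \<sigma> = 0 \<or> d \<sigma> = sgn (c \<sigma>)) \<and>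
      (\<forall>\<sigma>\<in>S. tl \<sigma> = v \<longrightarrow> d \<sigma> \<le> 0) \<and> (\<forall>\<sigma>\<in>S. hd \<sigma> = v \<longrightarrow> 0 \<le> d \<sigma>) \<and>
      (\<forall>\<sigma>. d \<sigma> \<noteq> 0 \<longrightarrow> tl \<sigma> \<in> R n \<and> hd \<sigma> \<in> R n)" for n v d
  have sub: "R n \<subseteq> R (Suc n)" for n unfolding RS stp_def by blast
  have P_mono: "P n v d \<Longrightarrow> P (Suc n) v d" for n v d
    using sub[of n] unfolding P_def by (meson subsetD)
  have extend: "\<exists>d. P (Suc n) v d"
    if d: "P n u d" and \<sigma>: "\<sigma> \<in> S" "u \<in> R n" "v \<notin> R n" "v \<in> R (Suc n)" "\<epsilon> = sgn (c \<sigma>)"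
      and ends: "\<epsilon> = 1 \<and> tl \<sigma> = u \<and> hd \<sigma> = v \<or> \<epsilon> = -1 \<and> hd \<sigma> = u \<and> tl \<sigma> = v" for n u v d \<sigma> \<epsilon>
  proof -
    have d0: "d \<tau> = 0" if "tl \<tau> = v \<or> hd \<tau> = v" for \<tau>
      using d \<sigma>(3) that unfolding P_def by metis
    let ?d = "\<lambda>\<tau>. d \<tau> + (if \<tau> = \<sigma> then \<epsilon> else 0)"
    have "(\<lambda>\<tau>. if \<tau> = \<sigma> then \<epsilon> else 0) \<in> chains_from_to u v"
      using \<sigma> ends by (auto simp: chains_from_to_def chain_unit bd_unit)
    moreover have "d \<in> chains_from_to q u" using d unfolding P_def by simp
    ultimately have "?d \<in> chains_from_to q v" by (rule chains_from_to_trans[rotated])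
    moreover have "?d \<tau> = 0 \<or> ?d \<tau> = sgn (c \<tau>)" for \<tau>
    proof (cases "\<tau> = \<sigma>")
      case True
      then show ?thesis using d0[of \<sigma>] ends \<sigma>(5) by auto
    next
      case False
      then show ?thesis using d unfolding P_def by simp
    qed
    moreover have "tl \<tau> = v \<longrightarrow> ?d \<tau> \<le> 0" "hd \<tau> = v \<longrightarrow> 0 \<le> ?d \<tau>" for \<tau>
      using d0[of \<tau>] ends \<sigma>(2,3) by auto
    moreover have "tl \<tau> \<in> R (Suc n) \<and> hd \<tau> \<in> R (Suc n)" if "?d \<tau> \<noteq> 0" for \<tau>
    proof (cases "\<tau> = \<sigma>")
      case True
      then show ?thesis using ends \<sigma>(2,4) sub[of n] by auto
    next
      case False
      then have "d \<tau> \<noteq> 0" using that by simp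
      then show ?thesis using d sub[of n] unfolding P_def by (meson subsetD)
    qed
    ultimately show ?thesis unfolding P_def by (intro exI[of _ ?d]) simp
  qed
  have path: "\<exists>d. P n v d" if "v \<in> R n" for n v
    using that
  proof (induction n arbitrary: v)
    case 0
    then show ?case
      by (auto simp: P_def R0 zero_in_chains intro!: exI[of _ "\<lambda>\<sigma>. 0"])
  next
    case (Suc n)
    show ?case
    proof (cases "v \<in> R n")
      case True
      then show ?thesis using Suc.IH P_mono by metis
    next
      case False
      with Suc.prems consider \<sigma> where "\<sigma> \<in> S" "0 < c \<sigma>" "tl \<sigma> \<in> R n" "v = hd \<sigma>"
        | \<sigma> where "\<sigma> \<in> S" "c \<sigma> < 0" "hd \<sigma> \<in> R n" "v = tl \<sigma>"
        unfolding RS stp_def by blast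
      then show ?thesis
      proof cases
        case 1
        with Suc.IH[of "tl \<sigma>"] obtain d where "P n (tl \<sigma>) d" by metis
        from extend[OF this 1(1,3) False Suc.prems, of 1] 1 show ?thesis by simp
      next
        case 2
        with Suc.IH[of "hd \<sigma>"] obtain d where "P n (hd \<sigma>) d" by metis
        from extend[OF this 2(1,3) False Suc.prems, of "-1"] 2 show ?thesis by simp
      qed
    qed
  qed
  define X where "X = (\<Union>n. R n)"
  have qX: "q \<in> X" using R0 by (auto simp: X_def)
  have cl: "hd \<sigma> \<in> X" if "\<sigma> \<in> S" "0 < c \<sigma>" "tl \<sigma> \<in> X" for \<sigma>
  proof -
    from that obtain n where "tl \<sigma> \<in> R n" by (auto simp: X_def)
    then have "hd \<sigma> \<in> R (Suc n)" using that unfolding RS stp_def by blast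
    then show ?thesis by (auto simp: X_def)
  qed
  have cl': "tl \<sigma> \<in> X" if "\<sigma> \<in> S" "c \<sigma> < 0" "hd \<sigma> \<in> X" for \<sigma>
  proof -
    from that obtain n where "hd \<sigma> \<in> R n" by (auto simp: X_def)
    then have "tl \<sigma> \<in> R (Suc n)" using that unfolding RS stp_def by blast
    then show ?thesis by (auto simp: X_def)
  qed
  \<comment> \<open>Cut argument: no flow leaves the reached set \<open>X\<close>, so the boundary
    of \<open>c\<close> summed over \<open>X\<close> is nonnegative. The source \<open>q\<close>
    contributes \<open>-1\<close> to this sum, so \<open>t\<close> must lie in \<open>X\<close> to
    compensate.\<close>
  let ?f = "\<lambda>v. of_bool (v \<in> X) :: int"
  have "0 \<le> (\<Sum>\<sigma>\<in>S. c \<sigma> * (?f (hd \<sigma>) - ?f (tl \<sigma>)))"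
  proof (rule sum_nonneg)
    fix \<sigma> assume "\<sigma> \<in> S"
    then consider "c \<sigma> = 0" | "0 < c \<sigma>" "?f (tl \<sigma>) \<le> ?f (hd \<sigma>)"
      | "c \<sigma> < 0" "?f (hd \<sigma>) \<le> ?f (tl \<sigma>)"
      using cl[of \<sigma>] cl'[of \<sigma>] by (metis linorder_neqE of_bool_eq(1,2) order_refl zero_le_one of_bool_less_eq_iff)
    then show "0 \<le> c \<sigma> * (?f (hd \<sigma>) - ?f (tl \<sigma>))"
      by cases (auto intro: mult_nonneg_nonneg mult_nonpos_nonpos)
  qed
  also have "\<dots> = (\<Sum>y\<in>V. ?f y * bd c y)" by (simp add: sum_bd)
  also have "\<dots> = (\<Sum>y\<in>V. ?f y * (of_bool (y = t) - of_bool (y = q)))"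
    using c by (intro sum.cong) (auto simp: chains_from_to_def)
  also have "\<dots> = (\<Sum>y\<in>V. if y = t then ?f y else 0) - (\<Sum>y\<in>V. if y = q then ?f y else 0)"
    by (subst sum_subtractf [symmetric]) (rule sum.cong, auto)
  also have "\<dots> = ?f t - ?f q" using q t by simp
  finally have "t \<in> X" using qX by (auto split: if_splits)
  then obtain n where "t \<in> R n" by (auto simp: X_def)
  then obtain d where "P n t d" using path by metis
  then show ?thesis using that[of d] unfolding P_def by metis
qed

end

section \<open>Integral flows of minimal quadratic cost\<close>

locale weighted_network = network +
  fixes \<l> x :: "'b \<Rightarrow> real" and q :: 'a
  assumes len_pos: "\<sigma> \<in> S \<Longrightarrow> 0 < \<l> \<sigma>" and q: "q \<in> V"
    and cycle_pos: "a \<in> cycs \<Longrightarrow> a \<noteq> (\<lambda>\<sigma>. 0) \<Longrightarrow>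
      0 < (\<Sum>\<sigma>\<in>S. (real_of_int (a \<sigma>))\<^sup>2 / 2 * \<l> \<sigma> + x \<sigma> * a \<sigma>)"
begin

text \<open>Energy of a flow with a linear drift \<open>x\<close>. By \<open>cycle_pos\<close> the
  zero cycle is the strict minimum among all cycles; this is the form in which the uniqueness of the
  maximizer in the theta function enters.\<close>

definition cost :: "('b \<Rightarrow> int) \<Rightarrow> real" where
  "cost c = (\<Sum>\<sigma>\<in>S. (real_of_int (c \<sigma>))\<^sup>2 / 2 * \<l> \<sigma> + x \<sigma> * c \<sigma>)"

definition minimal :: "'a \<Rightarrow> ('b \<Rightarrow> int) set" where
  "minimal y = {c \<in> chains_from_to q y. \<forall>d\<in>chains_from_to q y. cost c \<le> cost d}"

lemma cost_add:
  "cost (\<lambda>\<sigma>. c \<sigma> + d \<sigma>) = cost c + cost d + (\<Sum>\<sigma>\<in>S. real_of_int (c \<sigma> * d \<sigma>) * \<l> \<sigma>)"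
  unfolding cost_def sum.distrib [symmetric]
  by (intro sum.cong refl) (simp add: field_simps power2_eq_square)

lemma cost_add_unit:
  assumes "\<sigma> \<in> S"
  shows "cost (\<lambda>\<tau>. c \<tau> + (if \<tau> = \<sigma> then \<epsilon> else 0)) =
    cost c + (\<epsilon>\<^sup>2 / 2 * \<l> \<sigma> + x \<sigma> * \<epsilon>) + c \<sigma> * \<epsilon> * \<l> \<sigma>"
proof -
  have "cost (\<lambda>\<tau>. if \<tau> = \<sigma> then \<epsilon> else 0) =
      (\<Sum>\<tau>\<in>S. if \<tau> = \<sigma> then \<epsilon>\<^sup>2 / 2 * \<l> \<sigma> + x \<sigma> * \<epsilon> else 0)"
    unfolding cost_def by (rule sum.cong) auto
  moreover have "(\<Sum>\<tau>\<in>S. real_of_int (c \<tau> * (if \<tau> = \<sigma> then \<epsilon> else 0)) * \<l> \<tau>) =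
      (\<Sum>\<tau>\<in>S. if \<tau> = \<sigma> then c \<sigma> * \<epsilon> * \<l> \<sigma> else 0)"
    by (rule sum.cong) auto
  ultimately show ?thesis using assms by (simp add: cost_add)
qed

text \<open>A minimal flow \<open>c\<close> splits into a simple path \<open>d\<close> inside it and
  the cycle \<open>c - d\<close>. Since \<open>d\<close> follows the signs of \<open>c\<close>, the
  cross term of the cost is nonnegative; minimality then bounds the cost of the cycle by 0, and
  \<open>cycle_pos\<close> makes the cycle vanish.\<close>

lemma minimal_simple:
  assumes c: "c \<in> minimal y" and y: "y \<in> V"
  shows "\<bar>c \<sigma>\<bar> \<le> 1" "\<sigma> \<in> S \<Longrightarrow> tl \<sigma> = y \<Longrightarrow> c \<sigma> \<le> 0" "\<sigma> \<in> S \<Longrightarrow> hd \<sigma> = y \<Longrightarrow> 0 \<le> c \<sigma>"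
proof -
  have cy: "c \<in> chains_from_to q y" using c by (simp add: minimal_def)
  obtain d where d: "d \<in> chains_from_to q y" "\<And>\<sigma>. d \<sigma> = 0 \<or> d \<sigma> = sgn (c \<sigma>)"
    "\<And>\<sigma>. \<sigma> \<in> S \<Longrightarrow> tl \<sigma> = y \<Longrightarrow> d \<sigma> \<le> 0" "\<And>\<sigma>. \<sigma> \<in> S \<Longrightarrow> hd \<sigma> = y \<Longrightarrow> 0 \<le> d \<sigma>"
    using simple_path_in_flow[OF cy q y] by blast
  let ?a = "\<lambda>\<sigma>. c \<sigma> - d \<sigma>"
  have a: "?a \<in> cycs" using cy d(1) by (rule chains_from_to_diff)
  have "cost c = cost (\<lambda>\<sigma>. d \<sigma> + ?a \<sigma>)" by simp
  also have "\<dots> = cost d + cost ?a + (\<Sum>\<sigma>\<in>S. real_of_int (d \<sigma> * ?a \<sigma>) * \<l> \<sigma>)"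
    by (rule cost_add)
  finally have *: "cost c = cost d + cost ?a + (\<Sum>\<sigma>\<in>S. real_of_int (d \<sigma> * ?a \<sigma>) * \<l> \<sigma>)" .
  have "0 \<le> (\<Sum>\<sigma>\<in>S. real_of_int (d \<sigma> * ?a \<sigma>) * \<l> \<sigma>)"
  proof (rule sum_nonneg)
    fix \<sigma> assume "\<sigma> \<in> S"
    have "0 \<le> d \<sigma> * ?a \<sigma>"
      using d(2)[of \<sigma>] by (cases "0 < c \<sigma>"; cases "c \<sigma> = 0") auto
    then show "0 \<le> real_of_int (d \<sigma> * ?a \<sigma>) * \<l> \<sigma>"
      using len_pos[OF \<open>\<sigma> \<in> S\<close>] by (metis of_int_0_le_iff less_imp_le mult_nonneg_nonneg)
  qed
  moreover have "cost c \<le> cost d" using c d(1) by (simp add: minimal_def)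
  ultimately have "cost ?a \<le> 0" using * by linarith
  then have "?a = (\<lambda>\<sigma>. 0)"
    using cycle_pos[OF a] unfolding cost_def by fastforce
  then have "c = d" by (auto simp: fun_eq_iff)
  then show "\<bar>c \<sigma>\<bar> \<le> 1" "\<sigma> \<in> S \<Longrightarrow> tl \<sigma> = y \<Longrightarrow> c \<sigma> \<le> 0" "\<sigma> \<in> S \<Longrightarrow> hd \<sigma> = y \<Longrightarrow> 0 \<le> c \<sigma>"
    using d(2)[of \<sigma>] d(3,4) by (auto simp: sgn_if split: if_splits)
qed

definition size :: "('b \<Rightarrow> int) \<Rightarrow> int" where
  "size c = (\<Sum>\<sigma>\<in>S. \<bar>c \<sigma>\<bar>)"

text \<open>Two comparisons: \<open>c\<close> with \<open>\<sigma>\<close> removed competes with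
  \<open>d\<close> at \<open>z\<close>, and \<open>d\<close> with \<open>\<sigma>\<close> added
  competes with \<open>c\<close> at \<open>y\<close>. Together they give
  \<open>d \<sigma> * \<epsilon> \<le> 0\<close>, while simplicity of \<open>d\<close> gives the
  opposite sign. So \<open>d\<close> avoids \<open>\<sigma>\<close>, and both comparisons are
  equalities.\<close>

lemma minimal_extend:
  assumes \<sigma>: "\<sigma> \<in> S"
    and ends: "\<epsilon> = 1 \<and> y = tl \<sigma> \<and> z = hd \<sigma> \<or> \<epsilon> = -1 \<and> y = hd \<sigma> \<and> z = tl \<sigma>"
    and c: "c \<in> minimal y" "c \<sigma> = - \<epsilon>" and d: "d \<in> minimal z"
  shows "(\<lambda>\<tau>. d \<tau> + (if \<tau> = \<sigma> then - \<epsilon> else 0)) \<in> minimal y \<and>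
    size (\<lambda>\<tau>. d \<tau> + (if \<tau> = \<sigma> then - \<epsilon> else 0)) = size d + 1"
proof -
  let ?c = "\<lambda>\<tau>. c \<tau> + (if \<tau> = \<sigma> then \<epsilon> else 0)" and ?d = "\<lambda>\<tau>. d \<tau> + (if \<tau> = \<sigma> then - \<epsilon> else 0)"
  have \<epsilon>2: "\<epsilon> * \<epsilon> = 1" "(real_of_int \<epsilon>)\<^sup>2 = 1" using ends by auto
  have zV: "z \<in> V" using ends \<sigma> tl_in hd_in by blast
  have yz: "(\<lambda>\<tau>. if \<tau> = \<sigma> then \<epsilon> else 0) \<in> chains_from_to y z"
    using ends \<sigma> by (auto simp: chains_from_to_def chain_unit bd_unit)
  have zy: "(\<lambda>\<tau>. if \<tau> = \<sigma> then - \<epsilon> else 0) \<in> chains_from_to z y"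
    using ends \<sigma> by (auto simp: chains_from_to_def chain_unit bd_unit)
  have cy: "c \<in> chains_from_to q y" and dz: "d \<in> chains_from_to q z"
    using c d by (auto simp: minimal_def)
  have cz: "?c \<in> chains_from_to q z" using cy yz by (rule chains_from_to_trans)
  have dy: "?d \<in> chains_from_to q y" using dz zy by (rule chains_from_to_trans)
  have h1: "cost d \<le> cost c - \<l> \<sigma> / 2 + x \<sigma> * \<epsilon>"
  proof -
    have "cost d \<le> cost ?c" using d cz by (simp add: minimal_def)
    also have "\<dots> = cost c + (\<l> \<sigma> / 2 + x \<sigma> * \<epsilon>) - \<l> \<sigma>"
      using \<epsilon>2 c(2) by (simp add: cost_add_unit[OF \<sigma>] power2_eq_square)
    finally show ?thesis by simp
  qed
  have h2: "cost ?d = cost d + \<l> \<sigma> / 2 - x \<sigma> * \<epsilon> - real_of_int (d \<sigma> * \<epsilon>) * \<l> \<sigma>"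
    using \<epsilon>2 by (simp add: cost_add_unit[OF \<sigma>])
  have h3: "cost c \<le> cost ?d" using c(1) dy by (simp add: minimal_def)
  have "0 \<le> d \<sigma> * \<epsilon>"
    using minimal_simple(2,3)[OF d zV \<sigma>] ends by auto
  moreover have "real_of_int (d \<sigma> * \<epsilon>) * \<l> \<sigma> \<le> 0" using h1 h2 h3 by linarith
  then have "d \<sigma> * \<epsilon> \<le> 0"
    using len_pos[OF \<sigma>] by (metis mult_le_0_iff not_less of_int_le_0_iff)
  ultimately have "d \<sigma> * \<epsilon> = 0" by linarith
  then have d0: "d \<sigma> = 0" using \<epsilon>2 by auto
  have "cost ?d \<le> cost c" using h1 h2 d0 by simp
  then have "?d \<in> minimal y" using c(1) dy by (fastforce simp: minimal_def)
  moreover have "size ?d = size d + 1"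
  proof -
    have "size ?d = (\<Sum>\<tau>\<in>S. \<bar>d \<tau>\<bar> + (if \<tau> = \<sigma> then 1 else 0))"
      unfolding size_def using d0 ends by (intro sum.cong) auto
    then show ?thesis using \<sigma> by (simp add: sum.distrib size_def)
  qed
  ultimately show ?thesis by blast
qed

definition maximizers :: "('b \<Rightarrow> int) \<Rightarrow> ('b \<Rightarrow> int) set" where
  "maximizers c = {a \<in> cycs. \<forall>b\<in>cycs.
     (\<Sum>\<sigma>\<in>S. (c \<sigma> * \<l> \<sigma> + x \<sigma>) * b \<sigma> - (real_of_int (b \<sigma>))\<^sup>2 / 2 * \<l> \<sigma>)
     \<le> (\<Sum>\<sigma>\<in>S. (c \<sigma> * \<l> \<sigma> + x \<sigma>) * a \<sigma> - (real_of_int (a \<sigma>))\<^sup>2 / 2 * \<l> \<sigma>)}"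

text \<open>Completing the square turns the maximization in the theta function into the minimization of
  the cost of a flow.\<close>

lemma minimal_eq_maximizers:
  assumes c: "c \<in> chains_from_to q y"
  shows "minimal y = (\<lambda>a \<sigma>. c \<sigma> - a \<sigma>) ` maximizers c"
proof -
  have *: "cost (\<lambda>\<sigma>. c \<sigma> - a \<sigma>) = cost c -
      (\<Sum>\<sigma>\<in>S. (c \<sigma> * \<l> \<sigma> + x \<sigma>) * a \<sigma> - (real_of_int (a \<sigma>))\<^sup>2 / 2 * \<l> \<sigma>)" for a
    unfolding cost_def sum_subtractf [symmetric]
    by (intro sum.cong refl) (simp add: field_simps power2_eq_square)
  show ?thesis
  proof safe
    fix d assume d: "d \<in> minimal y"
    let ?a = "\<lambda>\<sigma>. c \<sigma> - d \<sigma>"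
    have a: "?a \<in> cycs" using c d by (intro chains_from_to_diff) (auto simp: minimal_def)
    have "?a \<in> maximizers c"
      unfolding maximizers_def
    proof (rule CollectI, rule conjI[OF a], rule ballI)
      fix b assume b: "b \<in> cycs"
      have "cost d \<le> cost (\<lambda>\<sigma>. c \<sigma> - b \<sigma>)"
        using d chains_from_to_diff_cyc[OF c b] by (simp add: minimal_def)
      then show "(\<Sum>\<sigma>\<in>S. (c \<sigma> * \<l> \<sigma> + x \<sigma>) * b \<sigma> - (real_of_int (b \<sigma>))\<^sup>2 / 2 * \<l> \<sigma>)
        \<le> (\<Sum>\<sigma>\<in>S. (c \<sigma> * \<l> \<sigma> + x \<sigma>) * (c \<sigma> - d \<sigma>) - (real_of_int (c \<sigma> - d \<sigma>))\<^sup>2 / 2 * \<l> \<sigma>)"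
        using *[of ?a] *[of b] by simp
    qed
    then show "d \<in> (\<lambda>a \<sigma>. c \<sigma> - a \<sigma>) ` maximizers c"
      by (intro image_eqI[of _ _ ?a]) auto
  next
    fix a assume a: "a \<in> maximizers c"
    then have ac: "a \<in> cycs" by (simp add: maximizers_def)
    show "(\<lambda>\<sigma>. c \<sigma> - a \<sigma>) \<in> minimal y"
      unfolding minimal_def
    proof (rule CollectI, rule conjI[OF chains_from_to_diff_cyc[OF c ac]], rule ballI)
      fix d assume d: "d \<in> chains_from_to q y"
      let ?b = "\<lambda>\<sigma>. c \<sigma> - d \<sigma>"
      have "?b \<in> cycs" using c d by (rule chains_from_to_diff)
      then have "cost (\<lambda>\<sigma>. c \<sigma> - a \<sigma>) \<le> cost (\<lambda>\<sigma>. c \<sigma> - ?b \<sigma>)"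
        using a unfolding * maximizers_def by auto
      then show "cost (\<lambda>\<sigma>. c \<sigma> - a \<sigma>) \<le> cost d" by simp
    qed
  qed
qed

text \<open>Let \<open>A\<close> be the set where \<open>\<phi>\<close> is maximal, and among the points of \<open>A\<close> take one whose longest
  minimal flow from \<open>q\<close> is as short as possible.  No minimal flow arrives there from inside \<open>A\<close>, so
  there the divisor is negative.\<close>

theorem negative_coefficient:
  fixes \<phi> :: "'a \<Rightarrow> real" and k :: "'b \<Rightarrow> int" and D :: "'a \<Rightarrow> int" and c :: "'a \<Rightarrow> 'b \<Rightarrow> int"
  assumes c: "\<And>y. y \<in> V \<Longrightarrow> c y \<in> chains_from_to q y"
    and fin: "\<And>y. y \<in> V \<Longrightarrow> finite (maximizers (c y))"
    and ne: "\<And>y. y \<in> V \<Longrightarrow> maximizers (c y) \<noteq> {}"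
    and \<phi>: "\<And>\<sigma>. \<sigma> \<in> S \<Longrightarrow> \<phi> (hd \<sigma>) - \<phi> (tl \<sigma>) = k \<sigma> * \<l> \<sigma>"
    and D: "\<And>y. y \<in> V \<Longrightarrow> D y =
      (\<Sum>\<sigma>\<in>{\<sigma>\<in>S. tl \<sigma> = y}. Max ((\<lambda>a. a \<sigma>) ` maximizers (c y))) +
      (\<Sum>\<sigma>\<in>{\<sigma>\<in>S. hd \<sigma> = y}. Max ((\<lambda>a. - a \<sigma>) ` maximizers (c y))) - of_bool (y = q) - bd k y"
  shows "\<exists>y\<in>V. D y < 0"
proof -
  have fin_min: "finite (minimal y)" and ne_min: "minimal y \<noteq> {}" if "y \<in> V" for y
    using minimal_eq_maximizers[OF c[OF that]] fin[OF that] ne[OF that] by auto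
  define L where "L y = Max (size ` minimal y)" for y
  define A where "A = {y\<in>V. \<forall>z\<in>V. \<phi> z \<le> \<phi> y}"
  have "Max (\<phi> ` V) \<in> \<phi> ` V" using q by (intro Max_in) auto
  then obtain y1 where y1: "y1 \<in> V" "\<phi> y1 = Max (\<phi> ` V)" by auto
  then have "y1 \<in> A" by (simp add: A_def)
  moreover have "finite A" by (simp add: A_def)
  ultimately obtain y where y: "y \<in> A" "\<And>z. z \<in> A \<Longrightarrow> L y \<le> L z"
    using that[of "arg_min_on L A"] arg_min_if_finite(1)[of A L] arg_min_least[of A _ L] by blast
  then have yV: "y \<in> V" by (simp add: A_def)
  \<comment> \<open>Seen from \<open>y\<close> towards \<open>z\<close>,
    \<open>- \<epsilon> * b \<sigma>\<close> is 1 if \<open>b\<close> arrives from \<open>z\<close>,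
    and \<open>\<epsilon> * k \<sigma>\<close> is the slope of \<open>\<phi>\<close>. For
    \<open>z\<close> in \<open>A\<close> the slope is 0 and the choice of \<open>y\<close> forbids
    an arrival; for \<open>z\<close> outside \<open>A\<close> the slope is a negative integer, at
    most -1, which outweighs an arrival.\<close>
  have key: "- \<epsilon> * b \<sigma> + \<epsilon> * k \<sigma> \<le> 0"
    if \<sigma>: "\<sigma> \<in> S" and b: "b \<in> minimal y"
      and ends: "\<epsilon> = 1 \<and> y = tl \<sigma> \<and> z = hd \<sigma> \<or> \<epsilon> = -1 \<and> y = hd \<sigma> \<and> z = tl \<sigma>"
    for \<epsilon> :: int and \<sigma> b z
  proof -
    have zV: "z \<in> V" using ends \<sigma> tl_in hd_in by blast
    have b1: "\<bar>b \<sigma>\<bar> \<le> 1" by (rule minimal_simple(1)[OF b yV])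
    have slope: "\<phi> z - \<phi> y = real_of_int (\<epsilon> * k \<sigma>) * \<l> \<sigma>" using \<phi>[OF \<sigma>] ends by auto
    show ?thesis
    proof (cases "z \<in> A")
      case True
      then have "\<phi> z = \<phi> y" using y(1) by (force simp: A_def)
      then have "\<epsilon> * k \<sigma> = 0" using slope len_pos[OF \<sigma>] by simp
      moreover have "- \<epsilon> * b \<sigma> \<le> 0"
      proof (rule ccontr)
        assume "\<not> ?thesis"
        then have b\<epsilon>: "b \<sigma> = - \<epsilon>" using b1 ends by auto
        have "Max (size ` minimal z) \<in> size ` minimal z"
          using fin_min[OF zV] ne_min[OF zV] by (intro Max_in) auto
        then obtain d where d: "d \<in> minimal z" "size d = L z" by (auto simp: L_def)
        have "size d + 1 \<le> L y"
          unfolding L_def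
          using conjunct1[OF minimal_extend[OF \<sigma> ends b b\<epsilon> d(1)]]
            conjunct2[OF minimal_extend[OF \<sigma> ends b b\<epsilon> d(1)], symmetric] fin_min[OF yV]
          by (intro Max_ge) auto
        then show False using y(2)[OF True] d(2) by simp
      qed
      ultimately show ?thesis by linarith
    next
      case False
      then have "\<phi> z < \<phi> y" using y(1) zV unfolding A_def
        by (smt (verit, best) mem_Collect_eq)
      then have "real_of_int (\<epsilon> * k \<sigma>) * \<l> \<sigma> < 0" using slope by simp
      then have "\<epsilon> * k \<sigma> < 0" using len_pos[OF \<sigma>] by (metis mult_less_0_iff not_less_iff_gr_or_eq of_int_less_0_iff)
      moreover have "- \<epsilon> * b \<sigma> \<le> 1" using b1 ends by auto
      ultimately show ?thesis by linarith
    qed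
  qed
  have out: "Max ((\<lambda>a. a \<sigma>) ` maximizers (c y)) \<le> c y \<sigma> - k \<sigma>" if "\<sigma> \<in> S" "tl \<sigma> = y" for \<sigma>
  proof -
    have "a \<sigma> \<le> c y \<sigma> - k \<sigma>" if a: "a \<in> maximizers (c y)" for a
    proof -
      have "(\<lambda>\<sigma>. c y \<sigma> - a \<sigma>) \<in> minimal y" using a minimal_eq_maximizers[OF c[OF yV]] by blast
      from key[OF \<open>\<sigma> \<in> S\<close> this, of 1] \<open>tl \<sigma> = y\<close> show ?thesis by simp
    qed
    then show ?thesis using fin[OF yV] ne[OF yV] by simp
  qed
  have inn: "Max ((\<lambda>a. - a \<sigma>) ` maximizers (c y)) \<le> - c y \<sigma> + k \<sigma>" if "\<sigma> \<in> S" "hd \<sigma> = y" for \<sigma>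
  proof -
    have "- a \<sigma> \<le> - c y \<sigma> + k \<sigma>" if a: "a \<in> maximizers (c y)" for a
    proof -
      have "(\<lambda>\<sigma>. c y \<sigma> - a \<sigma>) \<in> minimal y" using a minimal_eq_maximizers[OF c[OF yV]] by blast
      from key[OF \<open>\<sigma> \<in> S\<close> this, of "-1"] \<open>hd \<sigma> = y\<close> show ?thesis by simp
    qed
    then show ?thesis using fin[OF yV] ne[OF yV] by simp
  qed
  \<comment> \<open>With these bounds the terms in \<open>k\<close> cancel against
    \<open>bd k y\<close>, and what remains is minus the boundary of \<open>c y\<close> at its end,
    corrected at \<open>q\<close>. This is -1 also for \<open>y = q\<close>, where the boundary of
    \<open>c y\<close> is 0.\<close>
  have "D y \<le> (\<Sum>\<sigma>\<in>{\<sigma>\<in>S. tl \<sigma> = y}. c y \<sigma> - k \<sigma>) + (\<Sum>\<sigma>\<in>{\<sigma>\<in>S. hd \<sigma> = y}. - c y \<sigma> + k \<sigma>)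
      - of_bool (y = q) - bd k y"
    unfolding D[OF yV] using out inn by (intro diff_right_mono add_mono sum_mono) auto
  also have "\<dots> = - bd (c y) y - of_bool (y = q)"
    by (simp add: bd_def sum.distrib sum_subtractf sum_negf)
  also have "\<dots> = -1" using c[OF yV] yV by (simp add: chains_from_to_def)
  finally show ?thesis using yV by force
qed

end

section \<open>Linear algebra without ambient finite dimension\<close>

lemma span_disjoint_independent:
  fixes B K :: "'a::real_vector set"
  assumes B: "independent B" "finite B" and K: "K \<subseteq> B" and u: "u \<in> span K" "u \<in> span (B - K)"
  shows "u = 0"
proof -
  have fin: "finite K" "finite (B - K)" using B K finite_subset by auto
  obtain r where r: "u = (\<Sum>v\<in>K. r v *\<^sub>R v)" using u(1) fin by (auto simp: span_finite)
  obtain s where s: "u = (\<Sum>v\<in>B - K. s v *\<^sub>R v)" using u(2) fin by (auto simp: span_finite)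
  let ?t = "\<lambda>v. if v \<in> K then r v else - s v"
  have "(\<Sum>v\<in>B. ?t v *\<^sub>R v) = (\<Sum>v\<in>B - K. ?t v *\<^sub>R v) + (\<Sum>v\<in>K. ?t v *\<^sub>R v)"
    using K B(2) by (rule sum.subset_diff)
  also have "\<dots> = - u + u"
  proof (rule arg_cong2[of _ _ _ _ "(+)"])
    show "(\<Sum>v\<in>B - K. ?t v *\<^sub>R v) = - u" by (simp add: s sum_negf)
    show "(\<Sum>v\<in>K. ?t v *\<^sub>R v) = u" by (simp add: r)
  qed
  finally have "(\<Sum>v\<in>B. ?t v *\<^sub>R v) = 0" by simp
  then have "?t v = 0" if "v \<in> B" for v
    using independentD[OF B(1) B(2) order_refl, of ?t] that by blast
  then have "r v = 0" if "v \<in> K" for v using that K by force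
  then show ?thesis by (simp add: r)
qed

text \<open>Rank-nullity for a subspace of a finitely spanned space; the surrounding function space
  over an arbitrary type of edges or vertices may have infinite dimension. A basis of the kernel is
  extended to one of \<open>S\<close>, and \<open>F\<close> is injective on the span of the added
  vectors.\<close>

lemma dim_kernel_image:
  fixes F :: "'a::real_vector \<Rightarrow> 'b::real_vector"
  assumes F: "linear F" and S: "subspace S" "S \<subseteq> span T" "finite T"
  shows "dim S = dim {x \<in> S. F x = 0} + dim (F ` S)"
proof -
  let ?K = "{x \<in> S. F x = 0}"
  obtain BK where BK: "BK \<subseteq> ?K" "independent BK" "?K \<subseteq> span BK"
    using maximal_independent_subset by blast
  obtain B where B: "BK \<subseteq> B" "B \<subseteq> S" "independent B" "S \<subseteq> span B"
    using maximal_independent_subset_extend[of BK S] BK by blast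
  have finB: "finite B" using independent_span_bound[OF S(3) B(3)] B(2) S(2) by blast
  have span_S: "span B \<subseteq> S" using B(2) S(1) by (rule span_minimal)
  have inj: "inj_on F (span (B - BK))"
    unfolding linear_inj_on_iff_eq_0[OF F subspace_span]
  proof (intro ballI impI)
    fix u assume u: "u \<in> span (B - BK)" "F u = 0"
    then have "u \<in> S" using span_S span_mono[of "B - BK" B] by blast
    then have "u \<in> span BK" using BK(3) u(2) by blast
    then show "u = 0" using span_disjoint_independent[OF B(3) finB B(1)] u(1) by blast
  qed
  have ind: "independent (F ` (B - BK))"
    using F independent_mono[OF B(3)] inj by (intro linear_independent_injective_image) auto
  have "F ` S \<subseteq> span (F ` (B - BK))"
  proof (rule image_subsetI)
    fix s assume "s \<in> S"
    then have "F s \<in> span (F ` B)" using B(4) linear_span_image[OF F, of B] by blast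
    moreover have "F ` B \<subseteq> span (F ` (B - BK))"
    proof (rule image_subsetI)
      fix b assume "b \<in> B"
      then show "F b \<in> span (F ` (B - BK))"
        using BK(1) by (cases "b \<in> BK") (auto intro: span_base simp: span_zero)
    qed
    ultimately show "F s \<in> span (F ` (B - BK))" using span_minimal[OF _ subspace_span] by blast
  qed
  moreover have "F ` (B - BK) \<subseteq> F ` S" using B(2) by blast
  ultimately have "dim (F ` S) = card (F ` (B - BK))"
    using ind by (intro basis_card_eq_dim[symmetric]) auto
  also have "\<dots> = card (B - BK)"
    using inj by (intro card_image inj_on_subset[OF inj] span_superset)
  also have "\<dots> = card B - card BK" using B(1) finB finite_subset by (intro card_Diff_subset) auto
  finally have "dim (F ` S) = card B - card BK" .
  moreover have "dim S = card B" using B by (intro basis_card_eq_dim[symmetric]) auto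
  moreover have "dim ?K = card BK" using BK by (intro basis_card_eq_dim[symmetric]) auto
  moreover have "card BK \<le> card B" using B(1) finB by (rule card_mono[rotated])
  ultimately show ?thesis by simp
qed

text \<open>The representing vector is built by Gram--Schmidt, one spanning vector at a time.\<close>

lemma riesz_representation_span:
  fixes ip :: "'a::real_vector \<Rightarrow> 'a \<Rightarrow> real"
  assumes B: "finite B" and sub: "B \<subseteq> S" and S: "subspace S"
    and lin: "\<And>w. linear (ip w)" and sym: "\<And>v w. ip v w = ip w v"
    and pos: "\<And>w. w \<in> S \<Longrightarrow> w \<noteq> 0 \<Longrightarrow> 0 < ip w w"
  shows "\<forall>f. (\<forall>v\<in>S. \<forall>w\<in>S. f (v + w) = f v + f w) \<and> (\<forall>c. \<forall>w\<in>S. f (c *\<^sub>R w) = c * f w) \<longrightarrow>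
    (\<exists>b\<in>span B. \<forall>w\<in>span B. ip b w = f w)"
  using B sub
proof (induction B)
  case empty
  show ?case
  proof (intro allI impI)
    fix f :: "'a \<Rightarrow> real"
    assume f: "(\<forall>v\<in>S. \<forall>w\<in>S. f (v + w) = f v + f w) \<and> (\<forall>c. \<forall>w\<in>S. f (c *\<^sub>R w) = c * f w)"
    then have "f (0 *\<^sub>R 0) = 0" using subspace_0[OF S] by fastforce
    then show "\<exists>b\<in>span {}. \<forall>w\<in>span {}. ip b w = f w"
      using linear_0[OF lin[of 0]] by simp
  qed
next
  case (insert v B)
  then have BS: "span B \<subseteq> S" "v \<in> S" using span_minimal[OF _ S, of B] by auto
  have IH: "\<exists>b\<in>span B. \<forall>w\<in>span B. ip b w = f w"
    if "\<And>v w. v \<in> S \<Longrightarrow> w \<in> S \<Longrightarrow> f (v + w) = f v + f w" "\<And>c w. w \<in> S \<Longrightarrow> f (c *\<^sub>R w) = c * f w" for f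
    using insert that by auto
  show ?case
  proof (intro allI impI)
    fix f :: "'a \<Rightarrow> real"
    assume f: "(\<forall>v\<in>S. \<forall>w\<in>S. f (v + w) = f v + f w) \<and> (\<forall>c. \<forall>w\<in>S. f (c *\<^sub>R w) = c * f w)"
    obtain p where p: "p \<in> span B" "\<forall>w\<in>span B. ip p w = ip v w"
      using IH[of "ip v"] lin[of v] by (auto simp: linear_add linear_scale)
    obtain b where b: "b \<in> span B" "\<forall>w\<in>span B. ip b w = f w"
      using IH[of f] f by blast
    \<comment> \<open>\<open>u\<close> is the component of the new vector orthogonal to
      \<open>span B\<close>; correcting \<open>b\<close> by a multiple of \<open>u\<close> does not
      disturb the values already achieved on \<open>span B\<close>.\<close>
    define u where "u = v - p"
    have uS: "u \<in> S" using BS p S by (auto simp: u_def subspace_diff)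
    have orth: "ip w u = 0" if "w \<in> span B" for w
      using p(2) that sym[of w v] sym[of w p] by (simp add: u_def linear_diff[OF lin])
    show "\<exists>b\<in>span (insert v B). \<forall>w\<in>span (insert v B). ip b w = f w"
    proof (cases "u = 0")
      case True
      then have "v \<in> span B" using p by (simp add: u_def)
      then have "span (insert v B) = span B" by (rule span_redundant)
      then show ?thesis using b by auto
    next
      case False
      define k where "k = (f u) / ip u u"
      have uu: "0 < ip u u" using pos[OF uS False] .
      have u_span: "u \<in> span (insert v B)"
        unfolding u_def using p(1) span_mono[of B "insert v B"] by (intro span_diff) (auto intro: span_base)
      have b_span: "b \<in> span (insert v B)" using b span_mono[of B "insert v B"] by auto
      show ?thesis
      proof (intro bexI[of _ "b + k *\<^sub>R u"] ballI)
        show "b + k *\<^sub>R u \<in> span (insert v B)" using u_span b_span by (intro span_add span_scale)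
        fix w assume "w \<in> span (insert v B)"
        then obtain r where r: "w - r *\<^sub>R v \<in> span B" by (auto simp: span_breakdown_eq)
        define w0 where "w0 = (w - r *\<^sub>R v) + r *\<^sub>R p"
        have w0: "w0 \<in> span B" using r p(1) by (auto simp: w0_def intro!: span_add span_scale)
        have w: "w = w0 + r *\<^sub>R u" by (simp add: w0_def u_def algebra_simps)
        have ip_add: "ip (x + y) z = ip x z + ip y z" and ip_scale: "ip (c *\<^sub>R x) z = c * ip x z" for x y z c
          using sym linear_add[OF lin] linear_scale[OF lin] by (metis, metis real_scaleR_def)
        have "ip (b + k *\<^sub>R u) w = ip b w0 + r * ip b u + k * (ip u w0 + r * ip u u)"
          by (simp add: w ip_add ip_scale linear_add[OF lin] linear_scale[OF lin] algebra_simps)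
        also have "\<dots> = f w0 + r * f u"
          using orth[OF b(1)] orth[OF w0] b(2) w0 uu sym[of u w0] by (simp add: k_def)
        also have "\<dots> = f w"
        proof -
          have "w0 \<in> S" "r *\<^sub>R u \<in> S" using w0 BS uS S by (auto simp: subspace_scale)
          then show ?thesis using f uS by (simp add: w)
        qed
        finally show "ip (b + k *\<^sub>R u) w = f w" .
      qed
    qed
  qed
qed

section \<open>Chains and 1-forms on a tropical curve\<close>

lemma sum_fun_apply: "(\<Sum>i\<in>A. f i) x = (\<Sum>i\<in>A. f i x)" for f :: "'i \<Rightarrow> 'a \<Rightarrow> 'b::comm_monoid_add"
  by (induction A rule: infinite_finite_induct) auto

locale tropical =
  fixes C :: "('v, 'e) metric_graph"
  assumes tropical_curve: "tropical_curve C"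
begin

abbreviation "V \<equiv> verts (graph C)"
abbreviation "E \<equiv> arcs (graph C)"
abbreviation "src \<equiv> tail (graph C)"
abbreviation "tgt \<equiv> head (graph C)"
abbreviation "elen \<equiv> edge_length C"
abbreviation "len e \<equiv> real_of_ereal (edge_length C e)"

lemma fin_digraph: "fin_digraph (graph C)"
  using tropical_curve by (simp add: tropical_curve_def)

sublocale network V E src tgt
proof -
  interpret fin_digraph "graph C" by (rule fin_digraph)
  show "network V E src tgt" by unfold_locales auto
qed

lemma elen_pos: "e \<in> E \<Longrightarrow> 0 < elen e"
  using tropical_curve by (simp add: tropical_curve_def)

lemma elen_cases:
  assumes "e \<in> E"
  obtains (finite) "elen e = ereal (len e)" "0 < len e" | (leaf) "elen e = \<infinity>" "len e = 0"
  using elen_pos[OF assms] by (cases "elen e") auto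

lemma len_nonneg: "e \<in> E \<Longrightarrow> 0 \<le> len e"
  by (cases rule: elen_cases) auto

lemma in_arcs_eq: "in_arcs (graph C) v = {e\<in>E. tgt e = v}"
  by auto

lemma out_arcs_eq: "out_arcs (graph C) v = {e\<in>E. src e = v}"
  by auto

lemma valence_eq: "valence C v = card {e\<in>E. src e = v} + card {e\<in>E. tgt e = v}"
  by (simp add: valence_def out_degree_def in_degree_def in_arcs_eq out_arcs_eq)

text \<open>The leaf itself already accounts for the valence 1 of its infinite endpoint.\<close>

lemma leaf_head:
  assumes "e \<in> E" "elen e = \<infinity>"
  shows "{e'\<in>E. tgt e' = tgt e} = {e}" "{e'\<in>E. src e' = tgt e} = {}"
proof -
  have 1: "valence C (tgt e) = 1" using assms tropical_curve by (auto simp: tropical_curve_def)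
  have "card {e'\<in>E. tgt e' = tgt e} > 0" using assms by (subst card_gt_0_iff) auto
  with 1 have "card {e'\<in>E. src e' = tgt e} = 0" "card {e'\<in>E. tgt e' = tgt e} = 1"
    unfolding valence_eq by linarith+
  moreover have "e \<in> {e'\<in>E. tgt e' = tgt e}" using assms(1) by simp
  ultimately show "{e'\<in>E. tgt e' = tgt e} = {e}" "{e'\<in>E. src e' = tgt e} = {}"
    by (metis card_1_singletonE singletonD, metis (no_types, lifting) card_0_eq finite_S finite_subset mem_Collect_eq subsetI)
qed

lemma cycles_eq: "cycles C = {c. chain c \<and> (\<forall>v\<in>V. bd c v = 0)}"
  by (auto simp: cycles_def chain_def bd_def in_arcs_eq out_arcs_eq)

lemma cycs_eq: "cycles C = cycs"
  by (simp add: cycles_eq cycs_def)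

lemma unit_tangents_Vertex:
  "unit_tangents C (Vertex v) =
    (\<lambda>e. (e, 0, 1)) ` {e\<in>E. src e = v} \<union> (\<lambda>e. (e, elen e, -1)) ` {e\<in>E. tgt e = v}"
  using elen_pos by (auto simp: unit_tangents_def point_at_def split: if_splits) fastforce+

lemma sum_unit_tangents_Vertex:
  "(\<Sum>\<xi>\<in>unit_tangents C (Vertex v). f \<xi>) =
    (\<Sum>e\<in>{e\<in>E. src e = v}. f (e, 0, 1)) + (\<Sum>e\<in>{e\<in>E. tgt e = v}. f (e, elen e, -1))"
  unfolding unit_tangents_Vertex
  by (subst sum.union_disjoint) (auto simp: sum.reindex inj_on_def)

lemma unit_tangents_Interior:
  assumes "Interior e t \<in> points C"
  shows "unit_tangents C (Interior e t) = {(e, ereal t, 1), (e, ereal t, -1)}"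
proof -
  have e: "e \<in> E" "0 < t" "ereal t < elen e" using assms by (auto simp: points_def)
  have "unit_tangents C (Interior e t) \<subseteq> {(e, ereal t, 1), (e, ereal t, -1)}"
  proof
    fix \<xi> assume "\<xi> \<in> unit_tangents C (Interior e t)"
    then obtain e' t' \<epsilon> where \<xi>: "\<xi> = (e', t', \<epsilon>)"
      and *: "(e', t', \<epsilon>) \<in> unit_tangents C (Interior e t)" by (cases \<xi>) auto
    then have t': "e' = e" "real_of_ereal t' = t" "0 \<le> t'" "t' \<le> elen e" "t' \<noteq> 0" "t' \<noteq> elen e"
      by (auto simp: unit_tangents_def point_at_def split: if_splits)
    then have "t' = ereal t" by (cases t') auto
    then show "\<xi> \<in> {(e, ereal t, 1), (e, ereal t, -1)}"
      using * t' unfolding \<xi> by (auto simp: unit_tangents_def)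
  qed
  moreover have "{(e, ereal t, 1), (e, ereal t, -1)} \<subseteq> unit_tangents C (Interior e t)"
    using e by (auto simp: unit_tangents_def point_at_def)
  ultimately show ?thesis by blast
qed

text \<open>Inside an edge the two opposite tangent vectors cancel, so only the conditions at
  vertices remain; there the outward sum is minus the boundary. Thus 1-forms are the same functions
  as real cycles, and the two are interchanged freely from here on.\<close>

lemma one_forms_eq: "one_forms C = cycles C"
proof -
  have "(\<forall>p\<in>points C. (\<Sum>(e, t, \<epsilon>)\<in>unit_tangents C p. \<epsilon> * \<omega> e) = 0) \<longleftrightarrow> (\<forall>v\<in>V. bd \<omega> v = 0)" for \<omega>
  proof
    assume *: "\<forall>p\<in>points C. (\<Sum>(e, t, \<epsilon>)\<in>unit_tangents C p. \<epsilon> * \<omega> e) = 0"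
    show "\<forall>v\<in>V. bd \<omega> v = 0"
    proof
      fix v assume "v \<in> V"
      then have "Vertex v \<in> points C" by (simp add: points_def)
      with * have "(\<Sum>(e, t, \<epsilon>)\<in>unit_tangents C (Vertex v). \<epsilon> * \<omega> e) = 0" by blast
      then show "bd \<omega> v = 0" unfolding sum_unit_tangents_Vertex by (simp add: bd_def sum_negf)
    qed
  next
    assume *: "\<forall>v\<in>V. bd \<omega> v = 0"
    show "\<forall>p\<in>points C. (\<Sum>(e, t, \<epsilon>)\<in>unit_tangents C p. \<epsilon> * \<omega> e) = 0"
    proof
      fix p assume p: "p \<in> points C"
      show "(\<Sum>(e, t, \<epsilon>)\<in>unit_tangents C p. \<epsilon> * \<omega> e) = 0"
      proof (cases p)
        case (Vertex v)
        with p have "v \<in> V" by (auto simp: points_def)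
        with * have "bd \<omega> v = 0" by blast
        then show ?thesis unfolding Vertex sum_unit_tangents_Vertex by (simp add: bd_def sum_negf)
      next
        case (Interior e t)
        then show ?thesis using p by (simp add: unit_tangents_Interior)
      qed
    qed
  qed
  then show ?thesis by (simp add: one_forms_def cycles_eq chain_def)
qed

lemma cycle_leaf:
  assumes "\<omega> \<in> cycles C" "e \<in> E" "elen e = \<infinity>"
  shows "\<omega> e = 0"
proof -
  have "bd \<omega> (tgt e) = \<omega> e" unfolding bd_def leaf_head[OF assms(2,3)] by simp
  then show ?thesis using assms hd_in by (auto simp: cycles_eq)
qed

definition realc :: "('e \<Rightarrow> int) \<Rightarrow> 'e \<Rightarrow> real" where
  "realc a = (\<lambda>e. real_of_int (a e))"

lemma realc_apply [simp]: "realc a e = real_of_int (a e)"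
  by (simp add: realc_def)

lemma realc_cycle: "a \<in> cycs \<Longrightarrow> realc a \<in> one_forms C"
  by (auto simp: one_forms_eq cycles_eq cycs_def chain_def realc_def bd_of_int)

lemma subspace_one_forms: "subspace (one_forms C)"
  by (auto simp: subspace_def one_forms_eq cycles_eq chain_def plus_fun_def scaleR_fun_def bd_add bd_cmult zero_fun_def)

lemma connected:
  shows V_nonempty: "V \<noteq> {}"
    and "u \<in> V \<Longrightarrow> v \<in> V \<Longrightarrow> u \<rightarrow>\<^sup>*\<^bsub>mk_symmetric (graph C)\<^esub> v"
  using tropical_curve
  by (simp_all add: tropical_curve_def Digraph_Component.connected_def strongly_connected_def)

lemma reachable_chain:
  assumes "u \<rightarrow>\<^sup>*\<^bsub>mk_symmetric (graph C)\<^esub> v"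
  shows "\<exists>c. c \<in> chains_from_to u v"
proof -
  have "(u, v) \<in> (arcs_ends (with_proj (mk_symmetric (graph C))))\<^sup>*"
    using assms by (rule reachable_rtranclI)
  then show ?thesis
  proof induction
    case base
    show ?case using zero_in_chains by blast
  next
    case (step y z)
    then obtain c where c: "c \<in> chains_from_to u y" by blast
    from step(2) obtain e where e: "e \<in> E" "y = src e \<and> z = tgt e \<or> y = tgt e \<and> z = src e"
      by (auto simp: parcs_mk_symmetric)
    then show ?case
      using chains_from_to_trans[OF c] unit_in_chains[OF e(1)] uminus_in_chains[OF unit_in_chains[OF e(1)]]
      by blast
  qed
qed

lemma chain_exists:
  assumes "u \<in> V" "v \<in> V"
  obtains c where "c \<in> chains_from_to u v"
proof -
  show ?thesis using reachable_chain connected(2)[OF assms] that by blast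
qed

definition conn :: "'v \<Rightarrow> 'v \<Rightarrow> 'e \<Rightarrow> int" where
  "conn u v = (SOME c. c \<in> chains_from_to u v)"

lemma conn: "u \<in> V \<Longrightarrow> v \<in> V \<Longrightarrow> conn u v \<in> chains_from_to u v"
  unfolding conn_def by (metis chain_exists someI)

text \<open>The map \<open>e \<mapsto> loop_at v0 e\<close> extends to a projection of chains onto cycles, whose trace is the genus.\<close>

definition loop_at :: "'v \<Rightarrow> 'e \<Rightarrow> 'e \<Rightarrow> int" where
  "loop_at v0 e = (\<lambda>e'. conn v0 (src e) e' + (if e' = e then 1 else 0) - conn v0 (tgt e) e')"

lemma loop_at_cycs:
  assumes "v0 \<in> V" "e \<in> E"
  shows "loop_at v0 e \<in> cycs"
  unfolding loop_at_def
  by (intro chains_from_to_diff[of _ v0 "tgt e"] conn chains_from_to_trans[of _ v0 "src e"] unit_in_chains)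
    (use assms tl_in hd_in in auto)

text \<open>By \<open>sum_bd\<close> the connecting chains enter only through the boundary of
  \<open>\<omega>\<close>, which is 0. So the integral loops span the 1-forms, and a functional is
  determined by its values on them.\<close>

lemma cycle_eq_sum_loops:
  fixes \<omega> :: "'e \<Rightarrow> real"
  assumes "v0 \<in> V" "\<omega> \<in> one_forms C"
  shows "\<omega> = (\<Sum>e\<in>E. \<omega> e *\<^sub>R realc (loop_at v0 e))"
proof
  fix e'
  have \<omega>: "chain \<omega>" "\<forall>v\<in>V. bd \<omega> v = 0" using assms(2) by (auto simp: one_forms_eq cycles_eq)
  have "(\<Sum>e\<in>E. \<omega> e *\<^sub>R realc (loop_at v0 e)) e' =
      (\<Sum>e\<in>E. (if e = e' then \<omega> e else 0) - \<omega> e * (real_of_int (conn v0 (tgt e) e') - conn v0 (src e) e'))"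
    unfolding sum_fun_apply by (intro sum.cong) (auto simp: scaleR_fun_def loop_at_def algebra_simps)
  also have "\<dots> = (\<Sum>e\<in>E. if e = e' then \<omega> e else 0)
      - (\<Sum>e\<in>E. \<omega> e * (real_of_int (conn v0 (tgt e) e') - conn v0 (src e) e'))"
    by (rule sum_subtractf)
  also have "(\<Sum>e\<in>E. \<omega> e * (real_of_int (conn v0 (tgt e) e') - conn v0 (src e) e')) =
      (\<Sum>v\<in>V. real_of_int (conn v0 v e') * bd \<omega> v)"
    by (subst sum_bd) simp
  also have "\<dots> = 0" using \<omega> by simp
  also have "(\<Sum>e\<in>E. if e = e' then \<omega> e else 0) = \<omega> e'"
    using \<omega>(1) by (auto simp: chain_def)
  finally show "\<omega> e' = (\<Sum>e\<in>E. \<omega> e *\<^sub>R realc (loop_at v0 e)) e'" by (simp only: diff_0_right)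
qed

text \<open>Grouped by vertices, the connecting chains contribute the boundary of
  \<open>conn v0 v\<close> at \<open>v\<close>, which is 1 except for \<open>v = v0\<close>.\<close>

lemma trace_loops:
  assumes "v0 \<in> V"
  shows "(\<Sum>e\<in>E. loop_at v0 e e) = int (card E) - int (card V) + 1"
proof -
  have chains: "conn v0 v \<in> chains_from_to v0 v" if "v \<in> V" for v using conn assms that by blast
  have "(\<Sum>e\<in>E. conn v0 (tgt e) e - conn v0 (src e) e) = (\<Sum>v\<in>V. bd (conn v0 v) v)"
  proof -
    have "(\<Sum>e\<in>E. conn v0 (g e) e) = (\<Sum>v\<in>V. \<Sum>e\<in>{e\<in>E. g e = v}. conn v0 v e)" if "\<And>e. e \<in> E \<Longrightarrow> g e \<in> V" for g
      by (subst sum.group[of E V g, symmetric]) (use that in auto)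
    from this[of tgt] this[of src] show ?thesis
      using hd_in tl_in by (simp add: bd_def sum_subtractf)
  qed
  also have "\<dots> = (\<Sum>v\<in>V. 1 - (if v = v0 then 1 else 0))"
    using chains by (intro sum.cong) (auto simp: chains_from_to_def)
  also have "\<dots> = int (card V) - 1" using assms by (simp add: sum_subtractf)
  finally have "(\<Sum>e\<in>E. conn v0 (tgt e) e - conn v0 (src e) e) = int (card V) - 1" .
  then show ?thesis by (simp add: loop_at_def sum.distrib sum_subtractf)
qed

end

section \<open>Elementary estimates for quadratic functions\<close>

lemma ex_pos_lower_bound:
  fixes f :: "'a \<Rightarrow> real"
  assumes "finite A" "\<And>a. a \<in> A \<Longrightarrow> 0 < f a"
  obtains \<delta> where "0 < \<delta>" "\<delta> \<le> 1" "\<And>a. a \<in> A \<Longrightarrow> \<delta> \<le> f a"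
proof
  \<comment> \<open>The inserted 1 keeps the minimum defined for empty \<open>A\<close> and supplies
    the bound \<open>\<delta> \<le> 1\<close>.\<close>
  show "0 < Min (insert 1 (f ` A))" "Min (insert 1 (f ` A)) \<le> 1"
    using assms by (auto simp: Min_gr_iff)
  show "Min (insert 1 (f ` A)) \<le> f a" if "a \<in> A" for a
    using assms(1) that by (intro Min_le) auto
qed

text \<open>Completing the square in \<open>\<bar>n\<bar>\<close>. The additional
  \<open>\<bar>n\<bar>\<close> on the left is the reserve against perturbations that grow linearly
  with the cycle.\<close>

lemma quadratic_upper_bound:
  fixes n x l :: real
  assumes "0 < l"
  shows "n * x - n\<^sup>2 * l / 2 + \<bar>n\<bar> \<le> (\<bar>x\<bar> + 1)\<^sup>2 / (2 * l)"
proof -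
  have "n * x \<le> \<bar>n\<bar> * \<bar>x\<bar>" by (metis abs_ge_self abs_mult)
  then have "n * x - n\<^sup>2 * l / 2 + \<bar>n\<bar> \<le> \<bar>n\<bar> * (\<bar>x\<bar> + 1) - \<bar>n\<bar>\<^sup>2 * l / 2"
    by (simp add: algebra_simps)
  also have "\<dots> = (\<bar>x\<bar> + 1)\<^sup>2 / (2 * l) - (\<bar>n\<bar> * l - (\<bar>x\<bar> + 1))\<^sup>2 / (2 * l)"
    using assms by (simp add: field_simps power2_eq_square)
  also have "\<dots> \<le> (\<bar>x\<bar> + 1)\<^sup>2 / (2 * l)" using assms by simp
  finally show ?thesis .
qed

lemma quadratic_root_bound:
  fixes n x l R :: real
  assumes "0 < l" "R \<le> n * x - n\<^sup>2 * l / 2 + \<bar>n\<bar>"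
  shows "\<bar>n\<bar> \<le> 2 * (\<bar>x\<bar> + 1 + \<bar>R\<bar>) / l + 1"
proof (rule ccontr)
  assume "\<not> ?thesis"
  then have n: "2 * (\<bar>x\<bar> + 1 + \<bar>R\<bar>) / l + 1 < \<bar>n\<bar>" by simp
  moreover have "0 \<le> 2 * (\<bar>x\<bar> + 1 + \<bar>R\<bar>) / l" using assms(1) by simp
  ultimately have n1: "1 < \<bar>n\<bar>" by linarith
  have "2 * (\<bar>x\<bar> + 1 + \<bar>R\<bar>) / l < \<bar>n\<bar>" using n by simp
  then have "\<bar>x\<bar> + 1 + \<bar>R\<bar> < \<bar>n\<bar> * l / 2" using assms(1) by (simp add: field_simps)
  then have "\<bar>n\<bar> * (\<bar>x\<bar> + 1 + \<bar>R\<bar>) < \<bar>n\<bar> * (\<bar>n\<bar> * l / 2)"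
    using n1 by (intro mult_strict_left_mono) auto
  then have "\<bar>n\<bar> * \<bar>x\<bar> + \<bar>n\<bar> + \<bar>n\<bar> * \<bar>R\<bar> < n\<^sup>2 * l / 2"
    by (simp add: algebra_simps power2_eq_square)
  moreover have "n * x \<le> \<bar>n\<bar> * \<bar>x\<bar>" by (metis abs_ge_self abs_mult)
  moreover have "1 * \<bar>R\<bar> \<le> \<bar>n\<bar> * \<bar>R\<bar>" using n1 by (intro mult_right_mono) auto
  ultimately show False using assms(2) by linarith
qed

context tropical
begin

subsection \<open>Functionals on 1-forms\<close>

lemma dualD:
  assumes "x \<in> dual_forms C"
  shows "\<omega> \<notin> one_forms C \<Longrightarrow> x \<omega> = 0"
    "\<omega> \<in> one_forms C \<Longrightarrow> \<eta> \<in> one_forms C \<Longrightarrow> x (\<omega> + \<eta>) = x \<omega> + x \<eta>"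
    "\<omega> \<in> one_forms C \<Longrightarrow> x (c *\<^sub>R \<omega>) = c * x \<omega>"
  using assms by (auto simp: dual_forms_def)

lemma dual_zero [intro, simp]: "0 \<in> dual_forms C"
  by (simp add: dual_forms_def)

lemma dual_add [intro]: "x \<in> dual_forms C \<Longrightarrow> y \<in> dual_forms C \<Longrightarrow> x + y \<in> dual_forms C"
  by (simp add: dual_forms_def algebra_simps)

lemma dual_diff [intro]: "x \<in> dual_forms C \<Longrightarrow> y \<in> dual_forms C \<Longrightarrow> x - y \<in> dual_forms C"
  by (simp add: dual_forms_def algebra_simps)

lemma dual_uminus [intro]: "x \<in> dual_forms C \<Longrightarrow> - x \<in> dual_forms C"
  by (simp add: dual_forms_def algebra_simps)

lemma dual_scale [intro]: "x \<in> dual_forms C \<Longrightarrow> c *\<^sub>R x \<in> dual_forms C"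
  by (simp add: dual_forms_def scaleR_fun_def algebra_simps)

lemma dual_sum: "(\<And>i. i \<in> A \<Longrightarrow> f i \<in> dual_forms C) \<Longrightarrow> (\<Sum>i\<in>A. f i) \<in> dual_forms C"
  by (induction A rule: infinite_finite_induct) auto

lemma one_forms_add: "\<omega> \<in> one_forms C \<Longrightarrow> \<eta> \<in> one_forms C \<Longrightarrow> \<omega> + \<eta> \<in> one_forms C"
  and one_forms_scale: "\<omega> \<in> one_forms C \<Longrightarrow> c *\<^sub>R \<omega> \<in> one_forms C"
  and one_forms_0: "0 \<in> one_forms C"
  using subspace_one_forms by (simp_all add: subspace_def)

lemma linear_on_forms_dual:
  assumes "\<And>\<omega> \<eta>. f (\<omega> + \<eta>) = f \<omega> + f \<eta>" "\<And>c \<omega>. f (c *\<^sub>R \<omega>) = c * f \<omega>"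
  shows "(\<lambda>\<omega>. if \<omega> \<in> one_forms C then f \<omega> else 0) \<in> dual_forms C"
proof -
  have "f \<omega> = 0" if "\<omega> \<in> one_forms C" "c *\<^sub>R \<omega> \<notin> one_forms C" for c \<omega>
    using one_forms_scale that by blast
  then show ?thesis by (auto simp: dual_forms_def one_forms_add one_forms_scale assms)
qed

lemma chain_integral_dual: "chain_integral C b \<in> dual_forms C"
  unfolding chain_integral_def
  by (rule linear_on_forms_dual)
    (simp_all add: scaleR_fun_def algebra_simps sum.distrib sum_distrib_left)

lemma path_integral_dual: "path_integral C xs \<in> dual_forms C"
  unfolding path_integral_def
proof (rule linear_on_forms_dual)
  show "(\<Sum>(e, s, t)\<leftarrow>xs. (\<omega> + \<eta>) e * real_of_ereal (t - s)) =
      (\<Sum>(e, s, t)\<leftarrow>xs. \<omega> e * real_of_ereal (t - s)) + (\<Sum>(e, s, t)\<leftarrow>xs. \<eta> e * real_of_ereal (t - s))"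
    for \<omega> \<eta> :: "'e \<Rightarrow> real"
    by (induction xs) (auto simp: algebra_simps)
  show "(\<Sum>(e, s, t)\<leftarrow>xs. (c *\<^sub>R \<omega>) e * real_of_ereal (t - s)) =
      c * (\<Sum>(e, s, t)\<leftarrow>xs. \<omega> e * real_of_ereal (t - s))" for c and \<omega> :: "'e \<Rightarrow> real"
    by (induction xs) (auto simp: algebra_simps scaleR_fun_def)
qed

lemma dual_sum_scale:
  assumes "x \<in> dual_forms C" "\<And>i. i \<in> A \<Longrightarrow> w i \<in> one_forms C"
  shows "x (\<Sum>i\<in>A. c i *\<^sub>R w i) = (\<Sum>i\<in>A. c i * x (w i))"
proof -
  have x0: "x 0 = 0" using dualD(3)[OF assms(1) one_forms_0, of 0] by simp
  have "(\<Sum>i\<in>A. c i *\<^sub>R w i) \<in> one_forms C \<and> x (\<Sum>i\<in>A. c i *\<^sub>R w i) = (\<Sum>i\<in>A. c i * x (w i))"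
    using assms(2)
    by (induction A rule: infinite_finite_induct)
      (auto simp: x0 one_forms_0 one_forms_add one_forms_scale dualD[OF assms(1)])
  then show ?thesis by blast
qed

lemma dual_coordinates:
  assumes "x \<in> dual_forms C" "v0 \<in> V" "\<omega> \<in> one_forms C"
  shows "x \<omega> = (\<Sum>e\<in>E. \<omega> e * x (realc (loop_at v0 e)))"
  using dual_sum_scale[OF assms(1), of E "\<lambda>e. realc (loop_at v0 e)" \<omega>]
    cycle_eq_sum_loops[OF assms(2,3)] loop_at_cycs[OF assms(2)] realc_cycle by metis

text \<open>On leaves \<open>len\<close> has the default value 0, so definiteness depends on the
  fact that 1-forms vanish there: an edge where the form is nonzero has positive length.\<close>

lemma norm_pos:
  assumes "\<omega> \<in> one_forms C" "\<omega> \<noteq> 0"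
  shows "0 < (\<Sum>e\<in>E. \<omega> e * \<omega> e * len e)"
proof -
  obtain e where e: "\<omega> e \<noteq> 0" using assms(2) by (auto simp: fun_eq_iff)
  then have eE: "e \<in> E" using assms(1) by (auto simp: one_forms_eq cycles_eq chain_def)
  then have "elen e \<noteq> \<infinity>" using assms(1) e cycle_leaf by (auto simp: one_forms_eq)
  then have "0 < len e" using elen_cases[OF eE] by blast
  moreover have "0 < \<omega> e * \<omega> e" using e by (metis not_square_less_zero linorder_neqE mult_eq_0_iff)
  ultimately have "0 < \<omega> e * \<omega> e * len e" by simp
  then show ?thesis
    using eE len_nonneg by (intro sum_pos2[of _ e]) auto
qed

lemma riesz_representation:
  assumes x: "x \<in> dual_forms C"
  obtains b where "b \<in> cycles C" "chain_integral C b = x"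
proof -
  let ?ip = "\<lambda>b \<omega>. \<Sum>e\<in>E. b e * \<omega> e * len e :: real"
  have lin: "linear (?ip w)" for w
    by (rule linearI)
      (auto simp: scaleR_fun_def algebra_simps sum.distrib sum_distrib_left)
  obtain v0 where v0: "v0 \<in> V" using V_nonempty by blast
  let ?B = "(\<lambda>e. realc (loop_at v0 e)) ` E"
  have sub: "?B \<subseteq> one_forms C" using realc_cycle loop_at_cycs[OF v0] by blast
  have span: "one_forms C = span ?B"
  proof
    show "span ?B \<subseteq> one_forms C" using sub subspace_one_forms by (rule span_minimal)
    show "one_forms C \<subseteq> span ?B"
    proof
      fix \<omega> assume "\<omega> \<in> one_forms C"
      then have "\<omega> = (\<Sum>e\<in>E. \<omega> e *\<^sub>R realc (loop_at v0 e))" by (rule cycle_eq_sum_loops[OF v0])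
      also have "\<dots> \<in> span ?B" by (intro span_sum span_scale span_base) auto
      finally show "\<omega> \<in> span ?B" .
    qed
  qed
  have "\<exists>b\<in>span ?B. \<forall>w\<in>span ?B. ?ip b w = x w"
    by (rule riesz_representation_span[OF _ sub subspace_one_forms lin, rule_format])
      (use norm_pos dualD[OF x] in \<open>auto simp: mult_ac\<close>)
  then obtain b where b: "b \<in> one_forms C" "\<And>w. w \<in> one_forms C \<Longrightarrow> ?ip b w = x w"
    by (auto simp: span)
  have "chain_integral C b = x"
    using b(2) dualD(1)[OF x] by (auto simp: chain_integral_def fun_eq_iff)
  then show ?thesis using that b(1) by (simp add: one_forms_eq)
qed

lemma chain_integral_inj:
  assumes "b \<in> cycles C" "b' \<in> cycles C" "chain_integral C b = chain_integral C b'"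
  shows "b = b'"
proof (rule ccontr)
  assume "b \<noteq> b'"
  then have ne: "b - b' \<noteq> 0" by simp
  have of: "b - b' \<in> one_forms C"
    using assms(1,2) subspace_diff[OF subspace_one_forms] by (simp add: one_forms_eq)
  have "0 < (\<Sum>e\<in>E. (b - b') e * (b - b') e * len e)" using norm_pos[OF of ne] .
  also have "\<dots> = chain_integral C b (b - b') - chain_integral C b' (b - b')"
    using of by (simp add: chain_integral_def sum_subtractf [symmetric] algebra_simps)
  finally show False using assms(3) by simp
qed

lemma real_cycle_eq: "b \<in> cycles C \<Longrightarrow> real_cycle C (chain_integral C b) = b"
  unfolding real_cycle_def using chain_integral_inj by blast

definition lat :: "('e \<Rightarrow> int) \<Rightarrow> ('e \<Rightarrow> real) \<Rightarrow> real" where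
  "lat a = chain_integral C (realc a)"

lemma lattice_eq: "lattice C = lat ` cycs"
  by (auto simp: lattice_def lat_def cycs_eq realc_def)

lemma lat_apply: "a \<in> cycs \<Longrightarrow> lat c (realc a) = (\<Sum>e\<in>E. real_of_int (c e * a e) * len e)"
  by (simp add: lat_def chain_integral_def realc_cycle)

lemma lat_dual: "lat c \<in> dual_forms C"
  by (simp add: lat_def chain_integral_dual)

lemma lat_add: "lat (\<lambda>e. a e + b e) = lat a + lat b"
  by (auto simp: lat_def chain_integral_def fun_eq_iff sum.distrib algebra_simps)

lemma lat_diff: "lat (\<lambda>e. a e - b e) = lat a - lat b"
  by (auto simp: lat_def chain_integral_def fun_eq_iff sum_subtractf algebra_simps)

lemma lat_uminus: "lat (\<lambda>e. - a e) = - lat a"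
  by (auto simp: lat_def chain_integral_def fun_eq_iff sum_negf)

lemma lat_zero: "lat (\<lambda>e. 0) = 0"
  by (auto simp: lat_def chain_integral_def fun_eq_iff)

text \<open>With one argument in the lattice, \<open>Q\<close> is just evaluation of the functional
  on the cycle. This removes \<open>real_cycle\<close> from all later arguments.\<close>

lemma Q_lattice:
  assumes "a \<in> cycs" "x \<in> dual_forms C"
  shows "Q C (lat a) x = x (realc a)"
proof -
  have a: "realc a \<in> cycles C" using realc_cycle[OF assms(1)] by (simp add: one_forms_eq)
  obtain b where b: "b \<in> cycles C" "chain_integral C b = x"
    using riesz_representation[OF assms(2)] by blast
  have "x (realc a) = (\<Sum>e\<in>E. b e * realc a e * len e)"
    using a unfolding b(2)[symmetric] by (simp add: chain_integral_def one_forms_eq)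
  then show ?thesis
    using b real_cycle_eq[OF a] real_cycle_eq[OF b(1)] by (simp add: Q_def lat_def mult_ac)
qed

section \<open>Affine pieces of the theta function and their maximizers\<close>

definition nrm :: "('e \<Rightarrow> int) \<Rightarrow> real" where
  "nrm a = (\<Sum>e\<in>E. (real_of_int (a e))\<^sup>2 * len e)"

text \<open>The affine piece of the theta function that belongs to the lattice point
  \<open>lat a\<close>. Indexing the pieces by integral cycles makes the slope of a piece along an
  edge \<open>e\<close> the integer \<open>a e\<close>.\<close>

definition val :: "(('e \<Rightarrow> real) \<Rightarrow> real) \<Rightarrow> ('e \<Rightarrow> int) \<Rightarrow> real" where
  "val x a = x (realc a) - nrm a / 2"

lemma theta_eq:
  assumes "x \<in> dual_forms C"
  shows "theta C x = (SUP a\<in>cycs. val x a)"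
proof -
  have "Q C (lat a) x - Q C (lat a) (lat a) / 2 = val x a" if "a \<in> cycs" for a
    using that assms
    by (simp add: Q_lattice lat_dual val_def lat_apply nrm_def power2_eq_square)
  then show ?thesis
    unfolding theta_def lattice_eq image_image by (intro arg_cong[of _ _ Sup] image_cong) auto
qed

definition l1 :: "('e \<Rightarrow> int) \<Rightarrow> real" where
  "l1 a = (\<Sum>e\<in>E. \<bar>real_of_int (a e)\<bar>)"

lemma l1_nonneg: "0 \<le> l1 a"
  by (simp add: l1_def sum_nonneg)

text \<open>Coercivity: in loop coordinates the value is a sum of one concave quadratic per finite
  edge, each bounded above, so a lower bound on the sum bounds every coefficient. Adding
  \<open>l1 a\<close> prepares the linear growth of the gap in \<open>N_gap\<close>.\<close>

lemma finite_val_ge: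
  assumes x: "x \<in> dual_forms C"
  shows "finite {a \<in> cycs. R \<le> val x a + l1 a}"
proof -
  obtain v0 where v0: "v0 \<in> V" using V_nonempty by blast
  define X where "X e = x (realc (loop_at v0 e))" for e
  define f where "f e n = n * X e - n\<^sup>2 * len e / 2 + \<bar>n\<bar>" for e n
  define F where "F = {e\<in>E. elen e \<noteq> \<infinity>}"
  have F: "finite F" "\<And>e. e \<in> F \<Longrightarrow> 0 < len e" "F \<subseteq> E"
    by (auto simp: F_def elim: elen_cases)
  define B where "B e = (\<bar>X e\<bar> + 1)\<^sup>2 / (2 * len e)" for e
  have B: "f e n \<le> B e" "0 \<le> B e" if "e \<in> F" for e n
    using quadratic_upper_bound[OF F(2)[OF that]] F(2)[OF that] by (auto simp: f_def B_def)
  \<comment> \<open>What one edge must contribute at least when the others contribute as much as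
    they can; the bounds \<open>B e\<close> are nonnegative, so subtracting all of them is
    safe.\<close>
  define R' where "R' = R - (\<Sum>e\<in>F. B e)"
  define M where "M = (\<Sum>e\<in>F. 2 * (\<bar>X e\<bar> + 1 + \<bar>R'\<bar>) / len e + 1)"
  have "{a \<in> cycs. R \<le> val x a + l1 a} \<subseteq>
    {a. \<forall>e. (e \<in> E \<longrightarrow> a e \<in> {- \<lceil>M\<rceil>..\<lceil>M\<rceil>}) \<and> (e \<notin> E \<longrightarrow> a e = 0)}"
  proof (intro subsetI CollectI allI conjI impI)
    fix a e assume a: "a \<in> {a \<in> cycs. R \<le> val x a + l1 a}"
    then have ac: "a \<in> cycs" by simp
    show "a e = 0" if "e \<notin> E" using ac that by (auto simp: cycs_def chain_def)
    assume e: "e \<in> E"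
    have leaf: "a e' = 0" if "e' \<in> E - F" for e'
      using cycle_leaf[of a e'] that ac by (auto simp: cycs_eq F_def)
    have "x (realc a) = (\<Sum>e\<in>E. a e * X e)"
      using dual_coordinates[OF x v0 realc_cycle[OF ac]] by (simp add: X_def)
    then have "val x a + l1 a = (\<Sum>e\<in>E. f e (a e))"
      by (simp add: val_def nrm_def l1_def f_def sum_subtractf sum.distrib sum_divide_distrib)
    also have "\<dots> = (\<Sum>e\<in>F. f e (a e))"
      using F(3) leaf by (intro sum.mono_neutral_right) (auto simp: f_def)
    finally have R: "R \<le> (\<Sum>e\<in>F. f e (a e))" using a by simp
    have "\<bar>real_of_int (a e)\<bar> \<le> M"
    proof (cases "e \<in> F")
      case True
      have "(\<Sum>e\<in>F. f e (a e)) = f e (a e) + (\<Sum>e\<in>F - {e}. f e (a e))"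
        using F(1) True by (rule sum.remove)
      also have "\<dots> \<le> f e (a e) + (\<Sum>e\<in>F - {e}. B e)"
        using B by (intro add_left_mono sum_mono) auto
      also have "(\<Sum>e\<in>F - {e}. B e) \<le> (\<Sum>e\<in>F. B e)"
        using F(1) B by (intro sum_mono2) auto
      finally have "R' \<le> f e (a e)" using R by (simp add: R'_def)
      then have "\<bar>real_of_int (a e)\<bar> \<le> 2 * (\<bar>X e\<bar> + 1 + \<bar>R'\<bar>) / len e + 1"
        using quadratic_root_bound[OF F(2)[OF True]] by (simp add: f_def)
      also have "\<dots> \<le> M"
        unfolding M_def using F True by (intro member_le_sum) (auto simp: less_imp_le)
      finally show ?thesis .
    next
      case False
      then show ?thesis using leaf e F by (auto simp: M_def less_imp_le intro!: sum_nonneg)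
    qed
    then show "a e \<in> {- \<lceil>M\<rceil>..\<lceil>M\<rceil>}" by (simp add: abs_le_iff) linarith
  qed
  moreover have "finite {a. \<forall>e. (e \<in> E \<longrightarrow> a e \<in> {- \<lceil>M\<rceil>..\<lceil>M\<rceil>}) \<and> (e \<notin> E \<longrightarrow> a e = (0::int))}"
    by (rule finite_set_of_finite_funs) auto
  ultimately show ?thesis by (rule finite_subset)
qed

definition N :: "(('e \<Rightarrow> real) \<Rightarrow> real) \<Rightarrow> ('e \<Rightarrow> int) set" where
  "N x = {a \<in> cycs. \<forall>b\<in>cycs. val x b \<le> val x a}"

lemma N_cycs: "a \<in> N x \<Longrightarrow> a \<in> cycs"
  by (simp add: N_def)

lemma val_zero: "x \<in> dual_forms C \<Longrightarrow> val x (\<lambda>e. 0) = 0"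
proof -
  assume x: "x \<in> dual_forms C"
  have "realc (\<lambda>e. 0) = 0" by (auto simp: realc_def)
  then show ?thesis using dualD(3)[OF x one_forms_0, of 0] by (simp add: val_def nrm_def)
qed

lemma N_nonempty:
  assumes x: "x \<in> dual_forms C"
  shows "N x \<noteq> {}"
proof -
  let ?L = "{a \<in> cycs. 0 \<le> val x a + l1 a}"
  have 0: "(\<lambda>e. 0) \<in> ?L" using val_zero[OF x] l1_nonneg zero_in_cycs by simp
  have "Max (val x ` ?L) \<in> val x ` ?L" using 0 finite_val_ge[OF x] by (intro Max_in) blast+
  then obtain a where a: "a \<in> ?L" "val x a = Max (val x ` ?L)" by auto
  have le: "val x b \<le> val x a" if "b \<in> ?L" for b
    unfolding a(2) using finite_val_ge[OF x, of 0] that by (intro Max_ge) auto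
  have "val x b \<le> val x a" if b: "b \<in> cycs" for b
  proof (cases "b \<in> ?L")
    case False
    then have "val x b \<le> 0" using b l1_nonneg[of b] by simp
    then show ?thesis using le[OF 0] val_zero[OF x] by simp
  qed (rule le)
  then have "a \<in> N x" using a by (simp add: N_def)
  then show ?thesis by blast
qed

text \<open>The gap grows with \<open>l1 b\<close>, so that one constant serves for infinitely many
  \<open>b\<close>. Cycles with \<open>val x b + l1 b < val x a - 1\<close> satisfy it with factor
  1; only finitely many others remain, and there a minimum is taken.\<close>

lemma N_gap:
  assumes x: "x \<in> dual_forms C" and a: "a \<in> N x"
  obtains \<delta> where "0 < \<delta>" "\<And>b. b \<in> cycs \<Longrightarrow> b \<notin> N x \<Longrightarrow> val x b + \<delta> * (1 + l1 b) \<le> val x a"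
proof -
  let ?L = "{b \<in> cycs. val x a - 1 \<le> val x b + l1 b} - N x"
  have less: "val x b < val x a" if "b \<in> cycs" "b \<notin> N x" for b
    using that a unfolding N_def by fastforce
  obtain \<delta> where \<delta>: "0 < \<delta>" "\<delta> \<le> 1" "\<And>b. b \<in> ?L \<Longrightarrow> \<delta> \<le> (val x a - val x b) / (1 + l1 b)"
  proof (rule ex_pos_lower_bound[of ?L "\<lambda>b. (val x a - val x b) / (1 + l1 b)"])
    show "finite ?L" using finite_val_ge[OF x] by simp
    show "0 < (val x a - val x b) / (1 + l1 b)" if "b \<in> ?L" for b
      using less[of b] that l1_nonneg[of b] by (intro divide_pos_pos) auto
  qed blast
  have "val x b + \<delta> * (1 + l1 b) \<le> val x a" if b: "b \<in> cycs" "b \<notin> N x" for b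
  proof (cases "b \<in> ?L")
    case True
    have "0 < 1 + l1 b" using l1_nonneg[of b] by simp
    then show ?thesis using \<delta>(3)[OF True] by (simp add: pos_le_divide_eq)
  next
    case False
    have "\<delta> * (1 + l1 b) \<le> 1 * (1 + l1 b)"
      using \<delta>(2) l1_nonneg[of b] by (intro mult_right_mono) auto
    then show ?thesis using False b by simp
  qed
  then show ?thesis using that \<delta>(1) by blast
qed

lemma finite_N:
  assumes x: "x \<in> dual_forms C"
  shows "finite (N x)"
proof (rule finite_subset)
  show "N x \<subseteq> {a \<in> cycs. 0 \<le> val x a + l1 a}"
  proof
    fix a assume a: "a \<in> N x"
    then have "val x (\<lambda>e. 0) \<le> val x a" using zero_in_cycs by (simp add: N_def)
    then show "a \<in> {a \<in> cycs. 0 \<le> val x a + l1 a}"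
      using val_zero[OF x] l1_nonneg[of a] N_cycs[OF a] by simp
  qed
qed (rule finite_val_ge[OF x])

text \<open>The hypothesis on \<open>y\<close> changes the piece of \<open>b\<close> by at most
  \<open>\<eta> * l1 b\<close>, which the gap of \<open>N_gap\<close> absorbs for all
  \<open>b\<close> at once: no new cycle can become a maximizer.\<close>

lemma N_upper_semicontinuous:
  assumes x: "x \<in> dual_forms C"
  obtains \<eta> where "0 < \<eta>"
    "\<And>y. (\<And>b. b \<in> cycs \<Longrightarrow> \<bar>y (realc b) - x (realc b)\<bar> \<le> \<eta> * l1 b) \<Longrightarrow> N y \<subseteq> N x"
proof -
  obtain a where a: "a \<in> N x" using N_nonempty[OF x] by blast
  obtain \<delta> where \<delta>: "0 < \<delta>" "\<And>b. b \<in> cycs \<Longrightarrow> b \<notin> N x \<Longrightarrow> val x b + \<delta> * (1 + l1 b) \<le> val x a"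
    using N_gap[OF x a] by blast
  \<comment> \<open>Chosen so that \<open>\<eta> * (1 + l1 a) = \<delta> / 2\<close>: half of the
    gap pays for the change at the maximizer \<open>a\<close>, and
    \<open>\<eta> \<le> \<delta>\<close> covers the change at \<open>b\<close>.\<close>
  define \<eta> where "\<eta> = \<delta> / (2 * (1 + l1 a))"
  have a1: "0 < 1 + l1 a" using l1_nonneg[of a] by simp
  have \<eta>: "0 < \<eta>" using \<delta>(1) a1 by (simp add: \<eta>_def)
  show ?thesis
  proof (rule that[OF \<eta>], rule subsetI, rule ccontr)
    fix y b
    assume y: "\<And>b. b \<in> cycs \<Longrightarrow> \<bar>y (realc b) - x (realc b)\<bar> \<le> \<eta> * l1 b"
      and b: "b \<in> N y" "b \<notin> N x"
    have "\<eta> * (1 + l1 a) = \<delta> / 2"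
    proof -
      have "d / (2 * k) * k = d / 2" if "0 < k" for d k :: real using that by simp
      from this[OF a1] show ?thesis unfolding \<eta>_def .
    qed
    then have 1: "\<eta> + \<eta> * l1 a = \<delta> / 2" by (simp add: distrib_left)
    have "\<eta> \<le> \<delta>" using 1 \<eta> \<delta>(1) l1_nonneg[of a] mult_nonneg_nonneg[of \<eta> "l1 a"] by linarith
    then have 2: "\<eta> * l1 b \<le> \<delta> * l1 b" using l1_nonneg[of b] by (rule mult_right_mono)
    have "val y b \<le> val x b + \<eta> * l1 b"
      using y[OF N_cycs[OF b(1)]] unfolding val_def abs_le_iff by linarith
    also have "\<dots> < val x a - \<eta> * l1 a"
      using \<delta>(2)[OF N_cycs[OF b(1)] b(2)] 1 2 \<delta>(1) \<eta> by (simp add: distrib_left)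
    also have "\<dots> \<le> val y a" using y[OF N_cycs[OF a]] unfolding val_def abs_le_iff by linarith
    finally show False using b(1) N_cycs[OF a] by (auto simp: N_def)
  qed
qed

lemma theta_N:
  assumes "x \<in> dual_forms C" "a \<in> N x"
  shows "theta C x = val x a"
  unfolding theta_eq[OF assms(1)]
  by (rule cSup_eq_maximum) (use assms(2) in \<open>auto simp: N_def\<close>)

lemma theta_ge:
  assumes "x \<in> dual_forms C" "a \<in> cycs"
  shows "val x a \<le> theta C x"
proof -
  obtain b where "b \<in> N x" using N_nonempty[OF assms(1)] by blast
  then show ?thesis using theta_N[OF assms(1)] assms(2) by (auto simp: N_def)
qed

lemma dual_bound:
  assumes "x \<in> dual_forms C"
  obtains K where "0 < K" "\<And>b. b \<in> cycs \<Longrightarrow> \<bar>x (realc b)\<bar> \<le> K * l1 b"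
proof -
  obtain v0 where v0: "v0 \<in> V" using V_nonempty by blast
  let ?X = "\<lambda>e. x (realc (loop_at v0 e))"
  define K where "K = 1 + (\<Sum>e\<in>E. \<bar>?X e\<bar>)"
  have K0: "0 < K" by (simp add: K_def add_pos_nonneg sum_nonneg)
  have "\<bar>x (realc b)\<bar> \<le> K * l1 b" if b: "b \<in> cycs" for b
  proof -
    have "\<bar>x (realc b)\<bar> \<le> (\<Sum>e\<in>E. \<bar>real_of_int (b e)\<bar> * \<bar>?X e\<bar>)"
      unfolding dual_coordinates[OF assms v0 realc_cycle[OF b]]
      by (rule order_trans[OF sum_abs]) (simp add: abs_mult)
    also have "\<dots> \<le> (\<Sum>e\<in>E. \<bar>real_of_int (b e)\<bar> * K)"
    proof (intro sum_mono mult_left_mono)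
      fix e assume "e \<in> E"
      then have "\<bar>?X e\<bar> \<le> (\<Sum>e\<in>E. \<bar>?X e\<bar>)" by (intro member_le_sum) auto
      then show "\<bar>?X e\<bar> \<le> K" by (simp add: K_def)
    qed simp
    finally show ?thesis by (simp add: l1_def sum_distrib_left mult_ac)
  qed
  then show ?thesis using that K0 by blast
qed

subsection \<open>The theta divisor and slopes of the theta function\<close>

text \<open>Close to \<open>x\<close> only the pieces active at \<open>x\<close> compete, and along
  a ray the steepest of them wins; the formula is exact on an initial interval, not just to first
  order.\<close>

lemma theta_ray:
  assumes x: "x \<in> dual_forms C" and z: "z \<in> dual_forms C"
  obtains \<sigma> where "0 < \<sigma>"
    "\<And>s. 0 \<le> s \<Longrightarrow> s \<le> \<sigma> \<Longrightarrow> theta C (x + s *\<^sub>R z) = theta C x + s * Max ((\<lambda>a. z (realc a)) ` N x)"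
proof -
  obtain \<eta> where \<eta>: "0 < \<eta>"
    "\<And>y. (\<And>b. b \<in> cycs \<Longrightarrow> \<bar>y (realc b) - x (realc b)\<bar> \<le> \<eta> * l1 b) \<Longrightarrow> N y \<subseteq> N x"
    using N_upper_semicontinuous[OF x] by blast
  obtain K where K: "0 < K" "\<And>b. b \<in> cycs \<Longrightarrow> \<bar>z (realc b)\<bar> \<le> K * l1 b"
    using dual_bound[OF z] by blast
  let ?M = "Max ((\<lambda>a. z (realc a)) ` N x)"
  have fin: "finite (N x)" "N x \<noteq> {}" using x finite_N N_nonempty by auto
  show ?thesis
  proof (rule that[of "\<eta> / K"])
    show "0 < \<eta> / K" using \<eta> K by simp
    fix s :: real assume s: "0 \<le> s" "s \<le> \<eta> / K"
    let ?y = "x + s *\<^sub>R z"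
    have y: "?y \<in> dual_forms C" using x z by blast
    have sub: "N ?y \<subseteq> N x"
    proof (rule \<eta>(2))
      fix b assume b: "b \<in> cycs"
      have "\<bar>?y (realc b) - x (realc b)\<bar> = s * \<bar>z (realc b)\<bar>"
        using s by (simp add: scaleR_fun_def abs_mult)
      also have "\<dots> \<le> s * (K * l1 b)" using K(2)[OF b] s by (intro mult_left_mono) auto
      also have "\<dots> \<le> (\<eta> / K) * (K * l1 b)"
        using s K(1) l1_nonneg[of b] by (intro mult_right_mono) auto
      also have "\<dots> = \<eta> * l1 b" using K(1) by simp
      finally show "\<bar>?y (realc b) - x (realc b)\<bar> \<le> \<eta> * l1 b" .
    qed
    have val_y: "val ?y a = theta C x + s * z (realc a)" if "a \<in> N x" for a
      using theta_N[OF x that] by (simp add: val_def scaleR_fun_def)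
    have "?M \<in> (\<lambda>a. z (realc a)) ` N x" using fin by (intro Max_in) auto
    then obtain a where a: "a \<in> N x" "?M = z (realc a)" by blast
    obtain b where b: "b \<in> N ?y" using N_nonempty[OF y] by blast
    have "theta C ?y = theta C x + s * z (realc b)"
      using theta_N[OF y b] val_y sub b by auto
    also have "\<dots> \<le> theta C x + s * ?M"
      using s sub b fin by (intro add_left_mono mult_left_mono Max_ge) auto
    finally have "theta C ?y \<le> theta C x + s * ?M" .
    moreover have "theta C x + s * ?M \<le> theta C ?y"
      using theta_ge[OF y N_cycs[OF a(1)]] val_y[OF a(1)] a(2) by simp
    ultimately show "theta C ?y = theta C x + s * ?M" by simp
  qed
qed

text \<open>The piece of \<open>-a\<close> at \<open>-x\<close> has the same value as the piece of
  \<open>a\<close> at \<open>x\<close>.\<close>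

lemma N_uminus:
  assumes "x \<in> dual_forms C"
  shows "N (- x) = (\<lambda>a e. - a e) ` N x"
proof -
  have neg: "realc (\<lambda>e. - a e) = (-1) *\<^sub>R realc a" for a
    by (auto simp: realc_def scaleR_fun_def)
  have val: "val (- y) (\<lambda>e. - a e) = val y a" if "a \<in> cycs" "y \<in> dual_forms C" for a y
    using dualD(3)[OF that(2) realc_cycle[OF that(1)], of "-1"] unfolding val_def neg
    by (simp add: nrm_def)
  have sub: "(\<lambda>e. - a e) \<in> N (- y)" if a: "a \<in> N y" and y: "y \<in> dual_forms C" for a y
    unfolding N_def
  proof (rule CollectI, rule conjI[OF cycs_uminus[OF N_cycs[OF a]]], rule ballI)
    fix b assume b: "b \<in> cycs"
    have "val (- y) b = val y (\<lambda>e. - b e)" using val[OF cycs_uminus[OF b] y] by simp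
    also have "\<dots> \<le> val y a" using a cycs_uminus[OF b] by (simp add: N_def)
    also have "\<dots> = val (- y) (\<lambda>e. - a e)" using val[OF N_cycs[OF a] y] by simp
    finally show "val (- y) b \<le> val (- y) (\<lambda>e. - a e)" .
  qed
  show ?thesis
  proof safe
    fix a assume a: "a \<in> N (- x)"
    then have "(\<lambda>e. - a e) \<in> N (- (- x))" using dual_uminus[OF assms] by (rule sub)
    then show "a \<in> (\<lambda>a e. - a e) ` N x" by (intro image_eqI[of _ _ "\<lambda>e. - a e"]) auto
  next
    fix a assume "a \<in> N x"
    then show "(\<lambda>e. - a e) \<in> N (- x)" using assms by (rule sub)
  qed
qed

text \<open>Quasi-periodicity: replacing \<open>y\<close> by \<open>y + lat c\<close> and
  \<open>a\<close> by \<open>a + c\<close> changes the value by an amount that does not depend on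
  \<open>a\<close>.\<close>

lemma N_shift:
  assumes x: "x \<in> dual_forms C" and c: "c \<in> cycs"
  shows "N (x + lat c) = (\<lambda>a e. a e + c e) ` N x"
proof -
  have cyc_add: "(\<lambda>e. a e + c e) \<in> cycs" if "a \<in> cycs" "c \<in> cycs" for a c
    using that by (auto simp: cycs_def chain_add bd_add)
  have val: "val (y + lat c) (\<lambda>e. a e + c e) = val y a + (y (realc c) + nrm c / 2)"
    if "a \<in> cycs" "c \<in> cycs" "y \<in> dual_forms C" for a c y
  proof -
    have "realc (\<lambda>e. a e + c e) = realc a + realc c" by (auto simp: realc_def)
    then have 1: "y (realc (\<lambda>e. a e + c e)) = y (realc a) + y (realc c)"
      using dualD(2)[OF that(3)] realc_cycle that by simp
    have 2: "lat c (realc (\<lambda>e. a e + c e)) - nrm (\<lambda>e. a e + c e) / 2 = nrm c / 2 - nrm a / 2"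
      unfolding lat_apply[OF cyc_add[OF that(1,2)]] nrm_def sum_divide_distrib sum_subtractf [symmetric]
      by (intro sum.cong) (auto simp: power2_eq_square field_simps)
    show ?thesis using 1 2 by (simp add: val_def)
  qed
  have sub: "(\<lambda>e. a e + c e) \<in> N (y + lat c)" if a: "a \<in> N y" and y: "y \<in> dual_forms C" and c: "c \<in> cycs" for a y c
    unfolding N_def
  proof (rule CollectI, rule conjI[OF cyc_add[OF N_cycs[OF a] c]], rule ballI)
    fix b assume b: "b \<in> cycs"
    have b': "(\<lambda>e. b e - c e) \<in> cycs" using b c by (auto simp: cycs_def chain_diff bd_diff)
    have "val (y + lat c) b = val y (\<lambda>e. b e - c e) + (y (realc c) + nrm c / 2)"
      using val[OF b' c y] by simp
    also have "\<dots> \<le> val y a + (y (realc c) + nrm c / 2)" using a b' by (simp add: N_def)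
    also have "\<dots> = val (y + lat c) (\<lambda>e. a e + c e)" using val[OF N_cycs[OF a] c y] by simp
    finally show "val (y + lat c) b \<le> val (y + lat c) (\<lambda>e. a e + c e)" .
  qed
  show ?thesis
  proof safe
    fix a assume a: "a \<in> N (x + lat c)"
    have "(\<lambda>e. a e + - c e) \<in> N (x + lat c + lat (\<lambda>e. - c e))"
      using a x c by (intro sub cycs_uminus dual_add lat_dual)
    then show "a \<in> (\<lambda>a e. a e + c e) ` N x"
      by (intro image_eqI[of _ _ "\<lambda>e. a e - c e"]) (auto simp: lat_uminus)
  next
    fix a assume "a \<in> N x"
    then show "(\<lambda>e. a e + c e) \<in> N (x + lat c)" using x c by (rule sub)
  qed
qed

lemma locally_affineI:
  assumes x: "x \<in> dual_forms C" and N: "N x = {a}"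
  shows "locally_affine_at C (theta C) x"
proof -
  obtain v0 where v0: "v0 \<in> V" using V_nonempty by blast
  obtain \<eta> where \<eta>: "0 < \<eta>"
    "\<And>y. (\<And>b. b \<in> cycs \<Longrightarrow> \<bar>y (realc b) - x (realc b)\<bar> \<le> \<eta> * l1 b) \<Longrightarrow> N y \<subseteq> N x"
    using N_upper_semicontinuous[OF x] by blast
  let ?w = "\<lambda>e. realc (loop_at v0 e)"
  \<comment> \<open>Finitely many loop coordinates control all values on integral cycles, so this
    set is open for pointwise convergence and still satisfies the uniform condition with
    \<open>l1\<close>.\<close>
  define U where "U = (\<Inter>e\<in>E. {y. \<bar>y (?w e) - x (?w e)\<bar> < \<eta>})"
  have "open U"
    unfolding U_def
    by (intro open_INT ballI open_Collect_less continuous_intros continuous_on_product_coordinates) simp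
  moreover have "x \<in> U" using \<eta>(1) by (simp add: U_def)
  moreover have "theta C y = val y a" if y: "y \<in> U" "y \<in> dual_forms C" for y
  proof -
    have "N y \<subseteq> N x"
    proof (rule \<eta>(2))
      fix b assume b: "b \<in> cycs"
      have "y (realc b) - x (realc b) = (\<Sum>e\<in>E. b e * (y (?w e) - x (?w e)))"
        unfolding dual_coordinates[OF y(2) v0 realc_cycle[OF b]] dual_coordinates[OF x v0 realc_cycle[OF b]]
        by (simp add: sum_subtractf [symmetric] algebra_simps)
      also have "\<bar>\<dots>\<bar> \<le> (\<Sum>e\<in>E. \<bar>real_of_int (b e)\<bar> * \<bar>y (?w e) - x (?w e)\<bar>)"
        by (rule order_trans[OF sum_abs]) (simp add: abs_mult)
      also have "\<dots> \<le> (\<Sum>e\<in>E. \<bar>real_of_int (b e)\<bar> * \<eta>)"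
        using y(1) by (intro sum_mono mult_left_mono) (auto simp: U_def intro: less_imp_le)
      finally show "\<bar>y (realc b) - x (realc b)\<bar> \<le> \<eta> * l1 b"
        by (simp add: l1_def sum_distrib_left mult_ac)
    qed
    then have "a \<in> N y" using N N_nonempty[OF y(2)] by (metis subset_singleton_iff insertI1)
    then show ?thesis by (rule theta_N[OF y(2)])
  qed
  moreover have "val ((1 - s) *\<^sub>R y + s *\<^sub>R z) a = (1 - s) * val y a + s * val z a" for y z s
    by (simp add: val_def scaleR_fun_def field_simps)
  ultimately show ?thesis
    unfolding locally_affine_at_def
    by (intro exI[of _ U] exI[of _ "\<lambda>y. val y a"] conjI ballI allI) (assumption | elim IntE)+
qed

text \<open>On the line through \<open>x\<close> in the direction \<open>lat (a - b)\<close> an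
  affine function equals the mean of its values at opposite points. The pieces \<open>a\<close> and
  \<open>b\<close> bound these two values from below, and their slopes differ by the squared norm of
  \<open>a - b\<close>, which must then be 0.\<close>

lemma locally_affineD:
  assumes x: "x \<in> dual_forms C" and "locally_affine_at C (theta C) x"
    and a: "a \<in> N x" and b: "b \<in> N x"
  shows "a = b"
proof (rule ccontr)
  assume ne: "a \<noteq> b"
  obtain U A where U: "open U" "x \<in> U"
    "\<And>y z s. y \<in> dual_forms C \<Longrightarrow> z \<in> dual_forms C \<Longrightarrow> A ((1 - s) *\<^sub>R y + s *\<^sub>R z) = (1 - s) * A y + s * A z"
    "\<And>y. y \<in> U \<Longrightarrow> y \<in> dual_forms C \<Longrightarrow> theta C y = A y"
  proof -
    from assms(2) obtain U A where "open U \<and> x \<in> U \<and>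
        (\<forall>y\<in>dual_forms C. \<forall>z\<in>dual_forms C. \<forall>s::real.
          A ((1 - s) *\<^sub>R y + s *\<^sub>R z) = (1 - s) * A y + s * A z) \<and>
        (\<forall>y\<in>U \<inter> dual_forms C. theta C y = A y)"
      unfolding locally_affine_at_def by (elim exE) rule
    then show ?thesis using that[of U A] by simp
  qed
  let ?c = "\<lambda>e. a e - b e"
  let ?z = "lat ?c"
  have cont: "continuous_on UNIV (\<lambda>s. x + s *\<^sub>R ?z :: ('e \<Rightarrow> real) \<Rightarrow> real)"
    by (rule continuous_on_coordinatewise_then_product)
      (auto simp: scaleR_fun_def intro!: continuous_intros)
  have "open ((\<lambda>s. x + s *\<^sub>R ?z) -` U)" using cont U(1) by (auto simp: continuous_on_open_vimage)
  moreover have "0 \<in> (\<lambda>s. x + s *\<^sub>R ?z) -` U" using U(2) by simp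
  ultimately obtain r where r: "0 < r" "ball 0 r \<subseteq> (\<lambda>s. x + s *\<^sub>R ?z) -` U"
    using open_contains_ball by blast
  define s where "s = r / 2"
  have s: "0 < s" "x + s *\<^sub>R ?z \<in> U" "x + (- s) *\<^sub>R ?z \<in> U"
    using r(1) subsetD[OF r(2), of s] subsetD[OF r(2), of "- s"] by (auto simp: s_def)
  have d: "x + t *\<^sub>R ?z \<in> dual_forms C" for t using x lat_dual by blast
  have "x = (1 - 1 / 2) *\<^sub>R (x + s *\<^sub>R ?z) + (1 / 2) *\<^sub>R (x + (- s) *\<^sub>R ?z)"
    by (simp add: algebra_simps flip: scaleR_add_left)
  then have "A x = A ((1 - 1 / 2) *\<^sub>R (x + s *\<^sub>R ?z) + (1 / 2) *\<^sub>R (x + (- s) *\<^sub>R ?z))"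
    by (rule arg_cong)
  also have "\<dots> = (1 - 1 / 2) * A (x + s *\<^sub>R ?z) + (1 / 2) * A (x + (- s) *\<^sub>R ?z)"
    by (rule U(3)[OF d d])
  finally have "A x = (1 - 1 / 2) * A (x + s *\<^sub>R ?z) + (1 / 2) * A (x + (- s) *\<^sub>R ?z)" .
  then have mid: "2 * theta C x = theta C (x + s *\<^sub>R ?z) + theta C (x + (- s) *\<^sub>R ?z)"
    using U(4)[OF U(2) x] U(4)[OF s(2) d] U(4)[OF s(3) d] by simp
  have 1: "theta C x + t * ?z (realc k) \<le> theta C (x + t *\<^sub>R ?z)" if "k \<in> N x" for k t
    using theta_ge[OF d N_cycs[OF that], of t] theta_N[OF x that] by (simp add: val_def scaleR_fun_def)
  have cc: "?c \<in> cycs" using N_cycs[OF a] N_cycs[OF b] by (auto simp: cycs_def chain_diff bd_diff)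
  have "s * (?z (realc a) - ?z (realc b)) \<le> 0"
    using mid 1[OF a, of s] 1[OF b, of "- s"] by (simp add: algebra_simps)
  moreover have "?z (realc a) - ?z (realc b) = (\<Sum>e\<in>E. realc ?c e * realc ?c e * len e)"
    unfolding lat_apply[OF N_cycs[OF a]] lat_apply[OF N_cycs[OF b]]
    by (simp add: sum_subtractf [symmetric] algebra_simps)
  moreover have "0 < (\<Sum>e\<in>E. realc ?c e * realc ?c e * len e)"
  proof (rule norm_pos[OF realc_cycle[OF cc]])
    show "realc ?c \<noteq> 0" using ne by (auto simp: fun_eq_iff)
  qed
  ultimately show False using s(1) by (simp add: mult_le_0_iff)
qed

lemma mem_theta_divisor_iff:
  "j \<in> theta_divisor C \<longleftrightarrow> (\<exists>x. j = x +o lattice C \<and> x \<in> dual_forms C \<and> (\<exists>a\<in>N x. \<exists>b\<in>N x. a \<noteq> b))"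
proof -
  have "\<not> locally_affine_at C (theta C) x \<longleftrightarrow> (\<exists>a\<in>N x. \<exists>b\<in>N x. a \<noteq> b)" if "x \<in> dual_forms C" for x
  proof
    assume *: "\<not> locally_affine_at C (theta C) x"
    obtain a where a: "a \<in> N x" using N_nonempty[OF \<open>x \<in> dual_forms C\<close>] by blast
    have "N x \<noteq> {a}" using locally_affineI[OF that] * by blast
    then obtain b where "b \<in> N x" "b \<noteq> a" using a by blast
    then show "\<exists>a\<in>N x. \<exists>b\<in>N x. a \<noteq> b" using a by blast
  next
    assume "\<exists>a\<in>N x. \<exists>b\<in>N x. a \<noteq> b"
    then show "\<not> locally_affine_at C (theta C) x" using locally_affineD[OF that] by metis
  qed
  then show ?thesis unfolding theta_divisor_def mem_Collect_eq by (simp cong: conj_cong)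
qed

text \<open>One-sided derivative of the theta function at \<open>w\<close> along \<open>\<epsilon>\<close> times the edge \<open>e\<close>: the largest
  slope among the affine pieces active at \<open>w\<close>.\<close>

definition slope :: "(('e \<Rightarrow> real) \<Rightarrow> real) \<Rightarrow> 'e \<Rightarrow> int \<Rightarrow> int" where
  "slope w e \<epsilon> = Max ((\<lambda>a. \<epsilon> * a e) ` N w)"

lemma slope_leaf:
  assumes "w \<in> dual_forms C" "e \<in> E" "elen e = \<infinity>"
  shows "slope w e \<epsilon> = 0"
proof -
  have "a e = 0" if "a \<in> N w" for a
    using cycle_leaf[of a e] N_cycs[OF that] assms(2,3) by (simp add: cycs_eq)
  then have "(\<lambda>a. \<epsilon> * a e) ` N w = (\<lambda>a. 0) ` N w" by (intro image_cong) auto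
  then have "(\<lambda>a. \<epsilon> * a e) ` N w = {0}" using N_nonempty[OF assms(1)] by (metis image_constant_conv)
  then show ?thesis by (simp add: slope_def)
qed

lemma outgoing_slope_eq:
  assumes l: "l \<in> dual_forms C" and e: "e \<in> E" and t: "0 \<le> t" "t \<le> elen e"
  shows "outgoing_slope C (\<lambda>x. theta C (x - l)) xs (e, t, real_of_int \<epsilon>) =
    slope (path_integral C xs - l) e \<epsilon>"
proof -
  define w where "w = path_integral C xs - l"
  define z :: "('e \<Rightarrow> real) \<Rightarrow> real" where "z = (\<lambda>\<omega>. if \<omega> \<in> one_forms C then real_of_int \<epsilon> * \<omega> e else 0)"
  have w: "w \<in> dual_forms C" unfolding w_def using path_integral_dual l by blast
  have z: "z \<in> dual_forms C" unfolding z_def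
    by (rule linear_on_forms_dual) (simp_all add: algebra_simps scaleR_fun_def)
  have zN: "(\<lambda>a. z (realc a)) ` N w = real_of_int ` ((\<lambda>a. \<epsilon> * a e) ` N w)"
    unfolding image_image by (intro image_cong refl) (simp add: z_def realc_cycle N_cycs)
  have "Max ((\<lambda>a. z (realc a)) ` N w) = real_of_int (slope w e \<epsilon>)"
    unfolding zN slope_def
    by (intro mono_Max_commute[symmetric] monoI) (use finite_N[OF w] N_nonempty[OF w] in auto)
  then obtain \<sigma> where \<sigma>: "0 < \<sigma>"
    "\<And>s. 0 \<le> s \<Longrightarrow> s \<le> \<sigma> \<Longrightarrow> theta C (w + s *\<^sub>R z) = theta C w + s * slope w e \<epsilon>"
    using theta_ray[OF w z] by metis
  have seg: "path_integral C (xs @ [(e, t, t + ereal (real_of_int \<epsilon> * s))]) - l = w + s *\<^sub>R z" for s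
  proof
    fix \<omega>
    show "(path_integral C (xs @ [(e, t, t + ereal (real_of_int \<epsilon> * s))]) - l) \<omega> = (w + s *\<^sub>R z) \<omega>"
    proof (cases "\<omega> \<in> one_forms C")
      case True
      \<comment> \<open>On a leaf \<open>t\<close> may be infinite and the difference takes a
        default value; it is multiplied by \<open>\<omega> e = 0\<close>.\<close>
      have "\<omega> e * real_of_ereal (t + ereal (real_of_int \<epsilon> * s) - t) = real_of_int \<epsilon> * s * \<omega> e"
        using e
      proof (cases rule: elen_cases)
        case finite
        with t obtain t' where "t = ereal t'" by (cases t) auto
        then show ?thesis by simp
      next
        case leaf
        then have "\<omega> e = 0" using cycle_leaf True e by (simp add: one_forms_eq)
        then show ?thesis by simp
      qed
      then show ?thesis using True by (simp add: w_def z_def path_integral_def scaleR_fun_def mult_ac)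
    qed (simp add: w_def z_def path_integral_def scaleR_fun_def)
  qed
  let ?g = "\<lambda>s. theta C (path_integral C (xs @ [(e, t, t + ereal (real_of_int \<epsilon> * s))]) - l)"
  have "((\<lambda>s. theta C w + s * real_of_int (slope w e \<epsilon>)) has_vector_derivative real_of_int (slope w e \<epsilon>))
      (at 0 within {0..})"
    unfolding has_real_derivative_iff_has_vector_derivative [symmetric]
    by (auto intro!: derivative_eq_intros)
  then have "(?g has_vector_derivative real_of_int (slope w e \<epsilon>)) (at 0 within {0..})"
    by (rule has_vector_derivative_transform_within[where d = \<sigma>])
      (use \<sigma> in \<open>auto simp: seg dist_real_def\<close>)
  then have "(?g has_vector_derivative real_of_int (slope w e \<epsilon>)) (at_right 0)"
    by (rule has_vector_derivative_within_subset) auto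
  then show ?thesis
    unfolding outgoing_slope_def prod.case w_def [symmetric]
    by (intro vector_derivative_within) auto
qed

subsection \<open>Paths and the Abel--Jacobi map\<close>

lemma lattice_0: "0 \<in> lattice C"
  using zero_in_cycs lat_zero by (force simp: lattice_eq)

lemma lattice_add: "x \<in> lattice C \<Longrightarrow> y \<in> lattice C \<Longrightarrow> x + y \<in> lattice C"
proof -
  have "lat a + lat b \<in> lat ` cycs" if "a \<in> cycs" "b \<in> cycs" for a b
  proof (rule image_eqI)
    show "lat a + lat b = lat (\<lambda>e. a e + b e)" by (simp add: lat_add)
    show "(\<lambda>e. a e + b e) \<in> cycs" using that by (auto simp: cycs_def chain_add bd_add)
  qed
  then show "x \<in> lattice C \<Longrightarrow> y \<in> lattice C \<Longrightarrow> x + y \<in> lattice C" by (auto simp: lattice_eq)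
qed

lemma lattice_uminus: "x \<in> lattice C \<Longrightarrow> - x \<in> lattice C"
  by (auto simp: lattice_eq lat_uminus [symmetric] intro!: imageI cycs_uminus)

lemma lattice_diff: "x \<in> lattice C \<Longrightarrow> y \<in> lattice C \<Longrightarrow> x - y \<in> lattice C"
  using lattice_add[of x "- y"] lattice_uminus by simp

lemma lattice_scale: "x \<in> lattice C \<Longrightarrow> real_of_int k *\<^sub>R x \<in> lattice C"
proof -
  have "real_of_int k *\<^sub>R lat a \<in> lat ` cycs" if "a \<in> cycs" for a
  proof (rule image_eqI)
    show "real_of_int k *\<^sub>R lat a = lat (\<lambda>e. k * a e)"
      by (auto simp: lat_def chain_integral_def scaleR_fun_def fun_eq_iff sum_distrib_left mult_ac)
    show "(\<lambda>e. k * a e) \<in> cycs" using that by (auto simp: cycs_def chain_def bd_cmult)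
  qed
  then show "x \<in> lattice C \<Longrightarrow> real_of_int k *\<^sub>R x \<in> lattice C" by (auto simp: lattice_eq)
qed

lemma lattice_sum: "(\<And>i. i \<in> A \<Longrightarrow> f i \<in> lattice C) \<Longrightarrow> (\<Sum>i\<in>A. f i) \<in> lattice C"
  by (induction A rule: infinite_finite_induct) (auto intro: lattice_0 lattice_add)

lemma lattice_dual: "x \<in> lattice C \<Longrightarrow> x \<in> dual_forms C"
  by (auto simp: lattice_eq lat_dual)

lemma coset_eq_iff: "x +o lattice C = y +o lattice C \<longleftrightarrow> x - y \<in> lattice C"
proof
  assume "x +o lattice C = y +o lattice C"
  moreover have "x \<in> x +o lattice C" using lattice_0 by (force simp: elt_set_plus_def)
  ultimately show "x - y \<in> lattice C" by (simp add: set_minus_plus)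
next
  assume xy: "x - y \<in> lattice C"
  show "x +o lattice C = y +o lattice C"
  proof safe
    fix z assume "z \<in> x +o lattice C"
    then have "z - x \<in> lattice C" by (simp add: set_minus_plus)
    then have "(z - x) + (x - y) \<in> lattice C" using xy by (rule lattice_add)
    then show "z \<in> y +o lattice C" by (simp add: set_minus_plus)
  next
    fix z assume "z \<in> y +o lattice C"
    then have "z - y \<in> lattice C" by (simp add: set_minus_plus)
    then have "(z - y) - (x - y) \<in> lattice C" using xy by (rule lattice_diff)
    then show "z \<in> x +o lattice C" by (simp add: set_minus_plus)
  qed
qed

lemma coset_add: "(x +o lattice C) + (y +o lattice C) = (x + y) +o lattice C"
proof -
  have "lattice C + lattice C = lattice C"
    using lattice_add lattice_0 by (force simp: set_plus_def)
  then show ?thesis by (simp add: set_plus_rearrange)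
qed

text \<open>A point inside an edge is reached from the tail of the edge by a partial segment, whose
  integral is \<open>off p\<close>. Lifts of points are thus described by integral chains between
  vertices together with offsets.\<close>

definition base :: "('v, 'e) point \<Rightarrow> 'v" where
  "base p = (case p of Vertex v \<Rightarrow> v | Interior e t \<Rightarrow> src e)"

definition edgef :: "'e \<Rightarrow> ('e \<Rightarrow> real) \<Rightarrow> real" where
  "edgef e = (\<lambda>\<omega>. if \<omega> \<in> one_forms C then \<omega> e else 0)"

definition off :: "('v, 'e) point \<Rightarrow> ('e \<Rightarrow> real) \<Rightarrow> real" where
  "off p = (case p of Vertex v \<Rightarrow> 0 | Interior e t \<Rightarrow> t *\<^sub>R edgef e)"

lemma edgef_dual: "edgef e \<in> dual_forms C"
  unfolding edgef_def by (rule linear_on_forms_dual) (simp_all add: scaleR_fun_def)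

lemma off_dual: "off p \<in> dual_forms C"
  using edgef_dual by (cases p) (auto simp: off_def)

lemma lat_unit: "e \<in> E \<Longrightarrow> lat (\<lambda>\<tau>. if \<tau> = e then 1 else 0) = len e *\<^sub>R edgef e"
proof (rule ext)
  fix \<omega> assume e: "e \<in> E"
  have "(\<Sum>\<tau>\<in>E. realc (\<lambda>\<tau>. if \<tau> = e then 1 else 0) \<tau> * \<omega> \<tau> * len \<tau>) =
      (\<Sum>\<tau>\<in>E. if \<tau> = e then \<omega> e * len e else 0)" by (rule sum.cong) auto
  then show "lat (\<lambda>\<tau>. if \<tau> = e then 1 else 0) \<omega> = (len e *\<^sub>R edgef e) \<omega>"
    using e by (simp add: lat_def chain_integral_def edgef_def scaleR_fun_def)
qed

lemma edgef_leaf: "e \<in> E \<Longrightarrow> elen e = \<infinity> \<Longrightarrow> edgef e = 0"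
  using cycle_leaf by (auto simp: edgef_def one_forms_eq fun_eq_iff)

lemma base_in: "p \<in> points C \<Longrightarrow> base p \<in> V"
  by (auto simp: points_def base_def tl_in)

lemma point_at_in:
  assumes "e \<in> E" "0 \<le> t" "t \<le> elen e"
  shows "point_at C e t \<in> points C"
proof -
  have "0 < real_of_ereal t \<and> ereal (real_of_ereal t) < elen e" if "t \<noteq> 0" "t \<noteq> elen e"
    using assms that by (cases t; cases "elen e") auto
  then show ?thesis using assms tl_in hd_in by (auto simp: point_at_def points_def)
qed

lemma point_at_0: "point_at C e 0 = Vertex (src e)"
  by (simp add: point_at_def)

lemma point_at_len: "e \<in> E \<Longrightarrow> point_at C e (elen e) = Vertex (tgt e)"
  using elen_pos[of e] by (auto simp: point_at_def)

lemma point_at_Interior: "Interior e t \<in> points C \<Longrightarrow> point_at C e (ereal t) = Interior e t"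
  by (auto simp: point_at_def points_def zero_ereal_def)

lemma Interior_points: "Interior e t \<in> points C \<longleftrightarrow> e \<in> E \<and> 0 < t \<and> ereal t < elen e"
  by (auto simp: points_def)

lemma Vertex_points: "Vertex v \<in> points C \<longleftrightarrow> v \<in> V"
  by (auto simp: points_def)

lemma segment_from_tail:
  assumes "e \<in> E" "0 \<le> t" "t \<le> elen e"
  shows "\<exists>c. c \<in> chains_from_to (src e) (base (point_at C e t)) \<and>
    real_of_ereal t *\<^sub>R edgef e = lat c + off (point_at C e t)"
proof -
  consider "t = 0" | "t = elen e" | "t \<noteq> 0" "t \<noteq> elen e" by blast
  then show ?thesis
  proof cases
    case 1
    then show ?thesis using zero_in_chains lat_zero
      by (intro exI[of _ "\<lambda>e. 0"]) (auto simp: point_at_0 base_def off_def)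
  next
    case 2
    then show ?thesis using unit_in_chains[OF assms(1)] lat_unit[OF assms(1)] point_at_len[OF assms(1)]
      by (intro exI[of _ "\<lambda>\<tau>. if \<tau> = e then 1 else 0"]) (simp add: base_def off_def)
  next
    case 3
    then have "point_at C e t = Interior e (real_of_ereal t)" by (simp add: point_at_def)
    then show ?thesis using zero_in_chains lat_zero
      by (intro exI[of _ "\<lambda>e. 0"]) (auto simp: base_def off_def)
  qed
qed

lemma path_integral_Cons:
  assumes "e \<in> E" "0 \<le> s" "s \<le> elen e" "0 \<le> t" "t \<le> elen e"
  shows "path_integral C ((e, s, t) # xs) =
    path_integral C xs + real_of_ereal t *\<^sub>R edgef e - real_of_ereal s *\<^sub>R edgef e"
proof
  fix \<omega>
  show "path_integral C ((e, s, t) # xs) \<omega> =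
    (path_integral C xs + real_of_ereal t *\<^sub>R edgef e - real_of_ereal s *\<^sub>R edgef e) \<omega>"
  proof (cases "\<omega> \<in> one_forms C")
    case True
    have "\<omega> e * real_of_ereal (t - s) = real_of_ereal t * \<omega> e - real_of_ereal s * \<omega> e"
      using assms(1)
    proof (cases rule: elen_cases)
      case finite
      then obtain s' t' where "s = ereal s'" "t = ereal t'"
        using assms by (cases s; cases t) auto
      then show ?thesis by (simp add: algebra_simps)
    next
      case leaf
      then have "\<omega> e = 0" using cycle_leaf True assms(1) by (simp add: one_forms_eq)
      then show ?thesis by simp
    qed
    then show ?thesis using True by (simp add: path_integral_def edgef_def scaleR_fun_def)
  qed (simp add: path_integral_def edgef_def scaleR_fun_def)
qed

text \<open>Each segment of a path is the difference of two segments starting at the tail of its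
  edge, so the offsets at intermediate points cancel and an integral chain between the base vertices
  remains.\<close>

lemma path_integral_decomposition:
  assumes "is_path C p xs q"
  shows "\<exists>c. c \<in> chains_from_to (base p) (base q) \<and> path_integral C xs = lat c + off q - off p"
  using assms
proof (induction rule: is_path.induct)
  case (Nil p)
  show ?case using zero_in_chains lat_zero
    by (intro exI[of _ "\<lambda>e. 0"]) (auto simp: path_integral_def fun_eq_iff)
next
  case (Cons e s t xs q)
  obtain c where c: "c \<in> chains_from_to (base (point_at C e t)) (base q)"
    "path_integral C xs = lat c + off q - off (point_at C e t)" using Cons.IH by blast
  obtain a where a: "a \<in> chains_from_to (src e) (base (point_at C e s))"
    "real_of_ereal s *\<^sub>R edgef e = lat a + off (point_at C e s)"
    using segment_from_tail[of e s] Cons by blast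
  obtain b where b: "b \<in> chains_from_to (src e) (base (point_at C e t))"
    "real_of_ereal t *\<^sub>R edgef e = lat b + off (point_at C e t)"
    using segment_from_tail[of e t] Cons by blast
  have 1: "(\<lambda>e. - a e) \<in> chains_from_to (base (point_at C e s)) (src e)"
    using a(1) by (rule uminus_in_chains)
  have "(\<lambda>e. - a e + b e + c e) \<in> chains_from_to (base (point_at C e s)) (base q)"
    by (rule chains_from_to_trans[OF chains_from_to_trans[OF 1 b(1)] c(1)])
  moreover have "path_integral C ((e, s, t) # xs) = lat (\<lambda>e. - a e + b e + c e) + off q - off (point_at C e s)"
    using Cons.hyps unfolding lat_add lat_uminus by (simp add: path_integral_Cons a(2) b(2) c(2))
  ultimately show ?case by blast
qed

lemma is_path_append: "is_path C p xs q \<Longrightarrow> is_path C q ys r \<Longrightarrow> is_path C p (xs @ ys) r"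
  by (induction rule: is_path.induct) (auto intro: is_path.Cons)

lemma is_path_segment:
  "e \<in> E \<Longrightarrow> 0 \<le> s \<Longrightarrow> s \<le> elen e \<Longrightarrow> 0 \<le> t \<Longrightarrow> t \<le> elen e \<Longrightarrow>
    is_path C (point_at C e s) [(e, s, t)] (point_at C e t)"
  by (intro is_path.Cons is_path.Nil point_at_in)

lemma reachable_path:
  assumes "u \<rightarrow>\<^sup>*\<^bsub>mk_symmetric (graph C)\<^esub> v" "u \<in> V"
  shows "\<exists>xs. is_path C (Vertex u) xs (Vertex v)"
proof -
  have "(u, v) \<in> (arcs_ends (with_proj (mk_symmetric (graph C))))\<^sup>*"
    using assms(1) by (rule reachable_rtranclI)
  then show ?thesis
  proof induction
    case base
    show ?case using is_path.Nil[of "Vertex u" C] assms(2) by (auto simp: Vertex_points)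
  next
    case (step y z)
    then obtain xs where xs: "is_path C (Vertex u) xs (Vertex y)" by blast
    from step(2) obtain e where e: "e \<in> E" "y = src e \<and> z = tgt e \<or> y = tgt e \<and> z = src e"
      by (auto simp: parcs_mk_symmetric)
    have "0 \<le> elen e" using elen_pos[OF e(1)] by simp
    then have "is_path C (Vertex (src e)) [(e, 0, elen e)] (Vertex (tgt e))"
      "is_path C (Vertex (tgt e)) [(e, elen e, 0)] (Vertex (src e))"
      using is_path_segment[OF e(1), of 0 "elen e"] is_path_segment[OF e(1), of "elen e" 0]
      by (simp_all add: point_at_0 point_at_len e(1))
    then show ?case using is_path_append[OF xs] e(2) by blast
  qed
qed

lemma path_exists:
  assumes "p \<in> points C" "q \<in> points C"
  shows "\<exists>xs. is_path C p xs q"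
proof -
  have to_base: "\<exists>xs. is_path C r xs (Vertex (base r))" "\<exists>xs. is_path C (Vertex (base r)) xs r"
    if r: "r \<in> points C" for r
  proof -
    have "(\<exists>xs. is_path C r xs (Vertex (base r))) \<and> (\<exists>xs. is_path C (Vertex (base r)) xs r)"
    proof (cases r)
      case (Vertex v)
      then show ?thesis using is_path.Nil[OF r] by (auto simp: base_def)
    next
      case (Interior e t)
      have e: "e \<in> E" "0 \<le> ereal t" "ereal t \<le> elen e" "0 \<le> elen e"
        using r elen_pos[of e] unfolding Interior Interior_points by auto
      have "point_at C e (ereal t) = r" using point_at_Interior r Interior by simp
      then show ?thesis
        using is_path_segment[OF e(1), of 0 "ereal t"] is_path_segment[OF e(1), of "ereal t" 0] e
        by (auto simp: point_at_0 base_def Interior)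
    qed
    then show "\<exists>xs. is_path C r xs (Vertex (base r))" "\<exists>xs. is_path C (Vertex (base r)) xs r" by auto
  qed
  have "base p \<rightarrow>\<^sup>*\<^bsub>mk_symmetric (graph C)\<^esub> base q"
    by (intro connected(2) base_in assms)
  then have "\<exists>xs. is_path C (Vertex (base p)) xs (Vertex (base q))"
    using reachable_path base_in[OF assms(1)] by blast
  then show ?thesis using to_base(1)[OF assms(1)] to_base(2)[OF assms(2)] is_path_append by blast
qed

text \<open>Two chains with the same ends differ by a cycle, so the arbitrary choice of a path is
  invisible modulo the lattice.\<close>

lemma point_path_integral:
  assumes "p0 \<in> points C" "p \<in> points C" "c \<in> chains_from_to (base p0) (base p)"
  shows "path_integral C (SOME xs. is_path C p0 xs p) - (lat c + off p - off p0) \<in> lattice C"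
proof -
  have "is_path C p0 (SOME xs. is_path C p0 xs p) p"
    using path_exists[OF assms(1,2)] by (rule someI_ex)
  then obtain d where d: "d \<in> chains_from_to (base p0) (base p)"
    "path_integral C (SOME xs. is_path C p0 xs p) = lat d + off p - off p0"
    using path_integral_decomposition by blast
  have "lat (\<lambda>e. d e - c e) \<in> lattice C"
    using chains_from_to_diff[OF d(1) assms(3)] by (auto simp: lattice_eq)
  then show ?thesis by (simp add: d(2) lat_diff)
qed

end

section \<open>Lifts of points and coefficients of the pulled-back divisor\<close>

locale pointed_tropical = tropical C for C :: "('v, 'e) metric_graph" +
  fixes p0 :: "('v, 'e) point"
  assumes p0: "p0 \<in> points C"
begin

definition aj :: "('v, 'e) point \<Rightarrow> ('e \<Rightarrow> real) \<Rightarrow> real" where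
  "aj p = path_integral C (SOME xs. is_path C p0 xs p)"

lemma aj_dual: "aj p \<in> dual_forms C"
  by (simp add: aj_def path_integral_dual)

lemma aj_diff:
  assumes "p \<in> points C" "q \<in> points C" "c \<in> chains_from_to (base q) (base p)"
  shows "aj p - aj q - (lat c + off p - off q) \<in> lattice C"
proof -
  obtain d where d: "d \<in> chains_from_to (base p0) (base q)"
    using chain_exists[OF base_in[OF p0] base_in[OF assms(2)]] .
  have "(aj p - (lat (\<lambda>e. d e + c e) + off p - off p0)) - (aj q - (lat d + off q - off p0)) \<in> lattice C"
    unfolding aj_def
    by (intro lattice_diff point_path_integral p0 assms d chains_from_to_trans[OF d])
  then show ?thesis by (simp add: lat_add algebra_simps)
qed

lemma abel_jacobi_eq:
  assumes "finite A" "{p. D p \<noteq> 0} \<subseteq> A"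
  shows "abel_jacobi C p0 D = (\<Sum>p\<in>A. real_of_int (D p) *\<^sub>R aj p) +o lattice C"
proof -
  have "(\<Sum>p | D p \<noteq> 0. real_of_int (D p) *\<^sub>R aj p) = (\<Sum>p\<in>A. real_of_int (D p) *\<^sub>R aj p)"
    using assms by (intro sum.mono_neutral_left) auto
  then show ?thesis by (simp add: abel_jacobi_def aj_def)
qed

text \<open>The coefficient at \<open>p\<close> of the pulled-back theta divisor, computed at the lift \<open>w\<close>.\<close>

definition coef :: "(('e \<Rightarrow> real) \<Rightarrow> real) \<Rightarrow> ('v, 'e) point \<Rightarrow> int" where
  "coef w p = (case p of
     Vertex v \<Rightarrow> (\<Sum>e\<in>{e\<in>E. src e = v}. slope w e 1) + (\<Sum>e\<in>{e\<in>E. tgt e = v}. slope w e (-1))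
   | Interior e t \<Rightarrow> slope w e 1 + slope w e (-1))"

lemma slope_shift:
  assumes w: "w \<in> dual_forms C" and c: "c \<in> cycs"
  shows "slope (w + lat c) e \<epsilon> = slope w e \<epsilon> + \<epsilon> * c e"
  unfolding slope_def N_shift[OF assms] image_image distrib_left
  using finite_N[OF w] N_nonempty[OF w] by (rule Max_add_commute)

lemma slope_ge: "w \<in> dual_forms C \<Longrightarrow> a \<in> N w \<Longrightarrow> \<epsilon> * a e \<le> slope w e \<epsilon>"
  unfolding slope_def using finite_N by (intro Max_ge) auto

lemma cyc_flow:
  assumes "c \<in> cycs" "p \<in> points C"
  shows "(case p of Vertex v \<Rightarrow> (\<Sum>e\<in>{e\<in>E. src e = v}. c e) + (\<Sum>e\<in>{e\<in>E. tgt e = v}. - c e)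
    | Interior e t \<Rightarrow> c e + - c e) = (0::int)"
proof (cases p)
  case (Vertex v)
  then have "bd c v = 0" using assms by (auto simp: Vertex_points cycs_def)
  then show ?thesis using Vertex by (simp add: bd_def sum_negf)
qed simp

text \<open>A lattice translation changes each outgoing slope by the outgoing value of a cycle, and
  these values sum to 0 at every point.\<close>

lemma coef_shift:
  assumes w: "w \<in> dual_forms C" and c: "c \<in> cycs" and p: "p \<in> points C"
  shows "coef (w + lat c) p = coef w p"
  using cyc_flow[OF c p] by (cases p) (simp_all add: coef_def slope_shift[OF w c] sum.distrib sum_negf sum_subtractf)

text \<open>Convexity: a single active piece bounds every outgoing slope from below, and its own
  outgoing slopes sum to 0.\<close>

lemma coef_nonneg:
  assumes w: "w \<in> dual_forms C" and p: "p \<in> points C"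
  shows "0 \<le> coef w p"
proof -
  obtain a where a: "a \<in> N w" using N_nonempty[OF w] by blast
  have ge: "a e \<le> slope w e 1" "- a e \<le> slope w e (-1)" for e
    using slope_ge[OF w a, of 1] slope_ge[OF w a, of "-1"] by simp_all
  show ?thesis
  proof (cases p)
    case (Vertex v)
    have "0 = (\<Sum>e\<in>{e\<in>E. src e = v}. a e) + (\<Sum>e\<in>{e\<in>E. tgt e = v}. - a e)"
      using cyc_flow[OF N_cycs[OF a] p] by (simp add: Vertex)
    also have "\<dots> \<le> coef w p"
      unfolding Vertex coef_def point.case by (intro add_mono sum_mono ge)
    finally show ?thesis .
  next
    case (Interior e t)
    then show ?thesis using ge[of e] by (simp add: coef_def)
  qed
qed

text \<open>The coefficient may be computed at any convenient lift, because the arbitrary choices in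
  the definition move the argument only by lattice vectors.\<close>

lemma theta_pullback_eq:
  assumes p: "p \<in> points C" and x: "x \<in> dual_forms C" and w: "w \<in> dual_forms C"
    and wx: "w - (aj p - x) \<in> lattice C"
  shows "theta_pullback C p0 (x +o lattice C) p = coef w p"
proof -
  define l where "l = (SOME l. l \<in> x +o lattice C)"
  define xs where "xs = (SOME xs. is_path C p0 xs p)"
  have "x \<in> x +o lattice C" using lattice_0 by (force simp: elt_set_plus_def)
  then have "l \<in> x +o lattice C" unfolding l_def by (rule someI[of "\<lambda>l. l \<in> x +o lattice C"])
  then have lx: "l - x \<in> lattice C" by (simp add: set_minus_plus)
  have "l = x + (l - x)" by simp
  then have l: "l \<in> dual_forms C" using dual_add[OF x lattice_dual[OF lx]] by metis
  let ?w = "aj p - l"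
  have w': "?w \<in> dual_forms C" using aj_dual l by blast
  have "(w - (aj p - x)) + (l - x) \<in> lattice C" using wx lx by (rule lattice_add)
  then have "w - ?w \<in> lattice C" by (simp add: algebra_simps)
  then obtain c where c: "c \<in> cycs" "w - ?w = lat c" by (auto simp: lattice_eq)
  have "w = ?w + lat c" using c(2) by (simp add: algebra_simps)
  then have coef_eq: "coef w p = coef ?w p" using coef_shift[OF w' c(1) p] by simp
  have os: "outgoing_slope C (\<lambda>x. theta C (x - l)) xs (e, t, real_of_int \<epsilon>) = slope ?w e \<epsilon>"
    if "e \<in> E" "0 \<le> t" "t \<le> elen e" for e t \<epsilon>
    using outgoing_slope_eq[OF l that] by (simp add: aj_def xs_def)
  have "(\<Sum>\<xi>\<in>unit_tangents C p. outgoing_slope C (\<lambda>x. theta C (x - l)) xs \<xi>) = real_of_int (coef ?w p)"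
  proof (cases p)
    case (Vertex v)
    have "outgoing_slope C (\<lambda>x. theta C (x - l)) xs (e, 0, 1) = slope ?w e 1"
      "outgoing_slope C (\<lambda>x. theta C (x - l)) xs (e, elen e, -1) = slope ?w e (-1)" if "e \<in> E" for e
      using os[OF that, of 0 1] os[OF that, of "elen e" "-1"] elen_pos[OF that] by simp_all
    then show ?thesis unfolding Vertex sum_unit_tangents_Vertex by (simp add: coef_def)
  next
    case (Interior e t)
    have e: "e \<in> E" "0 \<le> ereal t" "ereal t \<le> elen e" using p by (auto simp: Interior Interior_points)
    then show ?thesis
      using os[OF e, of 1] os[OF e, of "-1"] p unfolding Interior
      by (simp add: unit_tangents_Interior coef_def)
  qed
  then show ?thesis
    unfolding theta_pullback_def Let_def l_def[symmetric] xs_def[symmetric] coef_eq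
    using p by auto
qed

end

lemma dim_functions_on:
  assumes "finite A"
  shows "subspace {f :: 'a \<Rightarrow> real. \<forall>x. x \<notin> A \<longrightarrow> f x = 0}"
    and "{f :: 'a \<Rightarrow> real. \<forall>x. x \<notin> A \<longrightarrow> f x = 0} \<subseteq> span ((\<lambda>a x. of_bool (x = a)) ` A)"
    and "dim {f :: 'a \<Rightarrow> real. \<forall>x. x \<notin> A \<longrightarrow> f x = 0} = card A"
proof -
  let ?S = "{f :: 'a \<Rightarrow> real. \<forall>x. x \<notin> A \<longrightarrow> f x = 0}"
  let ?d = "\<lambda>a x :: 'a. of_bool (x = a) :: real"
  have inj: "inj_on ?d A" by (auto simp: inj_on_def fun_eq_iff)
  show "subspace ?S" by (auto simp: subspace_def scaleR_fun_def)
  have expand: "(\<Sum>a\<in>A. f a *\<^sub>R ?d a) x = (if x \<in> A then f x else 0)" for f and x :: 'a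
  proof -
    have "(\<Sum>a\<in>A. f a *\<^sub>R ?d a) x = (\<Sum>a\<in>A. if a = x then f x else 0)"
      unfolding sum_fun_apply by (intro sum.cong) (auto simp: scaleR_fun_def)
    then show ?thesis using assms by simp
  qed
  show span: "?S \<subseteq> span (?d ` A)"
  proof
    fix f :: "'a \<Rightarrow> real" assume "f \<in> ?S"
    then have "f = (\<Sum>a\<in>A. f a *\<^sub>R ?d a)" by (auto simp: expand)
    also have "\<dots> \<in> span (?d ` A)" by (intro span_sum span_scale span_base) auto
    finally show "f \<in> span (?d ` A)" .
  qed
  have "independent (?d ` A)"
  proof (rule independent_if_scalars_zero)
    show "finite (?d ` A)" using assms by simp
    fix f :: "('a \<Rightarrow> real) \<Rightarrow> real" and g
    assume 0: "(\<Sum>g\<in>?d ` A. f g *\<^sub>R g) = 0" and g: "g \<in> ?d ` A"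
    have "(\<Sum>a\<in>A. f (?d a) *\<^sub>R ?d a) = 0" using 0 by (simp add: sum.reindex[OF inj])
    then have "(if x \<in> A then f (?d x) else 0) = 0" for x
      using expand[of "\<lambda>a. f (?d a)" x] by simp
    from g obtain a where "a \<in> A" "g = ?d a" by blast
    then show "f g = 0" using \<open>\<And>x. (if x \<in> A then f (?d x) else 0) = 0\<close>[of a] by simp
  qed
  moreover have "?d ` A \<subseteq> ?S" by auto
  ultimately have "card (?d ` A) = dim ?S" using span by (intro basis_card_eq_dim) auto
  then show "dim ?S = card A" by (simp add: card_image[OF inj])
qed

context tropical
begin

subsection \<open>The degree of the pulled-back theta divisor\<close>

text \<open>Rank-nullity twice: the kernel of the boundary map is the cycle space, and since the
  curve is connected its image consists of all functions on the vertices with total 0.\<close>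

lemma genus_eq: "int (genus C) = int (card E) - int (card V) + 1"
proof -
  let ?S = "{c :: 'e \<Rightarrow> real. \<forall>e. e \<notin> E \<longrightarrow> c e = 0}"
  let ?T = "{g :: 'v \<Rightarrow> real. \<forall>v. v \<notin> V \<longrightarrow> g v = 0}"
  define F where "F c = (\<lambda>v. if v \<in> V then bd c v else 0)" for c :: "'e \<Rightarrow> real"
  define G where "G g = (\<Sum>v\<in>V. g v)" for g :: "'v \<Rightarrow> real"
  have linF: "linear F"
    by (rule linearI) (auto simp: F_def scaleR_fun_def plus_fun_def bd_add bd_cmult)
  have linG: "linear G"
    by (rule linearI) (auto simp: G_def scaleR_fun_def sum.distrib sum_distrib_left)
  have ker: "{c \<in> ?S. F c = 0} = cycles C"
    by (auto simp: cycles_eq chain_def F_def fun_eq_iff)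
  obtain v0 where v0: "v0 \<in> V" using V_nonempty by blast
  have image: "F ` ?S = {g \<in> ?T. G g = 0}"
  proof (intro subset_antisym subsetI)
    fix g assume "g \<in> F ` ?S"
    then obtain c where c: "g = F c" by blast
    have "G g = (\<Sum>v\<in>V. 1 * bd c v)" by (simp add: G_def F_def c)
    then have "G g = 0" unfolding sum_bd by simp
    then show "g \<in> {g \<in> ?T. G g = 0}" by (simp add: c F_def)
  next
    fix g assume g: "g \<in> {g \<in> ?T. G g = 0}"
    \<comment> \<open>A preimage: send \<open>g v\<close> units from \<open>v0\<close> to each
      vertex \<open>v\<close>; the surplus at \<open>v0\<close> vanishes because the total is
      0.\<close>
    define c where "c e = (\<Sum>v\<in>V. g v * realc (conn v0 v) e)" for e
    have conn0: "conn v0 v \<in> chains_from_to v0 v" if "v \<in> V" for v using conn[OF v0 that] .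
    have "c \<in> ?S" using conn0 by (auto simp: c_def chains_from_to_def chain_def)
    moreover have "F c v = g v" for v
    proof (cases "v \<in> V")
      case True
      have "bd c v = (\<Sum>u\<in>V. g u * bd (realc (conn v0 u)) v)"
        unfolding c_def bd_sum bd_cmult ..
      also have "\<dots> = (\<Sum>u\<in>V. g u * (of_bool (v = u) - of_bool (v = v0)))"
        using conn0 True by (intro sum.cong) (auto simp: realc_def bd_of_int chains_from_to_def)
      also have "\<dots> = (\<Sum>u\<in>V. (if u = v then g u else 0) - g u * of_bool (v = v0))"
        by (intro sum.cong) auto
      also have "\<dots> = g v - G g * of_bool (v = v0)"
        using True by (simp add: sum_subtractf G_def sum_distrib_right [symmetric])
      finally show ?thesis using True g by (simp add: F_def)
    next
      case False
      then show ?thesis using g by (simp add: F_def)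
    qed
    ultimately show "g \<in> F ` ?S" by (metis (no_types, lifting) ext image_eqI)
  qed
  have "G ` ?T = UNIV"
  proof (intro subset_antisym subsetI UNIV_I)
    fix r :: real
    have "G (\<lambda>v. if v = v0 then r else 0) = r" using v0 by (simp add: G_def)
    then show "r \<in> G ` ?T" using v0 by (intro image_eqI[of _ _ "\<lambda>v. if v = v0 then r else 0"]) auto
  qed
  then have dimG: "dim (G ` ?T) = 1" by (simp add: dim_UNIV)
  have "card E = genus C + dim (F ` ?S)"
    using dim_kernel_image[OF linF dim_functions_on(1)[OF finite_S] dim_functions_on(2)[OF finite_S]]
    unfolding dim_functions_on(3)[OF finite_S] ker genus_def by simp
  moreover have "card V = dim (F ` ?S) + 1"
    using dim_kernel_image[OF linG dim_functions_on(1)[OF finite_V] dim_functions_on(2)[OF finite_V]]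
    unfolding dim_functions_on(3)[OF finite_V] image dimG by simp
  ultimately show ?thesis by simp
qed

end

context pointed_tropical
begin

section \<open>Slopes and breakpoints along a single edge\<close>

lemma edgef_realc: "a \<in> cycs \<Longrightarrow> edgef e (realc a) = real_of_int (a e)"
  by (simp add: edgef_def realc_cycle)

lemma slope_nonneg: "w \<in> dual_forms C \<Longrightarrow> - slope w e (-1) \<le> slope w e 1"
proof -
  assume w: "w \<in> dual_forms C"
  then obtain a where "a \<in> N w" using N_nonempty by blast
  then show "- slope w e (-1) \<le> slope w e 1" using slope_ge[OF w, of a 1 e] slope_ge[OF w, of a "-1" e] by simp
qed

text \<open>Convexity along the edge: for maximizers \<open>a\<close> at \<open>s\<close> and
  \<open>b\<close> at \<open>t\<close>, adding the two maximality inequalities leaves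
  \<open>(t - s) * (b e - a e) \<ge> 0\<close>.\<close>

lemma slope_mono:
  assumes w: "w \<in> dual_forms C" and st: "s < t"
  shows "slope (w + s *\<^sub>R edgef e) e 1 \<le> - slope (w + t *\<^sub>R edgef e) e (-1)"
proof -
  let ?u = "w + s *\<^sub>R edgef e" and ?v = "w + t *\<^sub>R edgef e"
  have d: "?u \<in> dual_forms C" "?v \<in> dual_forms C" using w edgef_dual by blast+
  have "a e \<le> b e" if a: "a \<in> N ?u" and b: "b \<in> N ?v" for a b
  proof -
    have "val ?u b \<le> val ?u a" "val ?v a \<le> val ?v b"
      using a b N_cycs[OF a] N_cycs[OF b] by (simp_all add: N_def)
    then have "0 \<le> (t - s) * (real_of_int (b e) - a e)"
      using N_cycs[OF a] N_cycs[OF b] by (simp add: val_def scaleR_fun_def edgef_realc algebra_simps)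
    then show ?thesis using st by (simp add: zero_le_mult_iff)
  qed
  note le = this
  have "slope ?v e (-1) \<in> (\<lambda>a. -1 * a e) ` N ?v"
    unfolding slope_def using finite_N[OF d(2)] N_nonempty[OF d(2)] by (intro Max_in) simp_all
  then obtain b where b: "b \<in> N ?v" "slope ?v e (-1) = -1 * b e" by (rule imageE)
  have "slope ?u e 1 \<in> (\<lambda>a. 1 * a e) ` N ?u"
    unfolding slope_def using finite_N[OF d(1)] N_nonempty[OF d(1)] by (intro Max_in) simp_all
  then obtain a where a: "a \<in> N ?u" "slope ?u e 1 = 1 * a e" by (rule imageE)
  show ?thesis unfolding a(2) b(2) using le[OF a(1) b(1)] by simp
qed

lemma N_edge_upper_semicontinuous:
  assumes w: "w \<in> dual_forms C"
  obtains \<eta> where "0 < \<eta>" "\<And>s. \<bar>s - t\<bar> \<le> \<eta> \<Longrightarrow> N (w + s *\<^sub>R edgef e) \<subseteq> N (w + t *\<^sub>R edgef e)"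
proof -
  have "w + t *\<^sub>R edgef e \<in> dual_forms C" using w edgef_dual by blast
  then obtain \<eta> where \<eta>: "0 < \<eta>"
    "\<And>y. (\<And>b. b \<in> cycs \<Longrightarrow> \<bar>y (realc b) - (w + t *\<^sub>R edgef e) (realc b)\<bar> \<le> \<eta> * l1 b) \<Longrightarrow>
      N y \<subseteq> N (w + t *\<^sub>R edgef e)"
    using N_upper_semicontinuous by blast
  show ?thesis
  proof (rule that[OF \<eta>(1)], rule \<eta>(2))
    fix s b assume s: "\<bar>s - t\<bar> \<le> \<eta>" and b: "b \<in> cycs"
    have "\<bar>real_of_int (b e)\<bar> \<le> l1 b"
    proof (cases "e \<in> E")
      case True
      then show ?thesis unfolding l1_def by (intro member_le_sum) auto
    next
      case False
      then show ?thesis using b l1_nonneg[of b] by (simp add: cycs_def chain_def)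
    qed
    then have "\<bar>s - t\<bar> * \<bar>real_of_int (b e)\<bar> \<le> \<eta> * l1 b"
      using s by (intro mult_mono) auto
    then show "\<bar>(w + s *\<^sub>R edgef e) (realc b) - (w + t *\<^sub>R edgef e) (realc b)\<bar> \<le> \<eta> * l1 b"
      using b by (simp add: scaleR_fun_def edgef_realc abs_mult flip: left_diff_distrib)
  qed
qed

lemma slope_subset:
  assumes "w \<in> dual_forms C" "w' \<in> dual_forms C" "N w \<subseteq> N w'"
  shows "slope w e \<epsilon> \<le> slope w' e \<epsilon>"
  unfolding slope_def using assms finite_N N_nonempty by (intro Max_mono) auto

text \<open>Each integer between the slopes at the two ends is passed at exactly one point of the edge; this
  counts the jumps without enumerating the breakpoints.\<close>

lemma slope_crossing:
  assumes w: "w \<in> dual_forms C" and l: "0 < l"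
    and k: "slope w e 1 \<le> k" "k < - slope (w + l *\<^sub>R edgef e) e (-1)"
  shows "\<exists>t. 0 < t \<and> t < l \<and> - slope (w + t *\<^sub>R edgef e) e (-1) \<le> k \<and> k < slope (w + t *\<^sub>R edgef e) e 1"
proof -
  let ?w = "\<lambda>t. w + t *\<^sub>R edgef e"
  have d: "?w t \<in> dual_forms C" for t using w edgef_dual by blast
  \<comment> \<open>The supremum of \<open>T\<close> is the crossing point. A point of
    \<open>T\<close> just below it has its active pieces among those at the supremum, which bounds
    the left slope there; if the right slope were also at most \<open>k\<close>, then
    \<open>T\<close> would extend further.\<close>
  define T where "T = {t. 0 \<le> t \<and> t \<le> l \<and> slope (?w t) e 1 \<le> k}"
  have T0: "0 \<in> T" using l k(1) by (simp add: T_def)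
  have bdd: "bdd_above T" by (auto simp: T_def bdd_above_def)
  define t where "t = Sup T"
  have t0: "0 \<le> t" unfolding t_def using T0 bdd by (rule cSup_upper)
  have tl: "t \<le> l" unfolding t_def using T0 by (intro cSup_least) (auto simp: T_def)
  obtain \<eta> where \<eta>: "0 < \<eta>" "\<And>s. \<bar>s - t\<bar> \<le> \<eta> \<Longrightarrow> N (?w s) \<subseteq> N (?w t)"
    using N_edge_upper_semicontinuous[OF w] by metis
  obtain s where s: "s \<in> T" "t - \<eta> < s"
    using less_cSup_iff[of T "t - \<eta>"] T0 bdd \<eta>(1) unfolding t_def[symmetric] by auto
  have st: "s \<le> t" unfolding t_def using s(1) bdd by (rule cSup_upper)
  have "- slope (?w t) e (-1) \<le> - slope (?w s) e (-1)"
    using slope_subset[OF d d \<eta>(2)[of s], of e "-1"] s(2) st by simp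
  also have "\<dots> \<le> slope (?w s) e 1" by (rule slope_nonneg[OF d])
  also have "\<dots> \<le> k" using s(1) by (simp add: T_def)
  finally have 1: "- slope (?w t) e (-1) \<le> k" .
  have "t \<noteq> l" using 1 k(2) by auto
  then have tl': "t < l" using tl by simp
  have 2: "k < slope (?w t) e 1"
  proof (rule ccontr)
    assume "\<not> ?thesis"
    then have le: "slope (?w t) e 1 \<le> k" by simp
    let ?r = "min l (t + \<eta>)"
    have "slope (?w ?r) e 1 \<le> slope (?w t) e 1"
      using \<eta> tl' by (intro slope_subset d \<eta>(2)) auto
    then have "?r \<in> T" using le t0 tl' \<eta>(1) l by (simp add: T_def)
    then have "?r \<le> t" unfolding t_def using bdd by (rule cSup_upper)
    then show False using tl' \<eta>(1) by simp
  qed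
  have "t \<noteq> 0" using 2 k(1) by auto
  then show ?thesis using t0 tl' 1 2 by (intro exI[of _ t]) auto
qed

definition jumps :: "(('e \<Rightarrow> real) \<Rightarrow> real) \<Rightarrow> 'e \<Rightarrow> real set" where
  "jumps w e = {t. 0 < t \<and> ereal t < elen e \<and>
     slope (w + t *\<^sub>R edgef e) e 1 + slope (w + t *\<^sub>R edgef e) e (-1) \<noteq> 0}"

text \<open>The half-open integer intervals from left to right slope at the jumps are disjoint by
  monotonicity and cover the interval between the slopes at the two ends by
  \<open>slope_crossing\<close>. Counting integers gives finiteness and the telescoped sum
  together.\<close>

lemma sum_jumps:
  assumes w: "w \<in> dual_forms C" and e: "e \<in> E"
  shows "finite (jumps w e)"
    and "(\<Sum>t\<in>jumps w e. slope (w + t *\<^sub>R edgef e) e 1 + slope (w + t *\<^sub>R edgef e) e (-1)) =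
      - slope (w + len e *\<^sub>R edgef e) e (-1) - slope w e 1"
proof -
  let ?w = "\<lambda>t. w + t *\<^sub>R edgef e"
  let ?L = "\<lambda>t. - slope (?w t) e (-1)" and ?R = "\<lambda>t. slope (?w t) e 1"
  have d: "?w t \<in> dual_forms C" for t using w edgef_dual by blast
  have "finite (jumps w e) \<and> (\<Sum>t\<in>jumps w e. ?R t - ?L t) = ?L (len e) - slope w e 1"
    using e
  proof (cases rule: elen_cases)
    case leaf
    then have "jumps w e = {}" using d e by (simp add: jumps_def slope_leaf)
    then show ?thesis using leaf w e by (simp add: slope_leaf)
  next
    case finite
    let ?J = "jumps w e"
    have J: "t \<in> ?J \<longleftrightarrow> 0 < t \<and> t < len e \<and> ?L t < ?R t" for t
    proof -
      have "ereal t < elen e \<longleftrightarrow> t < len e" using finite(1) by (metis less_ereal.simps(1))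
      then show ?thesis using slope_nonneg[OF d, of t e] by (auto simp: jumps_def)
    qed
    have mono: "?R s \<le> ?L t" if "s < t" for s t using slope_mono[OF w that] .
    have w0: "?R 0 = slope w e 1" by simp
    let ?K = "{?R 0..<?L (len e)}"
    have UN: "(\<Union>t\<in>?J. {?L t..<?R t}) = ?K"
    proof (intro subset_antisym subsetI)
      fix k assume "k \<in> (\<Union>t\<in>?J. {?L t..<?R t})"
      then obtain t where t: "t \<in> ?J" "?L t \<le> k" "k < ?R t" by auto
      then have "?R 0 \<le> ?L t" "?R t \<le> ?L (len e)" using J mono[of 0 t] mono[of t "len e"] by simp_all
      then show "k \<in> ?K" using t by simp
    next
      fix k assume "k \<in> ?K"
      then obtain t where "0 < t" "t < len e" "?L t \<le> k" "k < ?R t"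
        using slope_crossing[OF w finite(2), of e k] by auto
      then show "k \<in> (\<Union>t\<in>?J. {?L t..<?R t})" using J[of t] by auto
    qed
    have inj: "inj_on ?L ?J"
    proof (rule inj_onI)
      fix s t assume st: "s \<in> ?J" "t \<in> ?J" "?L s = ?L t"
      show "s = t"
      proof (rule linorder_cases[of s t])
        assume "s < t" then show ?thesis using mono[of s t] st J by fastforce
      next
        assume "t < s" then show ?thesis using mono[of t s] st J by fastforce
      qed
    qed
    have "?L ` ?J \<subseteq> ?K"
    proof (rule image_subsetI)
      fix t assume t: "t \<in> ?J"
      then have "?L t < ?R t" by (simp only: J)
      then have "?L t \<in> (\<Union>t\<in>?J. {?L t..<?R t})" using t by (intro UN_I[of t]) simp_all
      then show "?L t \<in> ?K" unfolding UN .
    qed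
    then have fin: "finite ?J" using inj by (meson finite_atLeastLessThan_int finite_imageD finite_subset)
    have "card ?K = (\<Sum>t\<in>?J. card {?L t..<?R t})"
      unfolding UN[symmetric]
    proof (rule card_UN_disjoint[OF fin])
      show "\<forall>s\<in>?J. \<forall>t\<in>?J. s \<noteq> t \<longrightarrow> {?L s..<?R s} \<inter> {?L t..<?R t} = {}"
      proof (intro ballI impI)
        fix s t assume "s \<in> ?J" "t \<in> ?J" "s \<noteq> t"
        then consider "?R s \<le> ?L t" | "?R t \<le> ?L s" using mono by (metis linorder_neqE)
        then show "{?L s..<?R s} \<inter> {?L t..<?R t} = {}" by cases auto
      qed
    qed simp
    moreover have "?R 0 \<le> ?L (len e)" using mono[OF finite(2)] .
    then have "?L (len e) - ?R 0 = int (card ?K)" by simp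
    ultimately have "?L (len e) - ?R 0 = (\<Sum>t\<in>?J. int (card {?L t..<?R t}))"
      by (simp only: of_nat_sum)
    also have "\<dots> = (\<Sum>t\<in>?J. ?R t - ?L t)" using J by (intro sum.cong) auto
    finally show ?thesis using fin by simp
  qed
  then show "finite (jumps w e)" "(\<Sum>t\<in>jumps w e. ?R t + slope (?w t) e (-1)) = ?L (len e) - slope w e 1"
    by simp_all
qed

text \<open>For the degree, the slopes at edge ends in the vertex coefficients cancel against the
  telescoped jumps inside the edges. What remains is the sum of \<open>loop_at v0 e e\<close>, the
  trace computed in \<open>trace_loops\<close>, and by \<open>genus_eq\<close> this is the
  genus.\<close>

lemma theta_pullback_divisor:
  assumes x: "x \<in> dual_forms C"
  shows "finite {p. theta_pullback C p0 (x +o lattice C) p \<noteq> 0}"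
    and "{p. theta_pullback C p0 (x +o lattice C) p \<noteq> 0} \<subseteq> points C"
    and "effective (theta_pullback C p0 (x +o lattice C))"
    and "divisor_degree (theta_pullback C p0 (x +o lattice C)) = int (genus C)"
proof -
  let ?D = "theta_pullback C p0 (x +o lattice C)"
  define v0 where "v0 = base p0"
  have v0: "v0 \<in> V" using base_in[OF p0] by (simp add: v0_def)
  define y where "y = - off p0 - x"
  have y: "y \<in> dual_forms C" unfolding y_def using off_dual x by blast
  \<comment> \<open>A lift chosen separately at each vertex; inside an edge it is continued from the
    tail.\<close>
  define w where "w v = lat (conn v0 v) + y" for v
  have w: "w v \<in> dual_forms C" for v unfolding w_def using lat_dual y by blast
  have D: "?D p = coef (w (base p) + off p) p" if p: "p \<in> points C" for p
  proof (rule theta_pullback_eq[OF p x])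
    show "w (base p) + off p \<in> dual_forms C" using w off_dual by blast
    have "aj p - (lat (conn v0 (base p)) + off p - off p0) \<in> lattice C"
      unfolding aj_def using conn[OF v0 base_in[OF p]] by (intro point_path_integral p0 p) (simp add: v0_def)
    from lattice_uminus[OF this] show "w (base p) + off p - (aj p - x) \<in> lattice C"
      by (simp add: w_def y_def algebra_simps)
  qed
  have D_out: "?D p = 0" if "p \<notin> points C" for p using that by (simp add: theta_pullback_def)
  then show sub: "{p. ?D p \<noteq> 0} \<subseteq> points C" by blast
  have "0 \<le> ?D p" for p
    using D D_out coef_nonneg[OF dual_add[OF w off_dual]] by (cases "p \<in> points C") auto
  then show "effective ?D" by (simp add: effective_def)
  define A where "A = Vertex ` V \<union> (\<Union>e\<in>E. Interior e ` jumps (w (src e)) e)"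
  have D_int: "?D (Interior e t) = slope (w (src e) + t *\<^sub>R edgef e) e 1 + slope (w (src e) + t *\<^sub>R edgef e) e (-1)"
    if "Interior e t \<in> points C" for e t
    using D[OF that] by (simp add: coef_def base_def off_def)
  have D_vert: "?D (Vertex v) = coef (w v) (Vertex v)" if "v \<in> V" for v
    using D[of "Vertex v"] that by (simp add: Vertex_points base_def off_def)
  have supp: "{p. ?D p \<noteq> 0} \<subseteq> A"
  proof
    fix p assume p: "p \<in> {p. ?D p \<noteq> 0}"
    then have pts: "p \<in> points C" using sub by blast
    show "p \<in> A"
    proof (cases p)
      case (Vertex v)
      then show ?thesis using pts by (simp add: A_def Vertex_points)
    next
      case (Interior e t)
      then show ?thesis using pts p D_int[of e t] by (auto simp: A_def Interior_points jumps_def)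
    qed
  qed
  have finA: "finite A" using sum_jumps(1)[OF w] by (simp add: A_def)
  then show fin: "finite {p. ?D p \<noteq> 0}" using supp by (rule finite_subset[rotated])
  \<comment> \<open>Continued along \<open>e\<close>, the lift at the tail meets the lift at the
    head only up to the lattice vector of a loop; this discrepancy is the source of the
    degree.\<close>
  have end_shift: "w (src e) + len e *\<^sub>R edgef e = w (tgt e) + lat (loop_at v0 e)" if "e \<in> E" for e
    unfolding w_def loop_at_def by (simp add: lat_add lat_diff lat_unit[OF that] algebra_simps)
  let ?I = "\<lambda>e. Interior e ` jumps (w (src e)) e"
  have "divisor_degree ?D = (\<Sum>p\<in>A. ?D p)"
    unfolding divisor_degree_def using finA supp by (intro sum.mono_neutral_left) auto
  also have "\<dots> = (\<Sum>p\<in>Vertex ` V. ?D p) + (\<Sum>p\<in>(\<Union>e\<in>E. Interior e ` jumps (w (src e)) e). ?D p)"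
    unfolding A_def using sum_jumps(1)[OF w] by (intro sum.union_disjoint) auto
  finally have total: "divisor_degree ?D = (\<Sum>p\<in>Vertex ` V. ?D p) + (\<Sum>p\<in>(\<Union>e\<in>E. ?I e). ?D p)" .
  have "(\<Sum>p\<in>Vertex ` V. ?D p) = (\<Sum>v\<in>V. coef (w v) (Vertex v))"
    by (subst sum.reindex) (auto simp: inj_on_def D_vert)
  also have "\<dots> = (\<Sum>e\<in>E. slope (w (src e)) e 1) + (\<Sum>e\<in>E. slope (w (tgt e)) e (-1))"
  proof -
    have "(\<Sum>v\<in>V. \<Sum>e\<in>{e\<in>E. g e = v}. slope (w v) e \<epsilon>) = (\<Sum>e\<in>E. slope (w (g e)) e \<epsilon>)"
      if "\<And>e. e \<in> E \<Longrightarrow> g e \<in> V" for g and \<epsilon> :: int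
    proof -
      have "(\<Sum>v\<in>V. \<Sum>e\<in>{e\<in>E. g e = v}. slope (w v) e \<epsilon>) = (\<Sum>v\<in>V. \<Sum>e\<in>{e\<in>E. g e = v}. slope (w (g e)) e \<epsilon>)"
        by (intro sum.cong) auto
      also have "\<dots> = (\<Sum>e\<in>E. slope (w (g e)) e \<epsilon>)" using that by (intro sum.group) auto
      finally show ?thesis .
    qed
    from this[of src 1] this[of tgt "-1"] show ?thesis
      using tl_in hd_in by (simp add: coef_def sum.distrib)
  qed
  finally have vertices: "(\<Sum>p\<in>Vertex ` V. ?D p) =
    (\<Sum>e\<in>E. slope (w (src e)) e 1) + (\<Sum>e\<in>E. slope (w (tgt e)) e (-1))" .
  have "(\<Sum>p\<in>(\<Union>e\<in>E. ?I e). ?D p) =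
      (\<Sum>e\<in>E. \<Sum>p\<in>Interior e ` jumps (w (src e)) e. ?D p)"
    using sum_jumps(1)[OF w] by (intro sum.UNION_disjoint) auto
  also have "\<dots> = (\<Sum>e\<in>E. loop_at v0 e e - slope (w (tgt e)) e (-1) - slope (w (src e)) e 1)"
  proof (rule sum.cong[OF refl])
    fix e assume e: "e \<in> E"
    have "(\<Sum>p\<in>?I e. ?D p) =
        (\<Sum>t\<in>jumps (w (src e)) e. slope (w (src e) + t *\<^sub>R edgef e) e 1 + slope (w (src e) + t *\<^sub>R edgef e) e (-1))"
    proof -
      have "Interior e t \<in> points C" if "t \<in> jumps (w (src e)) e" for t
        using that e by (simp add: Interior_points jumps_def)
      then show ?thesis
        by (subst sum.reindex) (simp_all add: inj_on_def D_int cong: sum.cong)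
    qed
    also have "\<dots> = - slope (w (src e) + len e *\<^sub>R edgef e) e (-1) - slope (w (src e)) e 1"
      by (rule sum_jumps(2)[OF w e])
    also have "\<dots> = loop_at v0 e e - slope (w (tgt e)) e (-1) - slope (w (src e)) e 1"
      unfolding end_shift[OF e] slope_shift[OF w loop_at_cycs[OF v0 e]] by simp
    finally show "(\<Sum>p\<in>?I e. ?D p) =
        loop_at v0 e e - slope (w (tgt e)) e (-1) - slope (w (src e)) e 1" .
  qed
  finally have interiors: "(\<Sum>p\<in>(\<Union>e\<in>E. ?I e). ?D p) =
    (\<Sum>e\<in>E. loop_at v0 e e - slope (w (tgt e)) e (-1) - slope (w (src e)) e 1)" .
  show "divisor_degree ?D = int (genus C)"
    using total vertices interiors trace_loops[OF v0] genus_eq by (simp only: sum_subtractf)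
qed

subsection \<open>Points of the theta divisor come from effective divisors\<close>

lemma coset_in_jacobian: "x \<in> dual_forms C \<Longrightarrow> x +o lattice C \<in> jacobian C"
  by (auto simp: jacobian_def)

text \<open>Two distinct maximizers differ on some edge, and with \<open>q\<close> in that edge the divisor pulled back
  from the translate through \<open>q\<close> contains \<open>q\<close>; removing \<open>q\<close> gives the required divisor.\<close>

lemma theta_divisor_subset:
  assumes \<kappa>: "jacobi_inversion_constant C p0 \<kappa>" and j: "j \<in> theta_divisor C"
  shows "\<exists>D. divisor C D \<and> effective D \<and> divisor_degree D = int (genus C) - 1 \<and> abel_jacobi C p0 D + \<kappa> = j"
proof -
  obtain x a b where x: "j = x +o lattice C" "x \<in> dual_forms C" and ab: "a \<in> N x" "b \<in> N x" "a \<noteq> b"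
    using j unfolding mem_theta_divisor_iff by blast
  obtain k where k: "\<kappa> = k +o lattice C"
    using \<kappa> by (auto simp: jacobi_inversion_constant_def jacobian_def)
  obtain e where ne: "a e \<noteq> b e" using ab(3) by blast
  have e: "e \<in> E"
  proof (rule ccontr)
    assume "e \<notin> E"
    then show False using ne N_cycs[OF ab(1)] N_cycs[OF ab(2)] by (simp add: cycs_def chain_def)
  qed
  have "elen e \<noteq> \<infinity>"
    using ne N_cycs[OF ab(1)] N_cycs[OF ab(2)] cycle_leaf[of a e] cycle_leaf[of b e] e by (auto simp: cycs_eq)
  then have len: "elen e = ereal (len e)" "0 < len e" using elen_cases[OF e] by blast+
  define q where "q = (Interior e (len e / 2) :: ('v, 'e) point)"
  have "ereal (len e / 2) < ereal (len e)" using len(2) by simp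
  then have q: "q \<in> points C" using e len unfolding q_def Interior_points by simp
  define D where "D = theta_pullback C p0 ((x + aj q) +o lattice C)"
  have xq: "x + aj q \<in> dual_forms C" using x(2) aj_dual by blast
  note D = theta_pullback_divisor[OF xq, folded D_def]
  have "D q = coef (- x) q"
    unfolding D_def by (rule theta_pullback_eq[OF q xq dual_uminus[OF x(2)]]) (simp add: lattice_0)
  \<comment> \<open>The two outgoing slopes inside \<open>e\<close> add up to the difference between
    the largest and the smallest value at \<open>e\<close> of cycles in \<open>N (- x)\<close>, and
    at least two of these values differ.\<close>
  moreover have "1 \<le> coef (- x) q"
  proof -
    have mem: "(\<lambda>e. - a e) \<in> N (- x)" "(\<lambda>e. - b e) \<in> N (- x)"
      unfolding N_uminus[OF x(2)] using ab by auto
    note ge = slope_ge[OF dual_uminus[OF x(2)] mem(1)] slope_ge[OF dual_uminus[OF x(2)] mem(2)]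
    have "1 \<le> slope (- x) e 1 + slope (- x) e (-1)"
      using ge(1)[of 1 e] ge(1)[of "-1" e] ge(2)[of 1 e] ge(2)[of "-1" e] ne by linarith
    then show ?thesis by (simp add: coef_def q_def)
  qed
  ultimately have Dq: "1 \<le> D q" by simp
  define D' where "D' p = D p - of_bool (p = q)" for p
  let ?A = "{p. D p \<noteq> 0}"
  have qA: "q \<in> ?A" using Dq by simp
  have supp: "{p. D' p \<noteq> 0} \<subseteq> ?A" using qA by (auto simp: D'_def)
  have "divisor C D'" using supp D(1,2) finite_subset by (auto simp: divisor_def)
  moreover have "effective D'" using D(3) Dq by (simp add: effective_def D'_def)
  moreover have "divisor_degree D' = int (genus C) - 1"
  proof -
    have "divisor_degree D' = (\<Sum>p\<in>?A. D' p)"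
      unfolding divisor_degree_def using D(1) supp by (intro sum.mono_neutral_left) auto
    also have "\<dots> = divisor_degree D - (\<Sum>p\<in>?A. of_bool (p = q))"
      by (simp add: D'_def sum_subtractf divisor_degree_def)
    also have "(\<Sum>p\<in>?A. of_bool (p = q)) = (1::int)" using D(1) qA by simp
    finally show ?thesis using D(4) by simp
  qed
  moreover have "abel_jacobi C p0 D' + \<kappa> = j"
  proof -
    let ?s = "\<Sum>p\<in>?A. real_of_int (D p) *\<^sub>R aj p"
    have "(x + aj q) +o lattice C \<in> jacobian C" using xq by (rule coset_in_jacobian)
    then have "abel_jacobi C p0 D + \<kappa> = (x + aj q) +o lattice C"
      using \<kappa> by (auto simp: jacobi_inversion_constant_def D_def)
    then have "(?s + k) - (x + aj q) \<in> lattice C"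
      unfolding abel_jacobi_eq[OF D(1) order_refl] k coset_add coset_eq_iff .
    then have 1: "(?s - aj q + k) - x \<in> lattice C" by (simp add: algebra_simps)
    have "(\<Sum>p\<in>?A. real_of_int (D' p) *\<^sub>R aj p) = ?s - (\<Sum>p\<in>?A. if p = q then aj q else 0)"
      unfolding sum_subtractf [symmetric]
      by (intro sum.cong refl) (auto simp: D'_def scaleR_left_diff_distrib)
    also have "(\<Sum>p\<in>?A. if p = q then aj q else 0) = aj q" using D(1) qA by simp
    finally have 2: "(\<Sum>p\<in>?A. real_of_int (D' p) *\<^sub>R aj p) = ?s - aj q" .
    show ?thesis
      unfolding abel_jacobi_eq[OF D(1) supp] k coset_add x(1) coset_eq_iff 2 by (rule 1)
  qed
  ultimately show ?thesis by blast
qed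

subsection \<open>Retraction of the leaves\<close>

definition leaf_end :: "'v \<Rightarrow> bool" where
  "leaf_end v \<longleftrightarrow> (\<exists>e\<in>E. elen e = \<infinity> \<and> tgt e = v)"

text \<open>The leaf chosen by \<open>SOME\<close> is the only edge at its infinite endpoint, by
  \<open>leaf_head\<close>.\<close>

definition retract :: "('v, 'e) point \<Rightarrow> ('v, 'e) point" where
  "retract p = (case p of
     Vertex v \<Rightarrow> if leaf_end v then Vertex (src (SOME e. e \<in> E \<and> elen e = \<infinity> \<and> tgt e = v)) else p
   | Interior e t \<Rightarrow> if elen e = \<infinity> then Vertex (src e) else p)"

definition core_points :: "('v, 'e) point set" where
  "core_points = {p \<in> points C. case p of Vertex v \<Rightarrow> \<not> leaf_end v | Interior e t \<Rightarrow> elen e \<noteq> \<infinity>}"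

lemma not_leaf_end:
  assumes "e \<in> E"
  shows "\<not> leaf_end (src e)" and "elen e \<noteq> \<infinity> \<Longrightarrow> \<not> leaf_end (tgt e)"
proof -
  show "\<not> leaf_end (src e)"
    unfolding leaf_end_def
  proof clarify
    fix e' assume e': "e' \<in> E" "elen e' = \<infinity>" "tgt e' = src e"
    then have "e \<in> {e''\<in>E. src e'' = tgt e'}" using assms by simp
    then show False unfolding leaf_head(2)[OF e'(1,2)] by simp
  qed
  show "\<not> leaf_end (tgt e)" if "elen e \<noteq> \<infinity>"
    unfolding leaf_end_def
  proof clarify
    fix e' assume e': "e' \<in> E" "elen e' = \<infinity>" "tgt e' = tgt e"
    then have "e \<in> {e''\<in>E. tgt e'' = tgt e'}" using assms by simp
    then show False unfolding leaf_head(1)[OF e'(1,2)] using e'(2) that by simp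
  qed
qed

text \<open>1-forms vanish on leaves, so moving a point along its leaf does not change its image in
  the Jacobian.\<close>

lemma retract:
  assumes p: "p \<in> points C"
  shows "retract p \<in> core_points" and "aj p - aj (retract p) \<in> lattice C"
proof -
  have "retract p \<in> core_points \<and> aj p - aj (retract p) \<in> lattice C"
  proof (cases p)
    case (Vertex v)
    show ?thesis
    proof (cases "leaf_end v")
      case True
      define e where "e = (SOME e. e \<in> E \<and> elen e = \<infinity> \<and> tgt e = v)"
      have "\<exists>e. e \<in> E \<and> elen e = \<infinity> \<and> tgt e = v" using True by (auto simp: leaf_end_def)
      then have e: "e \<in> E \<and> elen e = \<infinity> \<and> tgt e = v" unfolding e_def by (rule someI_ex)
      have r: "retract p = Vertex (src e)" using True by (simp add: Vertex retract_def e_def)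
      have pt: "Vertex (src e) \<in> points C" using e tl_in by (simp add: Vertex_points)
      have "aj p - aj (Vertex (src e)) - (lat (\<lambda>\<tau>. if \<tau> = e then 1 else 0) + off p - off (Vertex (src e))) \<in> lattice C"
        using unit_in_chains[of e] e by (intro aj_diff p pt) (simp add: base_def Vertex)
      moreover have "lat (\<lambda>\<tau>. if \<tau> = e then 1 else 0) + off p - off (Vertex (src e)) = 0"
        using lat_unit[of e] edgef_leaf[of e] e by (simp add: off_def Vertex)
      ultimately show ?thesis
        using pt not_leaf_end(1) e by (simp add: r core_points_def)
    next
      case False
      then show ?thesis using p lattice_0 by (simp add: retract_def core_points_def Vertex)
    qed
  next
    case (Interior e t)
    have e: "e \<in> E" using p by (simp add: Interior Interior_points)
    show ?thesis
    proof (cases "elen e = \<infinity>")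
      case True
      have r: "retract p = Vertex (src e)" using True by (simp add: Interior retract_def)
      have pt: "Vertex (src e) \<in> points C" using e tl_in by (simp add: Vertex_points)
      have "aj p - aj (Vertex (src e)) - (lat (\<lambda>e. 0) + off p - off (Vertex (src e))) \<in> lattice C"
        by (intro aj_diff p pt) (simp add: base_def Interior zero_in_chains)
      moreover have "off p = 0" using edgef_leaf[OF e True] by (simp add: off_def Interior)
      ultimately show ?thesis
        using pt not_leaf_end(1)[OF e] by (simp add: r core_points_def off_def lat_zero)
    next
      case False
      then show ?thesis using p lattice_0 by (simp add: retract_def core_points_def Interior)
    qed
  qed
  then show "retract p \<in> core_points" "aj p - aj (retract p) \<in> lattice C" by auto
qed

lemma core_vertex_exists: "\<exists>v\<in>V. \<not> leaf_end v"
proof (cases "E = {}")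
  case True
  then show ?thesis using V_nonempty by (auto simp: leaf_end_def)
next
  case False
  then show ?thesis using not_leaf_end(1) tl_in by blast
qed

lemma effective_retract:
  assumes D: "divisor C D" "effective D"
  obtains D' where "finite {p. D' p \<noteq> 0}" "{p. D' p \<noteq> 0} \<subseteq> core_points" "\<And>p. 0 \<le> D' p"
    "(\<Sum>p | D' p \<noteq> 0. D' p) = divisor_degree D"
    "(\<Sum>p | D p \<noteq> 0. real_of_int (D p) *\<^sub>R aj p) - (\<Sum>p | D' p \<noteq> 0. real_of_int (D' p) *\<^sub>R aj p) \<in> lattice C"
proof -
  let ?S = "{p. D p \<noteq> 0}"
  have S: "finite ?S" "?S \<subseteq> points C" using D(1) by (simp_all add: divisor_def)
  \<comment> \<open>The push-forward of \<open>D\<close>: all coefficients over the same retracted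
    point are added, which preserves degree and effectivity.\<close>
  define D' where "D' y = (\<Sum>p\<in>{p\<in>?S. retract p = y}. D p)" for y
  have supp: "{p. D' p \<noteq> 0} \<subseteq> retract ` ?S"
  proof
    fix y assume y: "y \<in> {p. D' p \<noteq> 0}"
    show "y \<in> retract ` ?S"
    proof (rule ccontr)
      assume "y \<notin> retract ` ?S"
      then have "{p\<in>?S. retract p = y} = {}" by blast
      then have "D' y = 0" by (simp only: D'_def sum.empty)
      then show False using y by simp
    qed
  qed
  have fin: "finite (retract ` ?S)" using S(1) by simp
  have "(\<Sum>p | D' p \<noteq> 0. D' p) = (\<Sum>y\<in>retract ` ?S. D' y)"
    using fin supp by (intro sum.mono_neutral_left) auto
  also have "\<dots> = (\<Sum>p\<in>?S. D p)"
    unfolding D'_def using S(1) by (intro sum.group) auto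
  finally have deg: "(\<Sum>p | D' p \<noteq> 0. D' p) = divisor_degree D" by (simp add: divisor_degree_def)
  have "(\<Sum>p | D' p \<noteq> 0. real_of_int (D' p) *\<^sub>R aj p) = (\<Sum>y\<in>retract ` ?S. real_of_int (D' y) *\<^sub>R aj y)"
    using fin supp by (intro sum.mono_neutral_left) auto
  also have "\<dots> = (\<Sum>y\<in>retract ` ?S. \<Sum>p\<in>{p\<in>?S. retract p = y}. real_of_int (D p) *\<^sub>R aj (retract p))"
    by (intro sum.cong refl) (simp add: D'_def scaleR_left.sum)
  also have "\<dots> = (\<Sum>p\<in>?S. real_of_int (D p) *\<^sub>R aj (retract p))"
    using S(1) by (intro sum.group) auto
  finally have "(\<Sum>p\<in>?S. real_of_int (D p) *\<^sub>R aj p) - (\<Sum>p | D' p \<noteq> 0. real_of_int (D' p) *\<^sub>R aj p) =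
      (\<Sum>p\<in>?S. real_of_int (D p) *\<^sub>R (aj p - aj (retract p)))"
    by (simp add: sum_subtractf scaleR_right_diff_distrib)
  also have "\<dots> \<in> lattice C"
    using S(2) retract(2) by (intro lattice_sum lattice_scale) auto
  finally have sums: "(\<Sum>p\<in>?S. real_of_int (D p) *\<^sub>R aj p) -
    (\<Sum>p | D' p \<noteq> 0. real_of_int (D' p) *\<^sub>R aj p) \<in> lattice C" .
  show ?thesis
  proof (rule that[of D'])
    show "finite {p. D' p \<noteq> 0}" using supp fin by (rule finite_subset)
    have "retract ` ?S \<subseteq> core_points" using S(2) retract(1) by (intro image_subsetI) blast
    then show "{p. D' p \<noteq> 0} \<subseteq> core_points" using supp by (rule subset_trans[rotated])
    show "0 \<le> D' p" for p
      unfolding D'_def using D(2) by (intro sum_nonneg) (simp add: effective_def)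
  qed (rule deg sums)+
qed

lemma theta_pullback_core:
  assumes "x \<in> dual_forms C"
  shows "{p. theta_pullback C p0 (x +o lattice C) p \<noteq> 0} \<subseteq> core_points"
proof
  fix p assume p: "p \<in> {p. theta_pullback C p0 (x +o lattice C) p \<noteq> 0}"
  then have pts: "p \<in> points C" using theta_pullback_divisor(2)[OF assms] by blast
  let ?w = "aj p - x"
  have w: "?w \<in> dual_forms C" using aj_dual assms by blast
  have "coef ?w p \<noteq> 0"
    using p theta_pullback_eq[OF pts assms w] lattice_0 by simp
  show "p \<in> core_points"
  proof (cases p)
    case (Vertex v)
    have "\<not> leaf_end v"
    proof
      assume "leaf_end v"
      then obtain e where e: "e \<in> E" "elen e = \<infinity>" "tgt e = v" by (auto simp: leaf_end_def)
      have "coef ?w p = 0"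
        unfolding coef_def Vertex point.case e(3)[symmetric] leaf_head[OF e(1,2)]
        using slope_leaf[OF w e(1,2)] by (simp add: Vertex e(3))
      then show False using \<open>coef ?w p \<noteq> 0\<close> by simp
    qed
    then show ?thesis using pts by (simp add: core_points_def Vertex)
  next
    case (Interior e t)
    have "elen e \<noteq> \<infinity>"
      using \<open>coef ?w p \<noteq> 0\<close> slope_leaf[OF w, of e] pts by (auto simp: coef_def Interior Interior_points)
    then show ?thesis using pts by (simp add: core_points_def Interior)
  qed
qed

end

section \<open>Subdivided curves\<close>

lemma subdivision_exists:
  fixes l :: real
  assumes M: "finite M" "M \<subseteq> {0<..<l}" and l: "0 < l"
  obtains n :: nat and \<tau> where "0 < n" "\<tau> 0 = 0" "\<tau> n = l" "\<And>i. i < n \<Longrightarrow> \<tau> i < \<tau> (Suc i)"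
    "M \<subseteq> \<tau> ` {0<..<n}"
proof -
  define xs where "xs = 0 # sorted_list_of_set M @ [l]"
  have xs: "sorted_wrt (<) xs"
    using M l by (auto simp: xs_def sorted_wrt_append)
  let ?n = "length xs - 1"
  have len: "length xs = card M + 2" by (simp add: xs_def)
  show ?thesis
  proof (rule that[of ?n "\<lambda>i. xs ! i"])
    show "0 < ?n" by (simp add: len)
    show "xs ! 0 = 0" by (simp add: xs_def)
    show "xs ! ?n = l" by (simp add: xs_def nth_append)
    show "xs ! i < xs ! Suc i" if "i < ?n" for i
      using xs that by (intro sorted_wrt_nth_less[of "(<)"]) auto
    show "M \<subseteq> (\<lambda>i. xs ! i) ` {0<..<?n}"
    proof
      fix m assume "m \<in> M"
      then have "m \<in> set (sorted_list_of_set M)" using M(1) by simp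
      then obtain i where i: "i < length (sorted_list_of_set M)" "sorted_list_of_set M ! i = m"
        by (auto simp: in_set_conv_nth)
      then have "xs ! Suc i = m" by (simp add: xs_def nth_append)
      then show "m \<in> (\<lambda>i. xs ! i) ` {0<..<?n}" using i(1) len by (intro image_eqI[of _ _ "Suc i"]) auto
    qed
  qed
qed

text \<open>Only edges of finite length are cut, at parameters that include both ends. Leaves stay
  outside the network, so every segment has positive real length, as a weighted network
  demands.\<close>

locale subdivided = pointed_tropical +
  fixes n :: "'b \<Rightarrow> nat" and \<tau> :: "'b \<Rightarrow> nat \<Rightarrow> real"
  assumes n_pos: "e \<in> E \<Longrightarrow> elen e \<noteq> \<infinity> \<Longrightarrow> 0 < n e"
    and \<tau>_0: "e \<in> E \<Longrightarrow> elen e \<noteq> \<infinity> \<Longrightarrow> \<tau> e 0 = 0"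
    and \<tau>_n: "e \<in> E \<Longrightarrow> elen e \<noteq> \<infinity> \<Longrightarrow> \<tau> e (n e) = len e"
    and \<tau>_less: "e \<in> E \<Longrightarrow> elen e \<noteq> \<infinity> \<Longrightarrow> i < n e \<Longrightarrow> \<tau> e i < \<tau> e (Suc i)"
begin

definition F :: "'b set" where
  "F = {e\<in>E. elen e \<noteq> \<infinity>}"

definition segs :: "('b \<times> nat) set" where
  "segs = (SIGMA e:F. {..<n e})"

definition pt :: "'b \<Rightarrow> nat \<Rightarrow> ('a, 'b) point" where
  "pt e i = (if i = 0 then Vertex (src e) else if i = n e then Vertex (tgt e) else Interior e (\<tau> e i))"

definition marks :: "('a, 'b) point set" where
  "marks = Vertex ` {v\<in>V. \<not> leaf_end v} \<union> (\<lambda>(e, i). pt e i) ` (SIGMA e:F. {0<..<n e})"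

definition stail :: "'b \<times> nat \<Rightarrow> ('a, 'b) point" where
  "stail \<sigma> = pt (fst \<sigma>) (snd \<sigma>)"

definition shead :: "'b \<times> nat \<Rightarrow> ('a, 'b) point" where
  "shead \<sigma> = pt (fst \<sigma>) (Suc (snd \<sigma>))"

definition slen :: "'b \<times> nat \<Rightarrow> real" where
  "slen \<sigma> = \<tau> (fst \<sigma>) (Suc (snd \<sigma>)) - \<tau> (fst \<sigma>) (snd \<sigma>)"

lemma F_E: "e \<in> F \<Longrightarrow> e \<in> E"
  by (simp add: F_def)

lemma finite_F [simp]: "finite F"
  by (simp add: F_def)

lemma finite_segs [simp]: "finite segs"
  by (simp add: segs_def)

lemma F_n_pos: "e \<in> F \<Longrightarrow> 0 < n e"
  using n_pos by (simp add: F_def)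

lemma \<tau>_strict:
  assumes "e \<in> F" "i < j" "j \<le> n e"
  shows "\<tau> e i < \<tau> e j"
  using assms(2,3)
proof (induction j)
  case (Suc j)
  have step: "\<tau> e j < \<tau> e (Suc j)" using \<tau>_less[of e j] assms(1) Suc.prems by (simp add: F_def)
  show ?case
  proof (cases "i = j")
    case True
    then show ?thesis using step by simp
  next
    case False
    then have "\<tau> e i < \<tau> e j" using Suc by simp
    then show ?thesis using step by simp
  qed
qed simp

lemma pt_in_marks:
  assumes "e \<in> F" "i \<le> n e"
  shows "pt e i \<in> marks"
proof -
  have "\<not> leaf_end (src e)" "\<not> leaf_end (tgt e)"
    using assms(1) not_leaf_end[of e] by (auto simp: F_def)
  then have ends: "Vertex (src e) \<in> marks" "Vertex (tgt e) \<in> marks"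
    using tl_in hd_in F_E[OF assms(1)] by (simp_all add: marks_def)
  show ?thesis
  proof (cases "i = 0 \<or> i = n e")
    case True
    then show ?thesis using ends by (auto simp: pt_def)
  next
    case False
    then have "(e, i) \<in> (SIGMA e:F. {0<..<n e})" using assms by simp
    then show ?thesis unfolding marks_def by (intro UnI2 image_eqI[of _ _ "(e, i)"]) simp_all
  qed
qed

lemma marks_core: "marks \<subseteq> core_points"
proof
  fix p assume "p \<in> marks"
  then consider v where "v \<in> V" "\<not> leaf_end v" "p = Vertex v"
    | e i where "e \<in> F" "0 < i" "i < n e" "p = pt e i"
    by (auto simp: marks_def)
  then show "p \<in> core_points"
  proof cases
    case 1
    then show ?thesis by (simp add: core_points_def Vertex_points)
  next
    case 2
    have "e \<in> E" "elen e \<noteq> \<infinity>" using 2(1) by (auto simp: F_def)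
    moreover from this have "elen e = ereal (len e)" using elen_cases by blast
    moreover have "0 < \<tau> e i" "\<tau> e i < len e"
      using \<tau>_strict[of e 0 i] \<tau>_strict[of e i "n e"] 2 \<tau>_0[of e] \<tau>_n[of e] by (auto simp: F_def)
    ultimately have "Interior e (\<tau> e i) \<in> points C" unfolding Interior_points by (metis less_ereal.simps(1))
    then show ?thesis using 2 \<open>elen e \<noteq> \<infinity>\<close> by (simp add: core_points_def pt_def)
  qed
qed

lemma marks_points: "p \<in> marks \<Longrightarrow> p \<in> points C"
  using marks_core by (auto simp: core_points_def)

sublocale sub: network marks segs stail shead
proof
  show "finite marks" by (simp add: marks_def)
  show "stail \<sigma> \<in> marks" "shead \<sigma> \<in> marks" if "\<sigma> \<in> segs" for \<sigma>
    using that by (auto simp: segs_def stail_def shead_def intro!: pt_in_marks)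
qed simp

lemma slen_pos: "\<sigma> \<in> segs \<Longrightarrow> 0 < slen \<sigma>"
  using \<tau>_less by (auto simp: segs_def slen_def F_def)

lemma sum_segs: "(\<Sum>\<sigma>\<in>segs. f \<sigma>) = (\<Sum>e\<in>F. \<Sum>i<n e. f (e, i))"
  unfolding segs_def by (subst sum.Sigma) simp_all

lemma sum_slen: "e \<in> F \<Longrightarrow> (\<Sum>i<n e. slen (e, i)) = len e"
  using \<tau>_0[of e] \<tau>_n[of e] by (simp add: slen_def sum_lessThan_telescope F_def)

lemma pt_eq_Vertex:
  "e \<in> F \<Longrightarrow> i \<le> n e \<Longrightarrow> pt e i = Vertex v \<longleftrightarrow> i = 0 \<and> src e = v \<or> i = n e \<and> tgt e = v"
  using F_n_pos[of e] by (auto simp: pt_def)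

lemma pt_eq_pt:
  assumes "e \<in> F" "0 < i" "i < n e" "j \<le> n e'" "e' \<in> F"
  shows "pt e' j = pt e i \<longleftrightarrow> e' = e \<and> j = i"
proof
  assume eq: "pt e' j = pt e i"
  have "pt e i = Interior e (\<tau> e i)" using assms by (simp add: pt_def)
  with eq have "e' = e" "\<tau> e j = \<tau> e i" by (auto simp: pt_def split: if_splits)
  then show "e' = e \<and> j = i"
    using \<tau>_strict[of e i j] \<tau>_strict[of e j i] assms by (metis less_imp_le less_irrefl linorder_neqE_nat)
qed simp

lemma segs_at_Vertex:
  "{\<sigma>\<in>segs. stail \<sigma> = Vertex v} = (\<lambda>e. (e, 0)) ` {e\<in>F. src e = v}"
  "{\<sigma>\<in>segs. shead \<sigma> = Vertex v} = (\<lambda>e. (e, n e - 1)) ` {e\<in>F. tgt e = v}"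
proof -
  show "{\<sigma>\<in>segs. stail \<sigma> = Vertex v} = (\<lambda>e. (e, 0)) ` {e\<in>F. src e = v}"
    using F_n_pos by (auto simp: segs_def stail_def pt_eq_Vertex less_imp_le)
  show "{\<sigma>\<in>segs. shead \<sigma> = Vertex v} = (\<lambda>e. (e, n e - 1)) ` {e\<in>F. tgt e = v}"
  proof (intro subset_antisym subsetI)
    fix \<sigma> assume "\<sigma> \<in> {\<sigma>\<in>segs. shead \<sigma> = Vertex v}"
    then obtain e i where "\<sigma> = (e, i)" "e \<in> F" "i < n e" "pt e (Suc i) = Vertex v"
      by (auto simp: segs_def shead_def)
    moreover from this have "Suc i = n e" "tgt e = v" using pt_eq_Vertex[of e "Suc i" v] by auto
    ultimately show "\<sigma> \<in> (\<lambda>e. (e, n e - 1)) ` {e\<in>F. tgt e = v}"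
      by (intro image_eqI[of _ _ e]) auto
  next
    fix \<sigma> assume "\<sigma> \<in> (\<lambda>e. (e, n e - 1)) ` {e\<in>F. tgt e = v}"
    then obtain e where e: "\<sigma> = (e, n e - 1)" "e \<in> F" "tgt e = v" by auto
    then show "\<sigma> \<in> {\<sigma>\<in>segs. shead \<sigma> = Vertex v}"
      using F_n_pos[OF e(2)] by (simp add: segs_def shead_def pt_def)
  qed
qed

lemma segs_at_pt:
  assumes "e \<in> F" "0 < i" "i < n e"
  shows "{\<sigma>\<in>segs. stail \<sigma> = pt e i} = {(e, i)}" "{\<sigma>\<in>segs. shead \<sigma> = pt e i} = {(e, i - 1)}"
proof -
  have "\<sigma> \<in> segs \<and> stail \<sigma> = pt e i \<longleftrightarrow> \<sigma> = (e, i)" for \<sigma>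
    using pt_eq_pt[OF assms, of "snd \<sigma>" "fst \<sigma>"] assms
    by (cases \<sigma>) (auto simp: segs_def stail_def)
  then show "{\<sigma>\<in>segs. stail \<sigma> = pt e i} = {(e, i)}" by blast
  have "\<sigma> \<in> segs \<and> shead \<sigma> = pt e i \<longleftrightarrow> \<sigma> = (e, i - 1)" for \<sigma>
    using pt_eq_pt[OF assms, of "Suc (snd \<sigma>)" "fst \<sigma>"] assms
    by (cases \<sigma>) (auto simp: segs_def shead_def)
  then show "{\<sigma>\<in>segs. shead \<sigma> = pt e i} = {(e, i - 1)}" by blast
qed

text \<open>The lift forgets the leaves, so it respects boundaries only for chains that vanish there.\<close>

definition lft :: "('b \<Rightarrow> int) \<Rightarrow> 'b \<times> nat \<Rightarrow> int" where
  "lft c \<sigma> = (if \<sigma> \<in> segs then c (fst \<sigma>) else 0)"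

lemma lft_seg: "e \<in> F \<Longrightarrow> i < n e \<Longrightarrow> lft c (e, i) = c e"
  by (simp add: lft_def segs_def)

lemma chain_lft: "sub.chain (lft c)"
  by (simp add: sub.chain_def lft_def)

lemma sum_at_Vertex:
  "(\<Sum>\<sigma>\<in>{\<sigma>\<in>segs. stail \<sigma> = Vertex v}. f \<sigma>) = (\<Sum>e\<in>{e\<in>F. src e = v}. f (e, 0))"
  "(\<Sum>\<sigma>\<in>{\<sigma>\<in>segs. shead \<sigma> = Vertex v}. f \<sigma>) = (\<Sum>e\<in>{e\<in>F. tgt e = v}. f (e, n e - 1))"
  unfolding segs_at_Vertex by (simp_all add: sum.reindex inj_on_def)

lemma sum_over_F:
  assumes "\<And>e. e \<in> E \<Longrightarrow> elen e = \<infinity> \<Longrightarrow> f e = 0"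
  shows "(\<Sum>e\<in>{e\<in>F. P e}. f e) = (\<Sum>e\<in>{e\<in>E. P e}. f e)"
  using assms by (intro sum.mono_neutral_left) (auto simp: F_def)

lemma bd_lft_Vertex:
  assumes "\<And>e. e \<in> E \<Longrightarrow> elen e = \<infinity> \<Longrightarrow> c e = 0"
  shows "sub.bd (lft c) (Vertex v) = bd c v"
proof -
  have "lft c (e, 0) = c e" "lft c (e, n e - 1) = c e" if "e \<in> F" for e
    using lft_seg[OF that] F_n_pos[OF that] by simp_all
  then have "sub.bd (lft c) (Vertex v) = (\<Sum>e\<in>{e\<in>F. tgt e = v}. c e) - (\<Sum>e\<in>{e\<in>F. src e = v}. c e)"
    unfolding sub.bd_def sum_at_Vertex by (intro arg_cong2[of _ _ _ _ "(-)"] sum.cong) auto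
  then show ?thesis
    using sum_over_F[of c "\<lambda>e. tgt e = v"] sum_over_F[of c "\<lambda>e. src e = v"] assms
    by (simp add: bd_def)
qed

lemma bd_lft_pt:
  assumes "e \<in> F" "0 < i" "i < n e"
  shows "sub.bd (lft c) (pt e i) = 0"
  unfolding sub.bd_def segs_at_pt[OF assms] using assms lft_seg[OF assms(1)] by simp

lemma marks_cases:
  assumes "y \<in> marks"
  obtains (Vertex) v where "v \<in> V" "\<not> leaf_end v" "y = Vertex v"
    | (pt) e i where "e \<in> F" "0 < i" "i < n e" "y = pt e i"
  using assms by (auto simp: marks_def)

lemma cycs_leaf: "a \<in> cycs \<Longrightarrow> e \<in> E \<Longrightarrow> elen e = \<infinity> \<Longrightarrow> a e = 0"
  using cycle_leaf[of a e] by (simp add: cycs_eq)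

lemma lft_cycs: "a \<in> cycs \<Longrightarrow> lft a \<in> sub.cycs"
  unfolding sub.cycs_def
proof (intro CollectI conjI ballI chain_lft)
  fix y assume a: "a \<in> cycs" and y: "y \<in> marks"
  from y show "sub.bd (lft a) y = 0"
  proof (cases rule: marks_cases)
    case (Vertex v)
    then show ?thesis using bd_lft_Vertex[OF cycs_leaf[OF a]] a by (simp add: cycs_def)
  next
    case (pt e i)
    then show ?thesis using bd_lft_pt by simp
  qed
qed

text \<open>At a mark inside an edge conservation equates the values on the two adjacent segments,
  so a cycle of the subdivision is constant along each edge. At infinite endpoints the boundary
  vanishes because the constructed cycle is 0 on leaves.\<close>

lemma sub_cycs_eq: "sub.cycs = lft ` cycs"
proof (intro subset_antisym subsetI)
  fix a' assume a': "a' \<in> sub.cycs"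
  define a where "a e = (if e \<in> F then a' (e, 0) else 0)" for e
  have const: "a' (e, i) = a e" if "e \<in> F" "i < n e" for e i
    using that(2)
  proof (induction i)
    case 0
    then show ?case using that by (simp add: a_def)
  next
    case (Suc i)
    have "sub.bd a' (pt e (Suc i)) = 0"
      using a' pt_in_marks[OF that(1), of "Suc i"] Suc.prems by (simp add: sub.cycs_def)
    then have "a' (e, i) = a' (e, Suc i)"
      unfolding sub.bd_def using segs_at_pt[OF that(1), of "Suc i"] Suc.prems by simp
    then show ?case using Suc by simp
  qed
  have eq: "lft a = a'"
  proof
    fix \<sigma>
    show "lft a \<sigma> = a' \<sigma>"
    proof (cases "\<sigma> \<in> segs")
      case True
      then show ?thesis
        using const[of "fst \<sigma>" "snd \<sigma>"] by (cases \<sigma>) (auto simp: lft_def segs_def)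
    next
      case False
      have "sub.chain a'" using a' by (simp add: sub.cycs_def)
      then have "a' \<sigma> = 0" using False unfolding sub.chain_def by blast
      then show ?thesis using False by (simp add: lft_def)
    qed
  qed
  have leaf: "a e = 0" if "e \<in> E" "elen e = \<infinity>" for e using that by (simp add: a_def F_def)
  have "a \<in> cycs"
    unfolding cycs_def
  proof (intro CollectI conjI ballI)
    show "chain a" by (simp add: chain_def a_def F_def)
    fix v assume v: "v \<in> V"
    show "bd a v = 0"
    proof (cases "leaf_end v")
      case True
      then obtain e where e: "e \<in> E" "elen e = \<infinity>" "tgt e = v" by (auto simp: leaf_end_def)
      show ?thesis unfolding bd_def e(3)[symmetric] leaf_head[OF e(1,2)] using leaf[OF e(1,2)] by simp
    next
      case False
      then have "Vertex v \<in> marks" using v by (simp add: marks_def)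
      then have "sub.bd a' (Vertex v) = 0" using a' by (simp add: sub.cycs_def)
      then show ?thesis using bd_lft_Vertex[of a v] leaf eq by simp
    qed
  qed
  then show "a' \<in> lft ` cycs" using eq by blast
qed (use lft_cycs in blast)

lemma sum_segs_lft:
  assumes "a \<in> cycs"
  shows "(\<Sum>\<sigma>\<in>segs. g (fst \<sigma>) (lft a \<sigma>) * slen \<sigma>) = (\<Sum>e\<in>E. g e (a e) * len e)"
proof -
  have "(\<Sum>\<sigma>\<in>segs. g (fst \<sigma>) (lft a \<sigma>) * slen \<sigma>) = (\<Sum>e\<in>F. \<Sum>i<n e. g e (a e) * slen (e, i))"
    unfolding sum_segs by (intro sum.cong refl) (simp add: lft_seg)
  also have "\<dots> = (\<Sum>e\<in>F. g e (a e) * len e)"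
    by (intro sum.cong refl) (simp add: sum_slen flip: sum_distrib_left)
  also have "\<dots> = (\<Sum>e\<in>E. g e (a e) * len e)"
    by (intro sum.mono_neutral_left) (auto simp: F_def)
  finally show ?thesis .
qed

text \<open>The integral over the chain \<open>c\<close> of the 1-form given by the cycle \<open>a\<close>.\<close>

definition ip :: "('b \<times> nat \<Rightarrow> int) \<Rightarrow> ('b \<Rightarrow> int) \<Rightarrow> real" where
  "ip c a = (\<Sum>\<sigma>\<in>segs. c \<sigma> * slen \<sigma> * lft a \<sigma>)"

lemma ip_lft: "a \<in> cycs \<Longrightarrow> ip (lft c) a = lat c (realc a)"
proof -
  assume a: "a \<in> cycs"
  have "ip (lft c) a = (\<Sum>\<sigma>\<in>segs. (\<lambda>e k. real_of_int (c e) * k) (fst \<sigma>) (lft a \<sigma>) * slen \<sigma>)"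
    unfolding ip_def by (intro sum.cong refl) (simp add: lft_def)
  also have "\<dots> = (\<Sum>e\<in>E. (\<lambda>e k. real_of_int (c e) * k) e (a e) * len e)" by (rule sum_segs_lft[OF a])
  finally show ?thesis by (simp add: lat_apply[OF a])
qed

lemma ip_add: "ip (\<lambda>\<sigma>. c \<sigma> + d \<sigma>) a = ip c a + ip d a"
  by (simp add: ip_def sum.distrib algebra_simps)

lemma ip_diff: "ip (\<lambda>\<sigma>. c \<sigma> - d \<sigma>) a = ip c a - ip d a"
  by (simp add: ip_def sum_subtractf algebra_simps)

lemma ip_sum: "ip (\<lambda>\<sigma>. \<Sum>i\<in>I. k i * c i \<sigma>) a = (\<Sum>i\<in>I. k i * ip (c i) a)"
  unfolding ip_def sum_distrib_left by (subst sum.swap) (simp add: sum_distrib_right sum_distrib_left mult_ac)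

lemma ip_unit: "\<sigma> \<in> segs \<Longrightarrow> ip (\<lambda>\<rho>. if \<rho> = \<sigma> then 1 else 0) a = slen \<sigma> * lft a \<sigma>"
proof -
  assume "\<sigma> \<in> segs"
  have "ip (\<lambda>\<rho>. if \<rho> = \<sigma> then 1 else 0) a = (\<Sum>\<rho>\<in>segs. if \<rho> = \<sigma> then slen \<sigma> * lft a \<sigma> else 0)"
    unfolding ip_def by (rule sum.cong) auto
  then show ?thesis using \<open>\<sigma> \<in> segs\<close> by simp
qed

text \<open>Realizes the lift of a mark by an integral chain of the subdivision: a connecting chain
  to the tail, prolonged segment by segment, turns the real offset into a sum of segment
  lengths.\<close>

lemma sub_chain_exists:
  assumes v1: "v1 \<in> V" "\<not> leaf_end v1" and y: "y \<in> marks"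
  obtains c where "c \<in> sub.chains_from_to (Vertex v1) y"
    "\<And>a. a \<in> cycs \<Longrightarrow> ip c a = (lat (conn v1 (base y)) + off y) (realc a)"
proof -
  have conn: "lft (conn v1 v) \<in> sub.chains_from_to (Vertex v1) (Vertex v)"
    if v: "v \<in> V" "\<not> leaf_end v" for v
  proof -
    have c: "conn v1 v \<in> chains_from_to v1 v" using conn[OF v1(1) v(1)] .
    \<comment> \<open>At an infinite endpoint the boundary is the coefficient of the leaf alone, and
      neither end of the chain lies there.\<close>
    have leaf: "conn v1 v e = 0" if e: "e \<in> E" "elen e = \<infinity>" for e
    proof -
      have ne: "tgt e \<noteq> v" "tgt e \<noteq> v1" using e v(2) v1(2) by (auto simp: leaf_end_def)
      have "bd (conn v1 v) (tgt e) = conn v1 v e" unfolding bd_def leaf_head[OF e] by simp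
      then show ?thesis using c hd_in[OF e(1)] ne by (simp add: chains_from_to_def)
    qed
    show ?thesis
      unfolding sub.chains_from_to_def
    proof (intro CollectI conjI ballI chain_lft)
      fix p assume "p \<in> marks"
      then show "sub.bd (lft (conn v1 v)) p = of_bool (p = Vertex v) - of_bool (p = Vertex v1)"
      proof (cases rule: marks_cases)
        case (Vertex u)
        then show ?thesis using bd_lft_Vertex[OF leaf] c by (simp add: chains_from_to_def)
      next
        case (pt e i)
        then show ?thesis using bd_lft_pt by (simp add: pt_def)
      qed
    qed
  qed
  from y show ?thesis
  proof (cases rule: marks_cases)
    case (Vertex v)
    show ?thesis
      by (rule that[of "lft (conn v1 v)"]) (use conn Vertex ip_lft in \<open>auto simp: base_def off_def\<close>)
  next
    case (pt e i)
    have e: "e \<in> E" "src e \<in> V" "\<not> leaf_end (src e)"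
      using F_E[OF pt(1)] tl_in not_leaf_end(1) by auto
    have "\<exists>c. c \<in> sub.chains_from_to (Vertex v1) (pt e j) \<and>
        (\<forall>a\<in>cycs. ip c a = lat (conn v1 (src e)) (realc a) + \<tau> e j * a e)" if "j \<le> i" for j
      using that
    proof (induction j)
      case 0
      then show ?case
        using conn[OF e(2,3)] ip_lft \<tau>_0[of e] pt(1)
        by (intro exI[of _ "lft (conn v1 (src e))"]) (auto simp: pt_def F_def simp del: realc_apply)
    next
      case (Suc j)
      then obtain c where c: "c \<in> sub.chains_from_to (Vertex v1) (pt e j)"
        "\<And>a. a \<in> cycs \<Longrightarrow> ip c a = lat (conn v1 (src e)) (realc a) + \<tau> e j * a e"
        by (auto simp del: realc_apply)
      let ?u = "\<lambda>\<rho>. if \<rho> = (e, j) then 1 else 0"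
      have seg: "(e, j) \<in> segs" using pt Suc.prems by (simp add: segs_def)
      then have "?u \<in> sub.chains_from_to (pt e j) (pt e (Suc j))"
        using sub.unit_in_chains[OF seg] by (simp add: stail_def shead_def)
      then have "(\<lambda>\<rho>. c \<rho> + ?u \<rho>) \<in> sub.chains_from_to (Vertex v1) (pt e (Suc j))"
        by (rule sub.chains_from_to_trans[OF c(1)])
      moreover have "ip (\<lambda>\<rho>. c \<rho> + ?u \<rho>) a = lat (conn v1 (src e)) (realc a) + \<tau> e (Suc j) * a e"
        if "a \<in> cycs" for a
        unfolding ip_add ip_unit[OF seg] c(2)[OF that]
        using pt Suc.prems by (simp add: lft_seg slen_def algebra_simps)
      ultimately show ?case by (intro exI[of _ "\<lambda>\<rho>. c \<rho> + ?u \<rho>"]) blast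
    qed
    from this[of i] obtain c where "c \<in> sub.chains_from_to (Vertex v1) (pt e i)"
      "\<And>a. a \<in> cycs \<Longrightarrow> ip c a = lat (conn v1 (src e)) (realc a) + \<tau> e i * a e"
      by (auto simp del: realc_apply)
    then show ?thesis
      using pt by (intro that[of c]) (auto simp: base_def off_def pt_def scaleR_fun_def edgef_realc)
  qed
qed

text \<open>As in Abel's theorem, the linear equivalence yields a flow \<open>k\<close> with the prescribed boundary that is
  orthogonal to all cycles, hence the gradient of a function \<open>\<phi>\<close>.\<close>

lemma no_effective_divisor:
  fixes D \<Theta> :: "('a, 'b) point \<Rightarrow> int"
  assumes v1: "v1 \<in> V" "\<not> leaf_end v1"
    and z: "z \<in> dual_forms C" "N z = {\<lambda>e. 0}"
    and \<Theta>: "\<And>y. y \<in> marks \<Longrightarrow> \<Theta> y = coef (lat (conn v1 (base y)) + off y + z) y"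
    and degree: "(\<Sum>y\<in>marks. \<Theta> y - of_bool (y = Vertex v1) - D y) = 0"
    and equivalent: "(\<Sum>y\<in>marks. real_of_int (\<Theta> y - of_bool (y = Vertex v1) - D y) *\<^sub>R aj y) \<in> lattice C"
  shows "\<exists>y\<in>marks. D y < 0"
proof -
  let ?q = "Vertex v1 :: ('a, 'b) point"
  have q: "?q \<in> marks" using v1 by (simp add: marks_def)
  obtain b where b: "b \<in> cycles C" "chain_integral C b = z" using riesz_representation[OF z(1)] .
  \<comment> \<open>The drift of the cost: the real cycle representing \<open>z\<close>, weighted by
    length, so that its pairing with integral cycles is \<open>z\<close> itself.\<close>
  define X where "X \<sigma> = b (fst \<sigma>) * slen \<sigma>" for \<sigma>
  have X: "(\<Sum>\<sigma>\<in>segs. X \<sigma> * lft a \<sigma>) = z (realc a)" if a: "a \<in> cycs" for a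
  proof -
    have "(\<Sum>\<sigma>\<in>segs. X \<sigma> * lft a \<sigma>) = (\<Sum>\<sigma>\<in>segs. (\<lambda>e k. b e * real_of_int k) (fst \<sigma>) (lft a \<sigma>) * slen \<sigma>)"
      by (simp add: X_def mult_ac)
    also have "\<dots> = (\<Sum>e\<in>E. (\<lambda>e k. b e * real_of_int k) e (a e) * len e)" by (rule sum_segs_lft[OF a])
    finally show ?thesis
      unfolding b(2)[symmetric] using realc_cycle[OF a] by (simp add: chain_integral_def)
  qed
  have sq: "(\<Sum>\<sigma>\<in>segs. (real_of_int (lft a \<sigma>))\<^sup>2 / 2 * slen \<sigma>) = nrm a / 2" if a: "a \<in> cycs" for a
    using sum_segs_lft[OF a, of "\<lambda>e k. (real_of_int k)\<^sup>2 / 2"] by (simp add: nrm_def sum_divide_distrib)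
  interpret W: weighted_network marks segs stail shead slen X ?q
  proof
    show "0 < slen \<sigma>" if "\<sigma> \<in> segs" for \<sigma> using that by (rule slen_pos)
    show "?q \<in> marks" by (rule q)
    fix a' assume a': "a' \<in> sub.cycs" "a' \<noteq> (\<lambda>\<sigma>. 0)"
    then obtain a where a: "a \<in> cycs" "a' = lft a" by (auto simp: sub_cycs_eq)
    have ne: "(\<lambda>e. - a e) \<noteq> (\<lambda>e. 0)"
    proof
      assume "(\<lambda>e. - a e) = (\<lambda>e. 0)"
      then have "a e = 0" for e by (simp add: fun_eq_iff)
      then have "lft a = (\<lambda>\<sigma>. 0)" by (auto simp: lft_def)
      then show False using a'(2) a(2) by simp
    qed
    have zero: "(\<lambda>e. 0) \<in> N z" using z(2) by simp
    have not: "(\<lambda>e. - a e) \<notin> N z" using z(2) ne by simp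
    \<comment> \<open>Strict because the zero cycle is the only maximizer at \<open>z\<close>.
      Evaluating at \<open>- a\<close> turns the linear term of \<open>val\<close> into the linear
      term of the cost.\<close>
    have "val z (\<lambda>e. - a e) < val z (\<lambda>e. 0)"
    proof (rule ccontr)
      assume "\<not> ?thesis"
      then have "val z c \<le> val z (\<lambda>e. - a e)" if "c \<in> cycs" for c
        using zero that unfolding N_def by force
      then show False using not cycs_uminus[OF a(1)] by (simp add: N_def)
    qed
    moreover have "realc (\<lambda>e. - a e) = (-1) *\<^sub>R realc a" by (auto simp: realc_def scaleR_fun_def)
    then have "z (realc (\<lambda>e. - a e)) = - z (realc a)"
      using dualD(3)[OF z(1) realc_cycle[OF a(1)], of "-1"] by simp
    ultimately have "0 < nrm a / 2 + z (realc a)"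
      unfolding val_zero[OF z(1)] by (simp add: val_def nrm_def)
    then show "0 < (\<Sum>\<sigma>\<in>segs. (real_of_int (a' \<sigma>))\<^sup>2 / 2 * slen \<sigma> + X \<sigma> * real_of_int (a' \<sigma>))"
      unfolding sum.distrib a(2) sq[OF a(1)] X[OF a(1)] .
  qed
  define w where "w y = lat (conn v1 (base y)) + off y + z" for y
  have w: "w y \<in> dual_forms C" for y unfolding w_def using lat_dual off_dual z(1) by blast
  have "\<exists>c. c \<in> sub.chains_from_to ?q y \<and> (\<forall>a\<in>cycs. ip c a = (lat (conn v1 (base y)) + off y) (realc a))"
    if "y \<in> marks" for y
    using sub_chain_exists[OF v1 that] by metis
  then obtain c where c: "\<And>y. y \<in> marks \<Longrightarrow> c y \<in> sub.chains_from_to ?q y"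
    and ip_c: "\<And>y a. y \<in> marks \<Longrightarrow> a \<in> cycs \<Longrightarrow> ip (c y) a = (lat (conn v1 (base y)) + off y) (realc a)"
    by metis
  have maximizers: "W.maximizers (c y) = lft ` N (w y)" if y: "y \<in> marks" for y
  proof -
    have obj: "(\<Sum>\<sigma>\<in>segs. (c y \<sigma> * slen \<sigma> + X \<sigma>) * lft a \<sigma> - (real_of_int (lft a \<sigma>))\<^sup>2 / 2 * slen \<sigma>) = val (w y) a"
      if a: "a \<in> cycs" for a
    proof -
      have "(\<Sum>\<sigma>\<in>segs. (c y \<sigma> * slen \<sigma> + X \<sigma>) * lft a \<sigma> - (real_of_int (lft a \<sigma>))\<^sup>2 / 2 * slen \<sigma>) =
          ip (c y) a + z (realc a) - nrm a / 2"
        unfolding ip_def X[OF a, symmetric] sq[OF a, symmetric] sum_subtractf sum.distrib [symmetric]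
        by (simp add: distrib_right)
      then show ?thesis by (simp add: ip_c[OF y a] val_def w_def del: realc_apply)
    qed
    show ?thesis
      unfolding W.maximizers_def sub_cycs_eq N_def using obj by (auto simp del: realc_apply)
  qed
  define \<delta> where "\<delta> y = \<Theta> y - of_bool (y = ?q) - D y" for y
  \<comment> \<open>Since \<open>\<delta>\<close> has degree 0, the terms \<open>aj ?q\<close>
    cancel. The lattice condition on \<open>aj\<close> becomes one on the chosen chains and yields
    the cycle \<open>\<gamma>\<close>.\<close>
  have "(\<Sum>y\<in>marks. real_of_int (\<delta> y) *\<^sub>R (aj y - aj ?q - (lat (conn v1 (base y)) + off y - off ?q))) \<in> lattice C"
  proof (intro lattice_sum lattice_scale aj_diff marks_points q)
    show "conn v1 (base y) \<in> chains_from_to (base ?q) (base y)" if "y \<in> marks" for y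
      using conn[OF v1(1) base_in[OF marks_points[OF that]]] by (simp add: base_def)
  qed
  also have "(\<Sum>y\<in>marks. real_of_int (\<delta> y) *\<^sub>R (aj y - aj ?q - (lat (conn v1 (base y)) + off y - off ?q))) =
      (\<Sum>y\<in>marks. real_of_int (\<delta> y) *\<^sub>R aj y) - (\<Sum>y\<in>marks. real_of_int (\<delta> y) *\<^sub>R aj ?q) -
      (\<Sum>y\<in>marks. real_of_int (\<delta> y) *\<^sub>R (lat (conn v1 (base y)) + off y))"
    by (simp add: off_def scaleR_right_diff_distrib sum_subtractf)
  also have "(\<Sum>y\<in>marks. real_of_int (\<delta> y) *\<^sub>R aj ?q) = 0"
    using degree unfolding \<delta>_def[symmetric] by (simp flip: scaleR_left.sum of_int_sum)
  finally have "(\<Sum>y\<in>marks. real_of_int (\<delta> y) *\<^sub>R aj y) - 0 -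
      (\<Sum>y\<in>marks. real_of_int (\<delta> y) *\<^sub>R (lat (conn v1 (base y)) + off y)) \<in> lattice C" .
  from lattice_diff[OF equivalent[folded \<delta>_def] this]
  have "(\<Sum>y\<in>marks. real_of_int (\<delta> y) *\<^sub>R (lat (conn v1 (base y)) + off y)) \<in> lattice C"
    by (simp add: algebra_simps)
  then obtain \<gamma> where \<gamma>: "\<gamma> \<in> cycs"
    "(\<Sum>y\<in>marks. real_of_int (\<delta> y) *\<^sub>R (lat (conn v1 (base y)) + off y)) = lat \<gamma>"
    by (auto simp: lattice_eq)
  \<comment> \<open>The chains \<open>c y\<close> weighted by \<open>\<delta>\<close> have boundary
    \<open>\<delta>\<close>; subtracting \<open>lft \<gamma>\<close> keeps the boundary and makes
    the flow orthogonal to all cycles.\<close>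
  define k where "k \<sigma> = (\<Sum>y\<in>marks. \<delta> y * c y \<sigma>) - lft \<gamma> \<sigma>" for \<sigma>
  have k_orth: "ip k a = 0" if a: "a \<in> cycs" for a
  proof -
    have "ip (\<lambda>\<sigma>. \<Sum>y\<in>marks. \<delta> y * c y \<sigma>) a = (\<Sum>y\<in>marks. \<delta> y * ip (c y) a)"
      by (simp add: ip_sum)
    also have "\<dots> = (\<Sum>y\<in>marks. real_of_int (\<delta> y) *\<^sub>R (lat (conn v1 (base y)) + off y)) (realc a)"
      unfolding sum_fun_apply by (intro sum.cong refl) (simp add: ip_c a scaleR_fun_def del: realc_apply)
    also have "\<dots> = ip (lft \<gamma>) a" unfolding \<gamma>(2) ip_lft[OF a] ..
    finally show ?thesis unfolding k_def ip_diff by simp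
  qed
  have bd_k: "sub.bd k y = \<delta> y" if y: "y \<in> marks" for y
  proof -
    have "sub.bd k y = (\<Sum>p\<in>marks. \<delta> p * sub.bd (c p) y)"
      unfolding k_def sub.bd_diff sub.bd_sum sub.bd_cmult
      using lft_cycs[OF \<gamma>(1)] y by (simp add: sub.cycs_def)
    also have "\<dots> = (\<Sum>p\<in>marks. (if p = y then \<delta> p else 0) - \<delta> p * of_bool (y = ?q))"
    proof (intro sum.cong refl)
      fix p assume "p \<in> marks"
      then have "sub.bd (c p) y = of_bool (y = p) - of_bool (y = ?q)"
        using c[of p] y by (simp add: sub.chains_from_to_def)
      then show "\<delta> p * sub.bd (c p) y = (if p = y then \<delta> p else 0) - \<delta> p * of_bool (y = ?q)"
        by (simp only: right_diff_distrib) auto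
    qed
    also have "\<dots> = \<delta> y - (\<Sum>p\<in>marks. \<delta> p) * of_bool (y = ?q)"
      using y sub.finite_V by (simp add: sum_subtractf flip: sum_distrib_right)
    finally show ?thesis using degree unfolding \<delta>_def[symmetric] by simp
  qed
  \<comment> \<open>A potential, obtained by integrating \<open>k\<close> along a chain from
    \<open>?q\<close>. Orthogonality to cycles makes the choice of chain irrelevant, so prolonging a
    chain by \<open>\<sigma>\<close> computes the difference across \<open>\<sigma>\<close>.\<close>
  define \<phi> where "\<phi> y = (\<Sum>\<sigma>\<in>segs. k \<sigma> * slen \<sigma> * c y \<sigma>)" for y
  have \<phi>: "\<phi> (shead \<sigma>) - \<phi> (stail \<sigma>) = k \<sigma> * slen \<sigma>" if \<sigma>: "\<sigma> \<in> segs" for \<sigma>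
  proof -
    let ?u = "\<lambda>\<rho>. if \<rho> = \<sigma> then 1 else (0::int)"
    have ends: "stail \<sigma> \<in> marks" "shead \<sigma> \<in> marks" using sub.tl_in sub.hd_in \<sigma> by auto
    have "(\<lambda>\<rho>. c (stail \<sigma>) \<rho> + ?u \<rho> - c (shead \<sigma>) \<rho>) \<in> sub.cycs"
      by (rule sub.chains_from_to_diff[OF sub.chains_from_to_trans[OF c sub.unit_in_chains] c])
        (use ends \<sigma> in auto)
    then obtain a where a: "a \<in> cycs" "(\<lambda>\<rho>. c (stail \<sigma>) \<rho> + ?u \<rho> - c (shead \<sigma>) \<rho>) = lft a"
      by (auto simp: sub_cycs_eq)
    have "0 = (\<Sum>\<rho>\<in>segs. k \<rho> * slen \<rho> * lft a \<rho>)" using k_orth[OF a(1)] by (simp add: ip_def)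
    also have "\<dots> = (\<Sum>\<rho>\<in>segs. k \<rho> * slen \<rho> * c (stail \<sigma>) \<rho> + (if \<rho> = \<sigma> then k \<sigma> * slen \<sigma> else 0)
        - k \<rho> * slen \<rho> * c (shead \<sigma>) \<rho>)"
      unfolding a(2)[symmetric] by (intro sum.cong refl) (auto simp: algebra_simps)
    also have "\<dots> = \<phi> (stail \<sigma>) + k \<sigma> * slen \<sigma> - \<phi> (shead \<sigma>)"
      using \<sigma> by (simp add: sum.distrib sum_subtractf \<phi>_def)
    finally show ?thesis by simp
  qed
  have max_eq: "Max ((\<lambda>a. \<epsilon> * a \<sigma>) ` W.maximizers (c y)) = slope (w y) (fst \<sigma>) \<epsilon>"
    if "y \<in> marks" "\<sigma> \<in> segs" for \<epsilon> \<sigma> y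
    unfolding maximizers[OF that(1)] image_image slope_def
    by (intro arg_cong[of _ _ Max] image_cong refl) (simp add: lft_def that(2))
  show ?thesis
  proof (rule W.negative_coefficient[of c, OF c])
    show "finite (W.maximizers (c y))" "W.maximizers (c y) \<noteq> {}" if "y \<in> marks" for y
      unfolding maximizers[OF that] using finite_N[OF w] N_nonempty[OF w] by simp_all
    show "\<phi> (shead \<sigma>) - \<phi> (stail \<sigma>) = k \<sigma> * slen \<sigma>" if "\<sigma> \<in> segs" for \<sigma> using that by (rule \<phi>)
    fix y assume y: "y \<in> marks"
    \<comment> \<open>Leaves attached at a vertex contribute slope 0, so nothing is lost in passing
      from edges to segments.\<close>
    have "coef (w y) y = (\<Sum>\<sigma>\<in>{\<sigma>\<in>segs. stail \<sigma> = y}. slope (w y) (fst \<sigma>) 1) +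
        (\<Sum>\<sigma>\<in>{\<sigma>\<in>segs. shead \<sigma> = y}. slope (w y) (fst \<sigma>) (-1))"
      using y
    proof (cases rule: marks_cases)
      case (Vertex v)
      show ?thesis
        unfolding Vertex(3) sum_at_Vertex coef_def point.case fst_conv
        using slope_leaf[OF w] by (intro arg_cong2[of _ _ _ _ "(+)"] sum_over_F[symmetric]) auto
    next
      case (pt e i)
      show ?thesis
        unfolding pt(4) segs_at_pt[OF pt(1-3)] using pt by (simp add: coef_def pt_def)
    qed
    also have "\<dots> = (\<Sum>\<sigma>\<in>{\<sigma>\<in>segs. stail \<sigma> = y}. Max ((\<lambda>a. a \<sigma>) ` W.maximizers (c y))) +
        (\<Sum>\<sigma>\<in>{\<sigma>\<in>segs. shead \<sigma> = y}. Max ((\<lambda>a. - a \<sigma>) ` W.maximizers (c y)))"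
      using max_eq[OF y, of _ 1] max_eq[OF y, of _ "-1"]
      by (intro arg_cong2[of _ _ _ _ "(+)"] sum.cong) auto
    finally show "D y = (\<Sum>\<sigma>\<in>{\<sigma>\<in>segs. stail \<sigma> = y}. Max ((\<lambda>a. a \<sigma>) ` W.maximizers (c y))) +
        (\<Sum>\<sigma>\<in>{\<sigma>\<in>segs. shead \<sigma> = y}. Max ((\<lambda>a. - a \<sigma>) ` W.maximizers (c y))) -
        of_bool (y = ?q) - sub.bd k y"
      using \<Theta>[OF y] bd_k[OF y] by (simp add: w_def \<delta>_def)
  qed
qed

end

section \<open>Effective divisors of degree g - 1 map into the theta divisor\<close>

context pointed_tropical
begin

lemma effective_in_theta_divisor:
  assumes \<kappa>: "jacobi_inversion_constant C p0 \<kappa>"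
    and D: "divisor C D" "effective D" "divisor_degree D = int (genus C) - 1"
  shows "abel_jacobi C p0 D + \<kappa> \<in> theta_divisor C"
proof (rule ccontr)
  assume not: "abel_jacobi C p0 D + \<kappa> \<notin> theta_divisor C"
  obtain k where k: "\<kappa> = k +o lattice C" "k \<in> dual_forms C"
    using \<kappa> by (auto simp: jacobi_inversion_constant_def jacobian_def)
  let ?s = "\<Sum>p | D p \<noteq> 0. real_of_int (D p) *\<^sub>R aj p"
  have fin: "finite {p. D p \<noteq> 0}" using D(1) by (simp add: divisor_def)
  define x where "x = ?s + k"
  have x: "x \<in> dual_forms C" unfolding x_def using aj_dual k(2) by (intro dual_add dual_sum dual_scale)
  have j: "abel_jacobi C p0 D + \<kappa> = x +o lattice C"
    unfolding x_def abel_jacobi_eq[OF fin order_refl] k(1) coset_add ..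
  obtain a where "a \<in> N x" using N_nonempty[OF x] by blast
  moreover have "b = b'" if "b \<in> N x" "b' \<in> N x" for b b'
    using not x that unfolding j mem_theta_divisor_iff by metis
  ultimately have Nx: "N x = {a}" by blast
  have a: "a \<in> cycs" using N_cycs[of a x] Nx by simp
  \<comment> \<open>The only maximizer at \<open>- x\<close> is \<open>- a\<close>; translating by
    \<open>lat a\<close> moves it to the zero cycle without changing the class in the
    Jacobian.\<close>
  define z where "z = - x + lat a"
  have z: "z \<in> dual_forms C" unfolding z_def using x lat_dual by blast
  have "N (- x) = {\<lambda>e. - a e}" unfolding N_uminus[OF x] Nx by simp
  then have Nz: "N z = {\<lambda>e. 0}" unfolding z_def N_shift[OF dual_uminus[OF x] a] by simp
  obtain v1 where v1: "v1 \<in> V" "\<not> leaf_end v1" using core_vertex_exists by blast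
  let ?q = "Vertex v1 :: ('v, 'e) point"
  have q: "?q \<in> points C" using v1 by (simp add: Vertex_points)
  have xq: "aj ?q - z \<in> dual_forms C" using aj_dual z by blast
  define \<Theta> where "\<Theta> = theta_pullback C p0 ((aj ?q - z) +o lattice C)"
  note \<Theta> = theta_pullback_divisor[OF xq, folded \<Theta>_def]
  have \<Theta>_core: "{p. \<Theta> p \<noteq> 0} \<subseteq> core_points"
    unfolding \<Theta>_def by (rule theta_pullback_core[OF xq])
  obtain D' where D': "finite {p. D' p \<noteq> 0}" "{p. D' p \<noteq> 0} \<subseteq> core_points" "\<And>p. 0 \<le> D' p"
    "(\<Sum>p | D' p \<noteq> 0. D' p) = divisor_degree D"
    "?s - (\<Sum>p | D' p \<noteq> 0. real_of_int (D' p) *\<^sub>R aj p) \<in> lattice C"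
    by (rule effective_retract[OF D(1,2)]) (rule that)
  \<comment> \<open>Both supports must consist of marks, since the finite argument sees the divisors
    only there.\<close>
  let ?P = "{p. D' p \<noteq> 0} \<union> {p. \<Theta> p \<noteq> 0}"
  define good where "good e m \<tau> \<longleftrightarrow> 0 < m \<and> \<tau> 0 = 0 \<and> \<tau> m = len e \<and> (\<forall>i<m. \<tau> i < \<tau> (Suc i)) \<and>
      Interior e -` ?P \<subseteq> \<tau> ` {0<..<m}" for e and m :: nat and \<tau>
  have "\<exists>f. good e (fst f) (snd f)" if e: "e \<in> E" "elen e \<noteq> \<infinity>" for e
  proof -
    have len: "elen e = ereal (len e)" "0 < len e" using elen_cases[OF e(1)] e(2) by blast+
    have "finite (Interior e -` ?P)"
      using D'(1) \<Theta>(1) by (intro finite_vimageI) (auto simp: inj_on_def)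
    moreover have "Interior e -` ?P \<subseteq> {0<..<len e}"
    proof
      fix t assume "t \<in> Interior e -` ?P"
      then have "Interior e t \<in> points C" using D'(2) \<Theta>_core by (auto simp: core_points_def)
      then have "0 < t" "ereal t < ereal (len e)" unfolding Interior_points using len(1) by simp_all
      then show "t \<in> {0<..<len e}" by simp
    qed
    ultimately obtain m :: nat and \<tau> where "0 < m" "\<tau> 0 = 0" "\<tau> m = len e"
      "\<And>i. i < m \<Longrightarrow> \<tau> i < \<tau> (Suc i)" "Interior e -` ?P \<subseteq> \<tau> ` {0<..<m}"
      by (rule subdivision_exists[OF _ _ len(2)]) (rule that)
    then have "good e m \<tau>" unfolding good_def by blast
    then show ?thesis by (intro exI[of _ "(m, \<tau>)"]) simp
  qed
  then have "\<exists>f. e \<in> E \<longrightarrow> elen e \<noteq> \<infinity> \<longrightarrow> good e (fst f) (snd f)" for e by blast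
  then obtain f where f: "\<And>e. e \<in> E \<longrightarrow> elen e \<noteq> \<infinity> \<longrightarrow> good e (fst (f e)) (snd (f e))"
    using choice[of "\<lambda>e f. e \<in> E \<longrightarrow> elen e \<noteq> \<infinity> \<longrightarrow> good e (fst f) (snd f)"] by blast
  define n where "n e = fst (f e)" for e
  define \<tau> where "\<tau> e = snd (f e)" for e
  have sd: "good e (n e) (\<tau> e)" if "e \<in> E" "elen e \<noteq> \<infinity>" for e
    using f that by (simp add: n_def \<tau>_def)
  interpret subdivided C p0 n \<tau>
  proof
    fix e and i :: nat assume e: "e \<in> E" "elen e \<noteq> \<infinity>"
    show "0 < n e" "\<tau> e 0 = 0" "\<tau> e (n e) = len e" using sd[OF e] by (simp_all add: good_def)
    show "\<tau> e i < \<tau> e (Suc i)" if "i < n e" using sd[OF e] that by (simp add: good_def)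
  qed
  have P_marks: "?P \<subseteq> marks"
  proof
    fix p assume p: "p \<in> ?P"
    then have core: "p \<in> core_points" using D'(2) \<Theta>_core by blast
    show "p \<in> marks"
    proof (cases p)
      case (Vertex v)
      then show ?thesis using core by (simp add: core_points_def marks_def Vertex_points)
    next
      case (Interior e t)
      then have e: "e \<in> E" "elen e \<noteq> \<infinity>" using core by (simp_all add: core_points_def Interior_points)
      have "t \<in> \<tau> e ` {0<..<n e}" using sd[OF e] p unfolding Interior good_def by blast
      then obtain i where i: "0 < i" "i < n e" "t = \<tau> e i" by auto
      then have "p = pt e i" by (simp add: pt_def Interior)
      then show ?thesis using i e pt_in_marks[of e i] by (simp add: F_def)
    qed
  qed
  have q_mark: "?q \<in> marks" using v1 by (simp add: marks_def)
  have sum_D': "(\<Sum>y\<in>marks. D' y) = int (genus C) - 1"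
    unfolding D(3)[symmetric] D'(4)[symmetric] using P_marks by (intro sum.mono_neutral_right) auto
  have sum_\<Theta>: "(\<Sum>y\<in>marks. \<Theta> y) = int (genus C)"
    unfolding \<Theta>(4)[symmetric] divisor_degree_def using P_marks by (intro sum.mono_neutral_right) auto
  have sum_D'_aj: "(\<Sum>y\<in>marks. real_of_int (D' y) *\<^sub>R aj y) = (\<Sum>p | D' p \<noteq> 0. real_of_int (D' p) *\<^sub>R aj p)"
    using P_marks by (intro sum.mono_neutral_right) auto
  let ?t = "\<Sum>y\<in>marks. real_of_int (\<Theta> y) *\<^sub>R aj y"
  have "(aj ?q - z) +o lattice C \<in> jacobian C" using xq by (rule coset_in_jacobian)
  then have "abel_jacobi C p0 \<Theta> + \<kappa> = (aj ?q - z) +o lattice C"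
    using \<kappa> by (auto simp: jacobi_inversion_constant_def \<Theta>_def)
  moreover have "{p. \<Theta> p \<noteq> 0} \<subseteq> marks" using P_marks by blast
  ultimately have 1: "(?t + k) - (aj ?q - z) \<in> lattice C"
    using abel_jacobi_eq[OF sub.finite_V, of \<Theta>] unfolding k(1) coset_add by (simp only: coset_add coset_eq_iff)
  have 2: "lat a \<in> lattice C" using a by (auto simp: lattice_eq)
  have "\<exists>y\<in>marks. D' y < 0"
  proof (rule no_effective_divisor[OF v1 z Nz])
    show "\<Theta> y = coef (lat (conn v1 (base y)) + off y + z) y" if y: "y \<in> marks" for y
      unfolding \<Theta>_def
    proof (rule theta_pullback_eq[OF marks_points[OF y] xq])
      show "lat (conn v1 (base y)) + off y + z \<in> dual_forms C" using lat_dual off_dual z by blast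
      have "aj y - aj ?q - (lat (conn v1 (base y)) + off y - off ?q) \<in> lattice C"
        using conn[OF v1(1) base_in[OF marks_points[OF y]]]
        by (intro aj_diff marks_points y q_mark) (simp add: base_def)
      from lattice_uminus[OF this]
      show "lat (conn v1 (base y)) + off y + z - (aj y - (aj ?q - z)) \<in> lattice C"
        by (simp add: off_def algebra_simps)
    qed
    have "(\<Sum>y\<in>marks. of_bool (y = ?q)) = (1::int)" using q_mark sub.finite_V by simp
    then show "(\<Sum>y\<in>marks. \<Theta> y - of_bool (y = ?q) - D' y) = 0"
      by (simp add: sum_subtractf sum_D' sum_\<Theta>)
    have "(\<Sum>y\<in>marks. real_of_int (of_bool (y = ?q)) *\<^sub>R aj y) = (\<Sum>y\<in>marks. if y = ?q then aj ?q else 0)"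
      by (intro sum.cong) auto
    also have "\<dots> = aj ?q" using q_mark sub.finite_V by simp
    finally have 3: "(\<Sum>y\<in>marks. real_of_int (\<Theta> y - of_bool (y = ?q) - D' y) *\<^sub>R aj y) =
        ?t - aj ?q - (\<Sum>p | D' p \<noteq> 0. real_of_int (D' p) *\<^sub>R aj p)"
      unfolding sum_D'_aj[symmetric] by (simp only: of_int_diff scaleR_left_diff_distrib sum_subtractf)
    \<comment> \<open>Jacobi inversion for the class of \<open>aj ?q - z\<close>, the retraction of
      \<open>D\<close> and the translation by \<open>lat a\<close> add up to the required linear
      equivalence once \<open>x = ?s + k\<close> is inserted.\<close>
    have "((?t + k) - (aj ?q - z)) + (?s - (\<Sum>p | D' p \<noteq> 0. real_of_int (D' p) *\<^sub>R aj p)) - lat a \<in> lattice C"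
      by (intro lattice_add lattice_diff 1 2 D'(5))
    then show "(\<Sum>y\<in>marks. real_of_int (\<Theta> y - of_bool (y = ?q) - D' y) *\<^sub>R aj y) \<in> lattice C"
      unfolding 3 z_def x_def by (simp add: algebra_simps)
  qed
  then show False using D'(3) by (meson not_le)
qed

end

theorem corollary8p6:
  fixes C :: "('v, 'e) metric_graph"
    and p0 :: "('v, 'e) point"
    and \<kappa> :: "(('e \<Rightarrow> real) \<Rightarrow> real) set"
  assumes "tropical_curve C"
    and "p0 \<in> points C"
    and "jacobi_inversion_constant C p0 \<kappa>"
  shows "(\<lambda>w. w + \<kappa>) ` W C p0 (int (genus C) - 1) = theta_divisor C"
proof -
  interpret pointed_tropical C p0
    using assms(1,2) by unfold_locales
  show ?thesis
  proof (intro subset_antisym subsetI)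
    fix j assume "j \<in> (\<lambda>w. w + \<kappa>) ` W C p0 (int (genus C) - 1)"
    then obtain D where "divisor C D" "effective D" "divisor_degree D = int (genus C) - 1"
      "j = abel_jacobi C p0 D + \<kappa>" by (auto simp: W_def)
    then show "j \<in> theta_divisor C" using effective_in_theta_divisor[OF assms(3)] by simp
  next
    fix j assume "j \<in> theta_divisor C"
    from theta_divisor_subset[OF assms(3) this]
    show "j \<in> (\<lambda>w. w + \<kappa>) ` W C p0 (int (genus C) - 1)" by (auto simp: W_def)
  qed
qed

end
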